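(* Let $n\geq 2$ and let $K\Subset\mathbb{C}^n$ be a regular compact set such that $\mathbb{C}^n\setminus K$ is connected. Suppose that $K=\bigcap_{j=1}^N\overline{V_j}$, where for $1\leq j\leq N$, $V_j\Subset\mathbb{C}^n$ is a Lipschitz domain such that $H^{0,n-1}_{W^1}(V_j)=0$. If $\mathbb{C}^n\setminus V_j$ is connected for each $j$, and $\mathbb{C}^n\setminus(V_i\cup V_j)$ is connected for each $1\leq i,j\leq N$, then $H^{0,n-1}_{W^1}(K)=0$.
   Context: A non-empty compact set $K$ is called regular if there is an open set $V$ with $K=\overline V$ and $V=\mathrm{interior}(K)$. For an open set $U\subset\mathbb{C}^n$, $W^1(U)$ is the Sobolev space of functions in $L^2(U)$ with all first partial derivatives in $L^2(U)$, $W^1_{p,q}(U)$ is the space of $(p,q)$-forms with coefficients in $W^1(U)$, and, with $\overline\partial$ in the sense of distributions, $$H^{p,q}_{W^1}(U)=\frac{\{f\in W^1_{p,q}(U):\overline\partial f=0\}}{\{\overline\partial g: g\in W^1_{p,q-1}(U),\ \overline\partial g\in W^1_{p,q}(U)\}}.$$ For a regular compact $K\subset\mathbb{C}^n$, the notation $H^{p,q}_{W^1}(K)=0$ means: if $f\in W^1_{p,q}(\mathbb{C}^n)$ satisfies $\overline\partial f=0$ on the set $K$, then there is $u\in W^1_{p,q-1}(\mathbb{C}^n)$ such that $\overline\partial u=f$ on the set $K$ (equalities of forms with $L^2$ coefficients, i.e. almost everywhere on $K$). *)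

theory Defs
  imports "HOL-Analysis.Analysis"
begin

definition regular_compact :: "'a::topological_space set \<Rightarrow> bool" where
  "regular_compact K \<longleftrightarrow>
     K \<noteq> {} \<and> compact K \<and> (\<exists>V. open V \<and> K = closure V \<and> V = interior K)"

text \<open>Near each boundary point the domain lies on one side of a Lipschitz graph over the
  hyperplane orthogonal to a unit vector \<open>v\<close>; choosing \<open>v\<close> amounts to choosing rotated
  coordinates, with \<open>inner x v\<close> as the last one.\<close>

definition lipschitz_boundary :: "'a::real_inner set \<Rightarrow> bool" where
  "lipschitz_boundary V \<longleftrightarrow>
     (\<forall>p\<in>frontier V. \<exists>r>0. \<exists>v. norm v = 1 \<and>
        (\<exists>\<psi> C. C-lipschitz_on {y. inner y v = 0} (\<psi> :: 'a \<Rightarrow> real) \<and>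
           V \<inter> ball p r = {x \<in> ball p r. inner x v < \<psi> (x - inner x v *\<^sub>R v)}))"

definition lipschitz_domain :: "'a::real_inner set \<Rightarrow> bool" where
  "lipschitz_domain V \<longleftrightarrow> open V \<and> connected V \<and> V \<noteq> {} \<and> lipschitz_boundary V"

primrec Ck :: "nat \<Rightarrow> ('a::euclidean_space \<Rightarrow> 'b::real_normed_vector) \<Rightarrow> bool" where
  "Ck 0 f \<longleftrightarrow> continuous_on UNIV f"
| "Ck (Suc k) f \<longleftrightarrow>
     f differentiable_on UNIV \<and> (\<forall>v\<in>Basis. Ck k (\<lambda>x. frechet_derivative f (at x) v))"

text \<open>Test functions on \<open>U\<close> are taken to be extended by zero to the whole space.\<close>

definition test_functions :: "'a::euclidean_space set \<Rightarrow> ('a \<Rightarrow> complex) set" where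
  "test_functions U =
     {\<phi>. (\<forall>k. Ck k \<phi>) \<and> compact (closure {x. \<phi> x \<noteq> 0}) \<and> closure {x. \<phi> x \<noteq> 0} \<subseteq> U}"

text \<open>Elements of the function spaces below are total functions rather than classes; their values
  outside \<open>U\<close> and on null sets are irrelevant.\<close>

definition L2 :: "'a::euclidean_space set \<Rightarrow> ('a \<Rightarrow> complex) set" where
  "L2 U = {f \<in> borel_measurable (lebesgue_on U). integrable (lebesgue_on U) (\<lambda>x. (cmod (f x))\<^sup>2)}"

definition weak_derivative ::
    "'a::euclidean_space set \<Rightarrow> 'a \<Rightarrow> ('a \<Rightarrow> complex) \<Rightarrow> ('a \<Rightarrow> complex) \<Rightarrow> bool" where
  "weak_derivative U v f g \<longleftrightarrow>
     (\<forall>\<phi>\<in>test_functions U.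
        (LINT x|lebesgue_on U. f x * frechet_derivative \<phi> (at x) v)
        = - (LINT x|lebesgue_on U. g x * \<phi> x))"

definition W1 :: "'a::euclidean_space set \<Rightarrow> ('a \<Rightarrow> complex) set" where
  "W1 U = {f \<in> L2 U. \<forall>v\<in>Basis. \<exists>g\<in>L2 U. weak_derivative U v f g}"

text \<open>A \<open>(p,q)\<close>-form is given by its coefficients: \<open>f I J\<close> is the coefficient of
  \<open>dz\<^sub>I \<and> dzbar\<^sub>J\<close>, the elements of \<open>I\<close> and \<open>J\<close> being taken in increasing order. Only
  the entries with \<open>card I = p\<close> and \<open>card J = q\<close> are meaningful.\<close>

type_synonym 'n form = "'n set \<Rightarrow> 'n set \<Rightarrow> complex^'n \<Rightarrow> complex"

definition L2_forms :: "nat \<Rightarrow> nat \<Rightarrow> (complex^'n) set \<Rightarrow> 'n form set" where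
  "L2_forms p q U = {f. \<forall>I J. card I = p \<and> card J = q \<longrightarrow> f I J \<in> L2 U}"

definition W1_forms :: "nat \<Rightarrow> nat \<Rightarrow> (complex^'n) set \<Rightarrow> 'n form set" where
  "W1_forms p q U = {f. \<forall>I J. card I = p \<and> card J = q \<longrightarrow> f I J \<in> W1 U}"

definition form_eq_on ::
    "nat \<Rightarrow> nat \<Rightarrow> (complex^'n) set \<Rightarrow> 'n form \<Rightarrow> 'n form \<Rightarrow> bool" where
  "form_eq_on p q S f g \<longleftrightarrow>
     (\<forall>I J. card I = p \<and> card J = q \<longrightarrow> (AE x in lebesgue. x \<in> S \<longrightarrow> f I J x = g I J x))"

definition form_zero :: "'n form" where
  "form_zero = (\<lambda>I J x. 0)"

definition form_diff :: "'n form \<Rightarrow> 'n form \<Rightarrow> 'n form" where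
  "form_diff f g = (\<lambda>I J x. f I J x - g I J x)"

definition zbar_derivative :: "'n \<Rightarrow> (complex^'n \<Rightarrow> complex) \<Rightarrow> complex^'n \<Rightarrow> complex" where
  "zbar_derivative k \<phi> x =
     (frechet_derivative \<phi> (at x) (axis k 1) + \<i> * frechet_derivative \<phi> (at x) (axis k \<i>)) / 2"

text \<open>\<open>weak_dbar p q U f h\<close>: the \<open>(p,q)\<close>-form \<open>f\<close> satisfies \<open>dbar f = h\<close> on \<open>U\<close> in the sense
  of distributions. The sign comes from
  \<open>dzbar\<^sub>k \<and> dz\<^sub>I \<and> dzbar\<^sub>J = (-1)^(p + card {l \<in> L. l < k}) dz\<^sub>I \<and> dzbar\<^sub>L\<close> where
  \<open>card I = p\<close>, \<open>k \<in> L\<close> and \<open>J = L - {k}\<close>. The notion is meant for \<open>f\<close> and \<open>h\<close> with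
  coefficients in \<open>L2 U\<close>.\<close>

definition weak_dbar ::
    "nat \<Rightarrow> nat \<Rightarrow> (complex^'n::{finite,linorder}) set \<Rightarrow> 'n form \<Rightarrow> 'n form \<Rightarrow> bool" where
  "weak_dbar p q U f h \<longleftrightarrow>
     (\<forall>I L. card I = p \<and> card L = Suc q \<longrightarrow>
        (\<forall>\<phi>\<in>test_functions U.
           (\<Sum>k\<in>L. (-1) ^ (p + card {l\<in>L. l < k}) *
              (LINT x|lebesgue_on U. f I (L - {k}) x * zbar_derivative k \<phi> x))
           = - (LINT x|lebesgue_on U. h I L x * \<phi> x)))"

definition W1_cocycles :: "nat \<Rightarrow> nat \<Rightarrow> (complex^'n::{finite,linorder}) set \<Rightarrow> 'n form set" where
  "W1_cocycles p q U = {f \<in> W1_forms p q U. weak_dbar p q U f form_zero}"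

text \<open>For \<open>q = 0\<close> there are no \<open>(p,q-1)\<close>-forms other than \<open>0\<close>.\<close>

definition W1_coboundaries :: "nat \<Rightarrow> nat \<Rightarrow> (complex^'n::{finite,linorder}) set \<Rightarrow> 'n form set" where
  "W1_coboundaries p q U =
     {f \<in> W1_forms p q U.
        if q = 0 then form_eq_on p q U f form_zero
        else \<exists>g\<in>W1_forms p (q - 1) U. weak_dbar p (q - 1) U g f}"

definition W1_cohomology :: "nat \<Rightarrow> nat \<Rightarrow> (complex^'n::{finite,linorder}) set \<Rightarrow> 'n form set set" where
  "W1_cohomology p q U =
     W1_cocycles p q U //
       {(f, f'). f \<in> W1_cocycles p q U \<and> f' \<in> W1_cocycles p q U \<and>
                 form_diff f f' \<in> W1_coboundaries p q U}"

text \<open>The quotient is the zero space iff it has exactly one element.\<close>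

definition W1_cohomology_vanishes :: "nat \<Rightarrow> nat \<Rightarrow> (complex^'n::{finite,linorder}) set \<Rightarrow> bool" where
  "W1_cohomology_vanishes p q U \<longleftrightarrow> is_singleton (W1_cohomology p q U)"

text \<open>For a form \<open>f\<close> with coefficients in \<open>W1 UNIV\<close>, the distribution \<open>dbar f\<close> on the whole
  space is a form with \<open>L2\<close> coefficients, unique almost everywhere; only this form is restricted
  to \<open>S\<close>.\<close>

definition dbar_eq_on ::
    "nat \<Rightarrow> nat \<Rightarrow> (complex^'n::{finite,linorder}) set \<Rightarrow> 'n form \<Rightarrow> 'n form \<Rightarrow> bool" where
  "dbar_eq_on p q S f g \<longleftrightarrow>
     (\<exists>h\<in>L2_forms p (Suc q) UNIV. weak_dbar p q UNIV f h \<and> form_eq_on p (Suc q) S h g)"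

definition compact_W1_cohomology_vanishes ::
    "nat \<Rightarrow> nat \<Rightarrow> (complex^'n::{finite,linorder}) set \<Rightarrow> bool" where
  "compact_W1_cohomology_vanishes p q K \<longleftrightarrow>
     (\<forall>f\<in>W1_forms p q UNIV. dbar_eq_on p q K f form_zero \<longrightarrow>
        (if q = 0 then form_eq_on p q K f form_zero
         else \<exists>u\<in>W1_forms p (q - 1) UNIV. dbar_eq_on p (q - 1) K u f))"

end

theory Submission
  imports Defs
begin

text \<open>The proof is a Mayer-Vietoris argument one degree below the top. Call a bounded set \<open>K\<close> good if
  every \<open>W\<^sup>1\<close> form of degree \<open>(0,n-1)\<close> whose dbar vanishes on \<open>K\<close> agrees on \<open>K\<close> with the dbar of a \<open>W\<^sup>1\<close>
  form. The closures of the given domains are good, and the intersection of two good sets is good;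
  induction on the number of domains gives the theorem.

  The intersection step is \<open>Mayer_Vietoris_vanishing\<close>. If \<open>h = dbar f\<close> vanishes on \<open>K1 \<inter> K2\<close>, let \<open>H\<close> be \<open>h\<close>
  with its values on \<open>K2\<close> replaced by zero. Both are forms of top degree, so \<open>H\<close> obeys no compatibility
  condition, and \<open>dbar \<omega> = H\<close> has a \<open>W\<^sup>1\<close> solution near \<open>K1 \<union> K2\<close> (\<open>top_degree_dbar\<close>). Now \<open>\<omega>\<close> is closed on
  \<open>K2\<close> and \<open>f - \<omega>\<close> is closed on \<open>K1\<close>; adding the two primitives gives a primitive of \<open>f\<close> on \<open>K1 \<inter> K2\<close>. The
  cutoff acts on \<open>h\<close>, which is merely square integrable, so it may jump at the boundary of \<open>K2\<close>, whereas a
  partition of unity for \<open>f\<close> itself would have to be smooth across sets that are not separated.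

  For a Lipschitz domain \<open>V\<close> (\<open>lipschitz_domain_vanishing\<close>), the hypothesis yields a \<open>W\<^sup>1\<close> primitive on \<open>V\<close>.
  Its coefficients extend to \<open>W\<^sup>1\<close> functions on the whole space (\<open>W1_extension\<close>), and as the frontier of
  \<open>V\<close> is a null set the equation also holds almost everywhere on the closure.

  Two pieces of analysis carry this. The first is Fourier series on a large cube. Frequencies are
  shifted by one half, so that zero is not a frequency and the dbar operator in top degree is inverted
  mode by mode, with the gain of one derivative. Identities between Fourier coefficients become
  identities between distributions (\<open>pairing_transfer\<close>), and a distributional derivative that is bounded
  in the square norm is a square integrable function (\<open>weak_dird_if_bounded\<close>).

  The second is even reflection across a Lipschitz graph, along the direction over which the graph is
  taken. This map preserves Lebesgue measure, so only the weak derivatives of the reflected function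
  are at stake. By the criterion just mentioned an estimate suffices (\<open>reflection_bound\<close>), and it is
  proved for smooth approximations of the graph with constants that depend on the Lipschitz constant
  only, so that it survives the passage to the limit.\<close>

section \<open>Smooth functions\<close>

abbreviation dird :: "'a::real_normed_vector \<Rightarrow> ('a \<Rightarrow> 'b::real_normed_vector) \<Rightarrow> 'a \<Rightarrow> 'b" where
  "dird v f \<equiv> (\<lambda>x. frechet_derivative f (at x) v)"

definition smooth :: "('a::euclidean_space \<Rightarrow> 'b::real_normed_vector) \<Rightarrow> bool" where
  "smooth f \<longleftrightarrow> (\<forall>k. Ck k f)"

lemma frechet_derivative_eqI: "(f has_derivative f') (at x) \<Longrightarrow> frechet_derivative f (at x) = f'"
  using frechet_derivative_at by metis

lemma Ck_SucI:
  assumes "\<And>x. (f has_derivative f' x) (at x)" "\<And>v. v \<in> Basis \<Longrightarrow> Ck k (\<lambda>x. f' x v)"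
  shows "Ck (Suc k) f"
proof -
  have "frechet_derivative f (at x) = f' x" for x
    using frechet_derivative_eqI[OF assms(1)] .
  then show ?thesis
    using assms by (auto simp: differentiable_on_def differentiable_def)
qed

lemma Ck_SucD:
  assumes "Ck (Suc k) f"
  shows "(f has_derivative frechet_derivative f (at x)) (at x)"
  using assms by (auto simp: differentiable_on_def frechet_derivative_works)

lemma Ck_Suc_imp: "Ck (Suc k) f \<Longrightarrow> Ck k f"
proof (induction k arbitrary: f)
  case 0
  then show ?case by (simp add: differentiable_imp_continuous_on)
next
  case (Suc k)
  show ?case
    by (rule Ck_SucI[OF Ck_SucD[OF Suc.prems]]) (use Suc in auto)
qed

lemma Ck_const: "Ck k (\<lambda>x. c)"
  by (induction k arbitrary: c) (auto intro!: Ck_SucI[where f'="\<lambda>x v. 0"] derivative_eq_intros)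

lemma Ck_bounded_linear: "bounded_linear f \<Longrightarrow> Ck k f"
  by (cases k)
     (auto simp del: Ck.simps(2) intro!: Ck_SucI[where f'="\<lambda>x. f"] Ck_const
       bounded_linear_imp_has_derivative linear_continuous_on)

lemma Ck_linear_compose:
  assumes "bounded_linear h" shows "Ck k f \<Longrightarrow> Ck k (\<lambda>x. h (f x))"
proof (induction k arbitrary: f)
  case 0
  then show ?case
    using bounded_linear.continuous_on[OF assms] by auto
next
  case (Suc k)
  show ?case
    by (rule Ck_SucI[OF bounded_linear.has_derivative[OF assms Ck_SucD[OF Suc.prems]]])
       (use Suc in auto)
qed

lemma Ck_add: "Ck k f \<Longrightarrow> Ck k g \<Longrightarrow> Ck k (\<lambda>x. f x + g x)"
proof (induction k arbitrary: f g)
  case 0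
  then show ?case by (auto intro: continuous_on_add)
next
  case (Suc k)
  show ?case
    by (rule Ck_SucI[OF has_derivative_add[OF Ck_SucD[OF Suc.prems(1)] Ck_SucD[OF Suc.prems(2)]]])
       (use Suc in auto)
qed

lemma Ck_sum:
  assumes "\<And>i. i \<in> I \<Longrightarrow> Ck k (f i)" shows "Ck k (\<lambda>x. \<Sum>i\<in>I. f i x)"
  using assms by (induction I rule: infinite_finite_induct) (auto intro: Ck_add Ck_const)

lemma Ck_bilinear:
  assumes "bounded_bilinear prd"
  shows "Ck k f \<Longrightarrow> Ck k g \<Longrightarrow> Ck k (\<lambda>x. prd (f x) (g x))"
proof (induction k arbitrary: f g)
  case 0
  then show ?case by (auto intro: bounded_bilinear.continuous_on[OF assms])
next
  case (Suc k)
  show ?case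
    by (rule Ck_SucI[OF bounded_bilinear.FDERIV[OF assms Ck_SucD[OF Suc.prems(1)] Ck_SucD[OF Suc.prems(2)]]],
        rule Ck_add; rule Suc.IH) (use Suc.prems Ck_Suc_imp[OF Suc.prems(1)] Ck_Suc_imp[OF Suc.prems(2)] in auto)
qed

lemma linear_Basis_expand:
  fixes D :: "'a::euclidean_space \<Rightarrow> 'b::real_vector"
  assumes "linear D" shows "D w = (\<Sum>b\<in>Basis. (w \<bullet> b) *\<^sub>R D b)"
proof -
  have "D w = D (\<Sum>b\<in>Basis. (w \<bullet> b) *\<^sub>R b)" by (simp add: euclidean_representation)
  also have "\<dots> = (\<Sum>b\<in>Basis. (w \<bullet> b) *\<^sub>R D b)"
    using assms by (simp add: linear_sum linear_scale)
  finally show ?thesis .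
qed

lemma Ck_compose:
  fixes G :: "'a::euclidean_space \<Rightarrow> 'b::euclidean_space"
  shows "Ck k \<phi> \<Longrightarrow> Ck k G \<Longrightarrow> Ck k (\<lambda>x. \<phi> (G x))"
proof (induction k arbitrary: \<phi>)
  case 0
  then show ?case by (auto intro: continuous_on_compose2)
next
  case (Suc k)
  let ?D = "\<lambda>x. \<lambda>v. \<Sum>b\<in>Basis. (frechet_derivative G (at x) v \<bullet> b) *\<^sub>R frechet_derivative \<phi> (at (G x)) b"
  have "((\<lambda>x. \<phi> (G x)) has_derivative (\<lambda>v. frechet_derivative \<phi> (at (G x)) (frechet_derivative G (at x) v))) (at x)" for x
    by (rule has_derivative_compose[OF Ck_SucD[OF Suc.prems(2)] Ck_SucD[OF Suc.prems(1)]])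
  moreover have "(\<lambda>v. frechet_derivative \<phi> (at (G x)) (frechet_derivative G (at x) v)) = ?D x" for x
    by (rule ext, rule linear_Basis_expand)
       (use Ck_SucD[OF Suc.prems(1), of "G x"] has_derivative_linear in blast)
  ultimately have d: "((\<lambda>x. \<phi> (G x)) has_derivative ?D x) (at x)" for x by metis
  show ?case
  proof (rule Ck_SucI[OF d], intro Ck_sum Ck_bilinear[OF bounded_bilinear_scaleR])
    fix v b :: 'a and c :: 'b assume "v \<in> Basis" "c \<in> Basis"
    show "Ck k (\<lambda>x. frechet_derivative G (at x) v \<bullet> c)"
      using Suc.prems(2) \<open>v \<in> Basis\<close>
      by (intro Ck_linear_compose[OF bounded_linear_inner_left]) auto
    show "Ck k (\<lambda>x. frechet_derivative \<phi> (at (G x)) c)"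
      using Suc.prems \<open>c \<in> Basis\<close> by (intro Suc.IH Ck_Suc_imp[of k G]) auto
  qed
qed

lemma smooth_const: "smooth (\<lambda>x. c)"
  by (simp add: smooth_def Ck_const)

lemma smooth_bounded_linear: "bounded_linear f \<Longrightarrow> smooth f"
  by (simp add: smooth_def Ck_bounded_linear)

lemma smooth_linear_compose: "bounded_linear h \<Longrightarrow> smooth f \<Longrightarrow> smooth (\<lambda>x. h (f x))"
  by (simp add: smooth_def Ck_linear_compose)

lemma smooth_add: "smooth f \<Longrightarrow> smooth g \<Longrightarrow> smooth (\<lambda>x. f x + g x)"
  by (simp add: smooth_def Ck_add)

lemma smooth_sum: "(\<And>i. i \<in> I \<Longrightarrow> smooth (f i)) \<Longrightarrow> smooth (\<lambda>x. \<Sum>i\<in>I. f i x)"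
  by (simp add: smooth_def Ck_sum)

lemma smooth_mult:
  fixes f g :: "_ \<Rightarrow> 'b::real_normed_algebra"
  shows "smooth f \<Longrightarrow> smooth g \<Longrightarrow> smooth (\<lambda>x. f x * g x)"
  by (simp add: smooth_def Ck_bilinear[OF bounded_bilinear_mult])

lemma smooth_scaleR: "smooth f \<Longrightarrow> smooth g \<Longrightarrow> smooth (\<lambda>x. f x *\<^sub>R g x)"
  by (simp add: smooth_def Ck_bilinear[OF bounded_bilinear_scaleR])

lemma smooth_minus: "smooth f \<Longrightarrow> smooth g \<Longrightarrow> smooth (\<lambda>x. f x - g x)"
  using smooth_add[of f "\<lambda>x. - g x"] smooth_linear_compose[OF bounded_linear_minus[OF bounded_linear_ident], of g] by simp

lemma smooth_compose:
  fixes G :: "'a::euclidean_space \<Rightarrow> 'b::euclidean_space"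
  shows "smooth \<phi> \<Longrightarrow> smooth G \<Longrightarrow> smooth (\<lambda>x. \<phi> (G x))"
  by (simp add: smooth_def Ck_compose)

lemma smooth_prod:
  fixes f :: "'i \<Rightarrow> 'a::euclidean_space \<Rightarrow> real"
  shows "(\<And>i. i \<in> I \<Longrightarrow> smooth (f i)) \<Longrightarrow> smooth (\<lambda>x. \<Prod>i\<in>I. f i x)"
  by (induction I rule: infinite_finite_induct) (auto intro: smooth_mult smooth_const)

lemma smooth_has_derivative: "smooth f \<Longrightarrow> (f has_derivative frechet_derivative f (at x)) (at x)"
  using Ck_SucD[of 0 f x] by (simp add: smooth_def del: Ck.simps)

lemma smooth_continuous: "smooth f \<Longrightarrow> continuous_on S f"
  unfolding smooth_def by (metis Ck.simps(1) continuous_on_subset subset_UNIV)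

lemma smooth_dird:
  assumes "smooth f" shows "smooth (dird v f)"
proof -
  have "Ck k (dird b f)" if "b \<in> Basis" for b k
    using assms that unfolding smooth_def by (metis Ck.simps(2))
  then have *: "smooth (dird b f)" if "b \<in> Basis" for b
    using that by (simp add: smooth_def)
  have "dird v f = (\<lambda>x. \<Sum>b\<in>Basis. (v \<bullet> b) *\<^sub>R dird b f x)"
    by (rule ext, rule linear_Basis_expand) (use smooth_has_derivative[OF assms] has_derivative_linear in blast)
  then show ?thesis
    using * by (auto intro!: smooth_sum smooth_scaleR smooth_const)
qed

text \<open>Functions are smooth as soon as they belong to a family that is closed under differentiation:
  all its members gain one order of differentiability at a time.\<close>

lemma smooth_family:
  fixes f :: "'i \<Rightarrow> 'a::euclidean_space \<Rightarrow> 'b::real_normed_vector"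
  assumes d: "\<And>i x. i \<in> I \<Longrightarrow> (f i has_derivative f' i x) (at x)"
    and e: "\<And>i v k. i \<in> I \<Longrightarrow> v \<in> Basis \<Longrightarrow> (\<And>j. j \<in> I \<Longrightarrow> Ck k (f j)) \<Longrightarrow> Ck k (\<lambda>x. f' i x v)"
    and i: "i \<in> I"
  shows "smooth (f i)"
proof -
  have "\<forall>i\<in>I. Ck k (f i)" for k
  proof (induction k)
    case 0
    then show ?case
      using d by (auto intro!: continuous_at_imp_continuous_on has_derivative_continuous)
  next
    case (Suc k)
    then show ?case using Ck_SucI[OF d e] by blast
  qed
  then show ?thesis using i by (auto simp: smooth_def)
qed

text \<open>The functions \<open>exp (-1/s) / s^m\<close>, continued by zero. The derivative of each is a combination of
  two others, which makes them a family as in \<open>smooth_family\<close>.\<close>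

definition flat :: "nat \<Rightarrow> real \<Rightarrow> real" where
  "flat m s = (if s > 0 then exp (- inverse s) * inverse s ^ m else 0)"

lemma flat_tendsto_0: "(flat m \<longlongrightarrow> 0) (at 0)"
proof -
  have "((\<lambda>s. inverse s ^ m / exp (inverse s)) \<longlongrightarrow> (0::real)) (at_right 0)"
    by (rule filterlim_compose[OF tendsto_power_div_exp_0 filterlim_inverse_at_top_right])
  then have "(flat m \<longlongrightarrow> 0) (at_right 0)"
    by (rule Lim_transform_eventually)
       (auto simp: eventually_at_right_less flat_def exp_minus field_simps intro!: eventually_mono[OF eventually_at_right_less])
  moreover have "(flat m \<longlongrightarrow> 0) (at_left 0)"
    by (rule Lim_transform_eventually[OF tendsto_const])
       (auto simp: flat_def eventually_at_filter)
  ultimately show ?thesis by (simp add: filterlim_split_at)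
qed

lemma flat_has_field_derivative:
  "(flat m has_field_derivative flat (m + 2) s - real m * flat (m + 1) s) (at s)"
proof -
  consider "s > 0" | "s < 0" | "s = 0" by linarith
  then show ?thesis
  proof cases
    case 1
    have "((\<lambda>s. exp (- inverse s) * inverse s ^ m) has_field_derivative flat (m + 2) s - real m * flat (m + 1) s) (at s)"
    proof (cases m)
      case (Suc j)
      have "s ^ j = s * s ^ (j - Suc 0) \<or> j = 0" by (cases j) auto
      with Suc show ?thesis
        using 1 by (auto intro!: derivative_eq_intros simp: flat_def field_simps power2_eq_square)
    qed (use 1 in \<open>auto intro!: derivative_eq_intros simp: flat_def field_simps power2_eq_square\<close>)
    then show ?thesis
      by (rule has_field_derivative_transform_within_open[where S="{0<..}"])
         (use 1 in \<open>auto simp: flat_def\<close>)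
  next
    case 2
    have "((\<lambda>s::real. 0) has_field_derivative flat (m + 2) s - real m * flat (m + 1) s) (at s)"
      using 2 by (auto simp: flat_def)
    then show ?thesis
      by (rule has_field_derivative_transform_within_open[where S="{..<0}"])
         (use 2 in \<open>auto simp: flat_def\<close>)
  next
    case 3
    have "((\<lambda>y. (flat m y - flat m 0) / (y - 0)) \<longlongrightarrow> 0) (at 0)"
      by (rule Lim_transform_eventually[OF flat_tendsto_0[of "m+1"]])
         (auto simp: flat_def eventually_at_filter field_simps)
    then show ?thesis
      using 3 by (simp add: has_field_derivative_iff flat_def)
  qed
qed

lemma smooth_flat: "smooth (flat m)"
proof (rule smooth_family[where I=UNIV and f=flat and f'="\<lambda>m s h. h * (flat (m + 2) s - real m * flat (m + 1) s)"])
  fix i :: nat and x :: real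
  show "(flat i has_derivative (\<lambda>h. h * (flat (i + 2) x - real i * flat (i + 1) x))) (at x)"
    using has_derivative_imp_has_field_derivative flat_has_field_derivative[of i x]
    unfolding has_field_derivative_def by (subst mult.commute) (simp only:)
next
  fix i k :: nat and v :: real assume "v \<in> Basis" and *: "\<And>j. j \<in> UNIV \<Longrightarrow> Ck k (flat j)"
  then have "Ck k (\<lambda>x. flat (i + 2) x + (- real i) *\<^sub>R flat (i + 1) x)"
    by (intro Ck_add Ck_bilinear[OF bounded_bilinear_scaleR] Ck_const) auto
  with \<open>v \<in> Basis\<close> show "Ck k (\<lambda>x. v * (flat (i + 2) x - real i * flat (i + 1) x))"
    by simp
qed auto

lemma exists_smooth_bump:
  fixes e :: real assumes "e > 0"
  obtains \<beta> :: "'a::euclidean_space \<Rightarrow> real"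
  where "smooth \<beta>" "\<And>x. \<beta> x \<ge> 0" "\<beta> 0 > 0" "\<And>x. norm x \<ge> e \<Longrightarrow> \<beta> x = 0"
proof -
  \<comment> \<open>the norm is at most the sum of the coordinates, so each may use the share \<open>e / DIM('a)\<close>\<close>
  define d where "d = e / real DIM('a)"
  have d: "d > 0" using assms by (simp add: d_def)
  define \<beta> where "\<beta> x = (\<Prod>b\<in>Basis. flat 0 (d + x \<bullet> b) * flat 0 (d - x \<bullet> b))" for x :: 'a
  have bl: "bounded_linear (\<lambda>x::'a. x \<bullet> b)" for b by (rule bounded_linear_inner_left)
  have "smooth \<beta>"
    unfolding \<beta>_def
    by (intro smooth_prod smooth_mult smooth_compose[OF smooth_flat] smooth_add smooth_minus
        smooth_const smooth_bounded_linear[OF bl])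
  moreover have "\<beta> x \<ge> 0" for x
    by (auto simp: \<beta>_def flat_def intro!: prod_nonneg)
  moreover have "\<beta> 0 > 0"
    using d by (auto simp: \<beta>_def flat_def intro!: prod_pos)
  moreover have "\<beta> x = 0" if "norm x \<ge> e" for x
  proof (rule ccontr)
    assume "\<beta> x \<noteq> 0"
    then have *: "\<bar>x \<bullet> b\<bar> < d" if "b \<in> Basis" for b
      using that by (fastforce simp: \<beta>_def flat_def split: if_splits)
    have "norm x \<le> (\<Sum>b\<in>Basis. \<bar>x \<bullet> b\<bar>)" by (rule norm_le_l1)
    also have "\<dots> < (\<Sum>b\<in>(Basis::'a set). d)" by (rule sum_strict_mono) (use * in auto)
    also have "\<dots> = e" by (simp add: d_def)
    finally show False using that by simp
  qed
  ultimately show thesis using that by blast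
qed

section \<open>Mollification and cutoff functions\<close>

lemma directional_quotient_tendsto:
  fixes f :: "'a::real_normed_vector \<Rightarrow> 'b::real_normed_vector"
  assumes "(f has_derivative D) (at x)"
  shows "((\<lambda>t. (f (x + t *\<^sub>R v) - f x) /\<^sub>R t) \<longlongrightarrow> D v) (at 0)"
proof -
  interpret D: bounded_linear D using assms has_derivative_bounded_linear by blast
  have "((\<lambda>t. f (x + t *\<^sub>R v)) has_derivative (\<lambda>t. D (t *\<^sub>R v))) (at 0)"
    by (rule has_derivative_compose[where g=f]) (use assms in \<open>auto intro!: derivative_eq_intros\<close>)
  then have "((\<lambda>t. norm (f (x + t *\<^sub>R v) - f x - D (t *\<^sub>R v)) / norm t) \<longlongrightarrow> 0) (at 0)"
    by (simp add: has_derivative_iff_norm)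
  then have "((\<lambda>t. norm ((f (x + t *\<^sub>R v) - f x) /\<^sub>R t - D v)) \<longlongrightarrow> 0) (at 0)"
  proof (rule Lim_transform_eventually)
    have "norm (f (x + t *\<^sub>R v) - f x - D (t *\<^sub>R v)) / norm t = norm ((f (x + t *\<^sub>R v) - f x) /\<^sub>R t - D v)"
      if "t \<noteq> 0" for t
    proof -
      have "(f (x + t *\<^sub>R v) - f x) /\<^sub>R t - D v = (f (x + t *\<^sub>R v) - f x - D (t *\<^sub>R v)) /\<^sub>R t"
        using that by (simp add: D.scaleR scaleR_right_diff_distrib)
      then show ?thesis by (simp add: divide_inverse_commute)
    qed
    then show "\<forall>\<^sub>F t in at 0. norm (f (x + t *\<^sub>R v) - f x - D (t *\<^sub>R v)) / norm t = norm ((f (x + t *\<^sub>R v) - f x) /\<^sub>R t - D v)"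
      by (simp add: eventually_at_filter)
  qed
  then show ?thesis
    by (simp add: LIM_zero_cancel tendsto_norm_zero_iff)
qed

lemma norm_derivative_le_lipschitz:
  assumes "(f has_derivative D) (at x)" "C-lipschitz_on UNIV f"
  shows "norm (D v) \<le> C * norm v"
proof -
  have "((\<lambda>t. norm ((f (x + t *\<^sub>R v) - f x) /\<^sub>R t)) \<longlongrightarrow> norm (D v)) (at 0)"
    by (intro tendsto_norm directional_quotient_tendsto assms)
  moreover have "norm ((f (x + t *\<^sub>R v) - f x) /\<^sub>R t) \<le> C * norm v" if "t \<noteq> 0" for t
  proof -
    have "norm (f (x + t *\<^sub>R v) - f x) \<le> C * (\<bar>t\<bar> * norm v)"
      using lipschitz_onD[OF assms(2), of "x + t *\<^sub>R v" x] by (simp add: dist_norm)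
    then have "norm (f (x + t *\<^sub>R v) - f x) / \<bar>t\<bar> \<le> C * norm v"
      using that by (simp add: field_simps)
    then show ?thesis by (simp add: divide_inverse_commute)
  qed
  ultimately show ?thesis
    by (intro tendsto_upperbound[of _ _ "at 0"]) (auto simp: eventually_at_filter)
qed

lemma integrable_continuous_compact_support:
  fixes g :: "'a::euclidean_space \<Rightarrow> 'b::{banach, second_countable_topology}"
  assumes "continuous_on UNIV g" "compact S" "\<And>x. x \<notin> S \<Longrightarrow> g x = 0"
  shows "integrable lborel g"
proof -
  have "integrable lborel (\<lambda>x. indicator S x *\<^sub>R g x)"
    by (rule borel_integrable_compact[OF assms(2)]) (use assms(1) continuous_on_subset in blast)
  moreover have "(\<lambda>x. indicator S x *\<^sub>R g x) = g"
    using assms(3) by (auto simp: indicator_def)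
  ultimately show ?thesis by simp
qed

lemma lborel_distr_reflect:
  fixes c :: "'a::euclidean_space"
  shows "distr lborel borel (\<lambda>x. c - x) = lborel"
  using lborel_affine[of "-1" c] by (simp add: density_1 one_ennreal_def[symmetric])

lemma lborel_integral_reflect:
  fixes f :: "'a::euclidean_space \<Rightarrow> 'b::{banach, second_countable_topology}"
  assumes "f \<in> borel_measurable borel"
  shows "(LINT y|lborel. f (c - y)) = integral\<^sup>L lborel f"
proof -
  have "integral\<^sup>L lborel f = integral\<^sup>L (distr lborel borel (\<lambda>x. c - x)) f"
    by (simp only: lborel_distr_reflect)
  also have "\<dots> = (LINT y|lborel. f (c - y))"
    using assms by (intro integral_distr) auto
  finally show ?thesis by simp
qed

definition mollify :: "('a::euclidean_space \<Rightarrow> real) \<Rightarrow> ('a \<Rightarrow> real) \<Rightarrow> 'a \<Rightarrow> real" where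
  "mollify \<rho> f x = (LINT y|lborel. f y * \<rho> (x - y))"

text \<open>The derivative falls on the kernel. For points near \<open>x0\<close> the integral extends over one fixed
  box, and there differentiation under the integral sign is available.\<close>

lemma mollify_has_derivative:
  fixes \<rho> f :: "'a::euclidean_space \<Rightarrow> real"
  assumes \<rho>: "smooth \<rho>" and supp: "\<And>x. norm x > e \<Longrightarrow> \<rho> x = 0" and f: "continuous_on UNIV f"
  shows "(mollify \<rho> f has_derivative (\<lambda>v. mollify (dird v \<rho>) f x0)) (at x0)"
proof -
  obtain a where a: "cball x0 (1 + e) \<subseteq> cbox (-a) a"
    using bounded_subset_cbox_symmetric[OF bounded_cball] by blast
  have cont\<rho>: "continuous_on UNIV (\<lambda>p. \<rho> (fst p - snd p))"
    by (intro continuous_on_compose2[OF smooth_continuous[OF \<rho>, of UNIV]] continuous_intros) auto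
  have contd: "continuous_on UNIV (dird v \<rho>)" for v
    by (rule smooth_continuous[OF smooth_dird[OF \<rho>]])
  have dsupp: "dird v \<rho> x = 0" if "norm x > e" for v x
  proof -
    have "open {x::'a. norm x > e}" by (rule open_Collect_less) (auto intro: continuous_intros)
    then have "(\<rho> has_derivative (\<lambda>v. 0)) (at x)"
      by (rule has_derivative_transform_within_open[OF has_derivative_const[of 0]]) (use that supp in auto)
    then show ?thesis by (simp add: frechet_derivative_eqI)
  qed
  have loc: "(LINT y|lborel. f y * k (x - y)) = integral (cbox (-a) a) (\<lambda>y. f y * k (x - y))"
    if k: "continuous_on UNIV k" "\<And>x. norm x > e \<Longrightarrow> k x = 0" and x: "x \<in> ball x0 1" for k x
  proof -
    have z: "f y * k (x - y) = 0" if "y \<notin> cbox (-a) a" for y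
    proof -
      have "y \<notin> cball x0 (1 + e)" using a that by blast
      then have "norm (x - y) > e"
        using x norm_triangle_ineq[of "x0 - x" "x - y"] by (auto simp: dist_norm)
      then show ?thesis using k by simp
    qed
    have "continuous_on UNIV (\<lambda>y. f y * k (x - y))"
      by (intro continuous_intros f continuous_on_compose2[OF k(1)]) auto
    then have "integrable lborel (\<lambda>y. f y * k (x - y))"
      using z by (intro integrable_continuous_compact_support[of _ "cbox (-a) a"]) auto
    then have "((\<lambda>y. f y * k (x - y)) has_integral (LINT y|lborel. f y * k (x - y))) UNIV"
      by (rule has_integral_integral_lborel)
    then have "((\<lambda>y. f y * k (x - y)) has_integral (LINT y|lborel. f y * k (x - y))) (cbox (-a) a)"
    proof (subst has_integral_restrict_UNIV[symmetric])
      assume "((\<lambda>y. f y * k (x - y)) has_integral (LINT y|lborel. f y * k (x - y))) UNIV"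
      moreover have "(\<lambda>y. if y \<in> cbox (-a) a then f y * k (x - y) else 0) = (\<lambda>y. f y * k (x - y))"
        using z by (intro ext) (auto simp del: mult_eq_0_iff)
      ultimately show "((\<lambda>y. if y \<in> cbox (-a) a then f y * k (x - y) else 0) has_integral (LINT y|lborel. f y * k (x - y))) UNIV"
        by (simp only:)
    qed
    then show ?thesis by (simp add: integral_unique)
  qed
  define fx where "fx = (\<lambda>x y. Blinfun (\<lambda>v. f y * frechet_derivative \<rho> (at (x - y)) v))"
  have bl: "bounded_linear (\<lambda>v. f y * frechet_derivative \<rho> (at (x - y)) v)" for x y
    using has_derivative_bounded_linear[OF smooth_has_derivative[OF \<rho>]]
    by (intro bounded_linear_const_mult)
  have fx: "blinfun_apply (fx x y) v = f y * dird v \<rho> (x - y)" for x y v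
    unfolding fx_def by (simp add: bounded_linear_Blinfun_apply[OF bl])
  have contfx: "continuous_on UNIV (\<lambda>p. fx (fst p) (snd p))"
  proof (rule continuous_on_blinfun_componentwise)
    fix i :: 'a
    have 1: "continuous_on UNIV (\<lambda>p::'a\<times>'a. f (snd p))"
      by (intro continuous_on_compose2[OF f] continuous_intros) auto
    have 2: "continuous_on UNIV (\<lambda>p::'a\<times>'a. dird i \<rho> (fst p - snd p))"
      by (intro continuous_on_compose2[OF contd] continuous_intros) auto
    show "continuous_on UNIV (\<lambda>p. blinfun_apply (fx (fst p) (snd p)) i)"
      unfolding fx by (intro continuous_intros 1 2)
  qed
  have "((\<lambda>x. integral (cbox (-a) a) (\<lambda>y. f y * \<rho> (x - y))) has_derivative
          blinfun_apply (integral (cbox (-a) a) (fx x0))) (at x0 within ball x0 1)"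
  proof (rule leibniz_rule)
    fix x y assume "x \<in> ball x0 1" "y \<in> cbox (-a) a"
    have "((\<lambda>x. \<rho> (x - y)) has_derivative (\<lambda>v. frechet_derivative \<rho> (at (x - y)) v)) (at x)"
      by (rule has_derivative_compose[where g=\<rho>, OF _ smooth_has_derivative[OF \<rho>]])
         (auto intro!: derivative_eq_intros)
    then have "((\<lambda>x. f y * \<rho> (x - y)) has_derivative blinfun_apply (fx x y)) (at x)"
      by (auto intro!: derivative_eq_intros simp: fx)
    then show "((\<lambda>x. f y * \<rho> (x - y)) has_derivative blinfun_apply (fx x y)) (at x within ball x0 1)"
      by (rule has_derivative_at_withinI)
  next
    fix x assume "x \<in> ball x0 1"
    have "continuous_on (cbox (-a) a) (\<lambda>y. f y * \<rho> (x - y))"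
      by (intro continuous_intros continuous_on_subset[OF f]
          continuous_on_compose2[OF smooth_continuous[OF \<rho>, of UNIV]]) auto
    then show "(\<lambda>y. f y * \<rho> (x - y)) integrable_on cbox (- a) a" by (rule integrable_continuous)
  next
    show "continuous_on (ball x0 1 \<times> cbox (- a) a) (\<lambda>(x, t). fx x t)"
      using continuous_on_subset[OF contfx] by (simp add: split_beta)
  qed auto
  moreover have "blinfun_apply (integral (cbox (-a) a) (fx x0)) = (\<lambda>v. mollify (dird v \<rho>) f x0)"
  proof
    fix v
    have "continuous_on (cbox (-a) a) (fx x0)"
      using continuous_on_compose2[OF contfx, of "cbox (-a) a" "\<lambda>y. (x0, y)"]
      by (simp add: continuous_intros)
    then have "fx x0 integrable_on cbox (-a) a" by (rule integrable_continuous)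
    then have "blinfun_apply (integral (cbox (-a) a) (fx x0)) v = integral (cbox (-a) a) (\<lambda>y. blinfun_apply (fx x0 y) v)"
      by (rule blinfun_apply_integral)
    also have "\<dots> = mollify (dird v \<rho>) f x0"
      unfolding mollify_def fx by (rule loc[symmetric]) (use contd dsupp in auto)
    finally show "blinfun_apply (integral (cbox (-a) a) (fx x0)) v = mollify (dird v \<rho>) f x0" .
  qed
  ultimately have "((\<lambda>x. integral (cbox (-a) a) (\<lambda>y. f y * \<rho> (x - y))) has_derivative
          (\<lambda>v. mollify (dird v \<rho>) f x0)) (at x0)"
    using at_within_open[of x0 "ball x0 1"] by (simp only: open_ball centre_in_ball zero_less_one simp_thms)
  then show ?thesis
    by (rule has_derivative_transform_within_open[of _ _ _ _ "ball x0 1"])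
       (use loc[OF smooth_continuous[OF \<rho>] supp] in \<open>auto simp: mollify_def\<close>)
qed

lemma dird_zero_outside_closed:
  assumes "closed S" "\<And>x. x \<notin> S \<Longrightarrow> f x = 0" "x \<notin> S"
  shows "dird v f x = 0"
proof -
  have "(f has_derivative (\<lambda>v. 0)) (at x)"
    by (rule has_derivative_transform_within_open[OF has_derivative_const[of 0], where s="-S"])
       (use assms in auto)
  then show ?thesis by (simp add: frechet_derivative_eqI)
qed

text \<open>The mollifications of \<open>f\<close> by all smooth kernels supported in one ball form a family that is
  closed under differentiation.\<close>

lemma smooth_mollify:
  fixes \<rho> f :: "'a::euclidean_space \<Rightarrow> real"
  assumes \<rho>: "smooth \<rho>" and supp: "\<And>x. norm x > e \<Longrightarrow> \<rho> x = 0" and f: "continuous_on UNIV f"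
  shows "smooth (mollify \<rho> f)"
proof -
  define I where "I = {\<rho>::'a \<Rightarrow> real. smooth \<rho> \<and> (\<forall>x. norm x > e \<longrightarrow> \<rho> x = 0)}"
  have dI: "dird v k \<in> I" if "k \<in> I" for k v
    using that smooth_dird[of k v] dird_zero_outside_closed[of "cball 0 e" k]
    by (auto simp: I_def)
  show ?thesis
  proof (rule smooth_family[where I=I and f="\<lambda>\<rho>. mollify \<rho> f" and f'="\<lambda>\<rho> x v. mollify (dird v \<rho>) f x"])
    show "(mollify k f has_derivative (\<lambda>v. mollify (dird v k) f x)) (at x)" if "k \<in> I" for k x
      using that by (intro mollify_has_derivative[where e=e] f) (auto simp: I_def)
    show "\<rho> \<in> I" using assms by (auto simp: I_def)
    fix i v k assume "i \<in> I" "\<And>j. j \<in> I \<Longrightarrow> Ck k (mollify j f)"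
    then have "Ck k (mollify (dird v i) f)" using dI by blast
    then show "Ck k (\<lambda>x. mollify (dird v i) f x)" .
  qed
qed

definition mollifier :: "real \<Rightarrow> ('a::euclidean_space \<Rightarrow> real) \<Rightarrow> bool" where
  "mollifier e \<rho> \<longleftrightarrow> smooth \<rho> \<and> (\<forall>x. \<rho> x \<ge> 0) \<and> (\<forall>x. norm x > e \<longrightarrow> \<rho> x = 0) \<and> integral\<^sup>L lborel \<rho> = 1"

lemma exists_mollifier:
  assumes "e > 0" obtains \<rho> :: "'a::euclidean_space \<Rightarrow> real" where "mollifier e \<rho>"
proof -
  obtain \<beta> :: "'a \<Rightarrow> real"
    where \<beta>: "smooth \<beta>" "\<And>x. \<beta> x \<ge> 0" "\<beta> 0 > 0" "\<And>x. norm x \<ge> e \<Longrightarrow> \<beta> x = 0"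
    using exists_smooth_bump[OF assms] by blast
  have cont: "continuous_on UNIV \<beta>" by (rule smooth_continuous[OF \<beta>(1)])
  have int: "integrable lborel \<beta>"
    by (rule integrable_continuous_compact_support[OF cont, of "cball 0 e"]) (use \<beta>(4) in auto)
  have "integral\<^sup>L lborel \<beta> \<noteq> 0"
  proof
    assume "integral\<^sup>L lborel \<beta> = 0"
    then have "AE x in lborel. \<beta> x = 0"
      using integral_nonneg_eq_0_iff_AE[OF int] \<beta>(2) by auto
    then have "AE x in lebesgue. \<beta> x = 0" by (rule AE_completion)
    moreover have op: "open {x. \<beta> x \<noteq> 0}"
      by (intro open_Collect_neq cont continuous_intros)
    then have "{x. \<beta> x \<noteq> 0} \<in> sets lebesgue" by simp
    ultimately have "negligible {x. \<beta> x \<noteq> 0}"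
      by (subst (asm) AE_iff_null) (auto simp: negligible_iff_null_sets)
    moreover note op
    moreover have "{x. \<beta> x \<noteq> 0} \<noteq> {}" using \<beta>(3) by force
    ultimately show False using open_not_negligible by blast
  qed
  moreover have "integral\<^sup>L lborel \<beta> \<ge> 0" using \<beta>(2) by simp
  ultimately have pos: "integral\<^sup>L lborel \<beta> > 0" by simp
  have "mollifier e (\<lambda>x. inverse (integral\<^sup>L lborel \<beta>) * \<beta> x)"
    unfolding mollifier_def using pos \<beta> by (auto intro!: smooth_mult smooth_const)
  then show thesis by (rule that)
qed

context
  fixes \<rho> f :: "'a::euclidean_space \<Rightarrow> real" and e :: real
  assumes \<rho>: "mollifier e \<rho>" and f: "continuous_on UNIV f"
begin

lemma mollifier_smooth: "smooth \<rho>"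
  and mollifier_nonneg: "\<rho> x \<ge> 0"
  and mollifier_supp: "norm x > e \<Longrightarrow> \<rho> x = 0"
  and mollifier_integral: "integral\<^sup>L lborel \<rho> = 1"
  using \<rho> unfolding mollifier_def by auto

lemma mollify_smooth: "smooth (mollify \<rho> f)"
  by (rule smooth_mollify[OF mollifier_smooth mollifier_supp f])

lemma mollify_alt: "mollify \<rho> f x = (LINT y|lborel. f (x - y) * \<rho> y)"
proof -
  have [measurable]: "f \<in> borel_measurable borel" "\<rho> \<in> borel_measurable borel"
    using f smooth_continuous[OF mollifier_smooth, of UNIV] by (auto intro: borel_measurable_continuous_onI)
  show ?thesis
    unfolding mollify_def
    by (subst lborel_integral_reflect[of _ x, symmetric]) auto
qed

lemma mollify_integrable: "integrable lborel (\<lambda>y. f (x - y) * \<rho> y)"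
  by (rule integrable_continuous_compact_support[where S="cball 0 e"])
     (use mollifier_supp smooth_continuous[OF mollifier_smooth]
      in \<open>auto intro!: continuous_intros continuous_on_compose2[OF f]\<close>)

lemma integrable_mollifier: "integrable lborel \<rho>"
  using mollifier_integral not_integrable_integral_eq by fastforce

text \<open>A mollification averages the values of \<open>f\<close> near \<open>x\<close>. With \<open>a = b\<close> this shows that it
  reproduces \<open>f\<close> exactly where \<open>f\<close> is locally constant, which is how cutoff functions are made.\<close>

lemma mollify_between:
  assumes "\<And>y. norm y \<le> e \<Longrightarrow> a \<le> f (x - y) \<and> f (x - y) \<le> b"
  shows "a \<le> mollify \<rho> f x" "mollify \<rho> f x \<le> b"
proof -
  have *: "a * \<rho> y \<le> f (x - y) * \<rho> y \<and> f (x - y) * \<rho> y \<le> b * \<rho> y" for y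
    using assms[of y] mollifier_supp[of y] mollifier_nonneg[of y]
    by (cases "norm y \<le> e") (auto intro: mult_right_mono)
  have "(LINT y|lborel. a * \<rho> y) \<le> (LINT y|lborel. f (x - y) * \<rho> y)"
    by (rule integral_mono) (use * mollify_integrable integrable_mollifier in auto)
  then show "a \<le> mollify \<rho> f x" using mollifier_integral by (simp add: mollify_alt)
  have "(LINT y|lborel. f (x - y) * \<rho> y) \<le> (LINT y|lborel. b * \<rho> y)"
    by (rule integral_mono) (use * mollify_integrable integrable_mollifier in auto)
  then show "mollify \<rho> f x \<le> b" using mollifier_integral by (simp add: mollify_alt)
qed

lemma mollify_lipschitz:
  assumes "C-lipschitz_on UNIV f" shows "C-lipschitz_on UNIV (mollify \<rho> f)"
proof (rule lipschitz_onI)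
  show "C \<ge> 0" using assms lipschitz_on_nonneg by blast
  fix x x' :: 'a
  have "mollify \<rho> f x - mollify \<rho> f x' = (LINT y|lborel. (f (x - y) - f (x' - y)) * \<rho> y)"
    unfolding mollify_alt by (subst Bochner_Integration.integral_diff[symmetric])
      (auto simp: mollify_integrable left_diff_distrib)
  also have "\<bar>\<dots>\<bar> \<le> (LINT y|lborel. \<bar>(f (x - y) - f (x' - y)) * \<rho> y\<bar>)"
    by (rule integral_abs_bound)
  also have "\<dots> \<le> (LINT y|lborel. C * dist x x' * \<rho> y)"
  proof (rule integral_mono)
    show "integrable lborel (\<lambda>y. \<bar>(f (x - y) - f (x' - y)) * \<rho> y\<bar>)"
      by (intro integrable_abs) (simp add: left_diff_distrib mollify_integrable)
    show "integrable lborel (\<lambda>y. C * dist x x' * \<rho> y)" using integrable_mollifier by simp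
    fix y
    have "\<bar>f (x - y) - f (x' - y)\<bar> \<le> C * dist x x'"
      using lipschitz_onD[OF assms, of "x - y" "x' - y"] by (simp add: dist_norm)
    then show "\<bar>(f (x - y) - f (x' - y)) * \<rho> y\<bar> \<le> C * dist x x' * \<rho> y"
      using mollifier_nonneg by (simp add: abs_mult mult_right_mono)
  qed
  also have "\<dots> = C * dist x x'" using mollifier_integral by simp
  finally show "dist (mollify \<rho> f x) (mollify \<rho> f x') \<le> C * dist x x'" by (simp add: dist_real_def)
qed

end

lemma lipschitz_clip_infdist:
  assumes "d > 0"
  shows "(1/d)-lipschitz_on UNIV (\<lambda>x. max 0 (min 1 (2 - infdist x C / d)) :: real)"
proof (rule lipschitz_onI)
  fix x y :: 'a
  have "\<bar>(2 - infdist x C / d) - (2 - infdist y C / d)\<bar> = \<bar>infdist x C - infdist y C\<bar> / d"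
    using assms by (simp add: abs_divide[symmetric] diff_divide_distrib[symmetric] abs_minus_commute)
  also have "\<dots> \<le> 1 / d * dist x y"
    using infdist_triangle_abs[of x C y] assms by (simp add: divide_right_mono)
  finally show "dist (max 0 (min 1 (2 - infdist x C / d))) (max 0 (min 1 (2 - infdist y C / d))) \<le> 1 / d * dist x y"
    by (auto simp: dist_real_def)
qed (use assms in auto)

lemma exists_smooth_cutoff:
  fixes C U :: "'a::euclidean_space set"
  assumes "compact C" "open U" "C \<subseteq> U"
  obtains \<theta> :: "'a \<Rightarrow> real" and W S where "smooth \<theta>" "\<And>x. 0 \<le> \<theta> x \<and> \<theta> x \<le> 1"
    "open W" "C \<subseteq> W" "\<And>x. x \<in> W \<Longrightarrow> \<theta> x = 1" "compact S" "S \<subseteq> U" "\<And>x. x \<notin> S \<Longrightarrow> \<theta> x = 0"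
proof (cases "C = {}")
  case True
  then show ?thesis
    by (intro that[of "\<lambda>x. 0" "{}" "{}"]) (auto intro: smooth_const)
next
  case False
  obtain r where r: "r > 0" "(\<Union>x\<in>C. cball x r) \<subseteq> U"
    using compact_subset_open_imp_cball_epsilon_subset[OF assms] by blast
  define d where "d = r / 3"
  have d: "d > 0" using r by (simp add: d_def)
  \<comment> \<open>equal to 1 up to distance \<open>d\<close> and to 0 from distance \<open>2 d\<close> on, so a kernel of radius \<open>d / 2\<close> leaves both regions intact nearby\<close>
  define f where "f x = max 0 (min 1 (2 - infdist x C / d))" for x :: 'a
  have f: "continuous_on UNIV f"
    unfolding f_def using lipschitz_clip_infdist[OF d] by (rule lipschitz_on_continuous_on)
  have f01: "0 \<le> f x \<and> f x \<le> 1" for x by (simp add: f_def)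
  obtain \<rho> :: "'a \<Rightarrow> real" where \<rho>: "mollifier (d/2) \<rho>" using exists_mollifier[of "d/2"] d by auto
  have near: "infdist (x - y) C \<le> infdist x C + norm y" "infdist x C \<le> infdist (x - y) C + norm y" for x y
    using infdist_triangle[of "x - y" C x] infdist_triangle[of x C "x - y"] by (auto simp: dist_norm)
  show ?thesis
  proof (rule that[of "mollify \<rho> f" "{x. infdist x C < d / 2}" "{x. infdist x C \<le> r}"])
    show "smooth (mollify \<rho> f)" by (rule mollify_smooth[OF \<rho> f])
    show "0 \<le> mollify \<rho> f x \<and> mollify \<rho> f x \<le> 1" for x
      using mollify_between[OF \<rho> f, of 0 x 1] f01 by auto
    show "open {x. infdist x C < d / 2}" by (intro open_Collect_less continuous_intros)
    show "C \<subseteq> {x. infdist x C < d / 2}" using d by auto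
    show "mollify \<rho> f x = 1" if "x \<in> {x. infdist x C < d / 2}" for x
    proof -
      have "f (x - y) = 1" if "norm y \<le> d / 2" for y
      proof -
        have "infdist (x - y) C / d \<le> 1"
          using that \<open>x \<in> _\<close> near(1)[of x y] d by (auto simp: field_simps)
        then show ?thesis by (auto simp: f_def)
      qed
      then show ?thesis using mollify_between[OF \<rho> f, of 1 x 1] by force
    qed
    show "compact {x. infdist x C \<le> r}" by (rule compact_infdist_le[OF False assms(1) r(1)])
    show "{x. infdist x C \<le> r} \<subseteq> U"
    proof
      fix x assume "x \<in> {x. infdist x C \<le> r}"
      then have le: "infdist x C \<le> r" by simp
      obtain c where "c \<in> C" "infdist x C = dist x c"
        using infdist_attains_inf[OF compact_imp_closed[OF assms(1)] False] .
      with le have "c \<in> C" "dist x c \<le> r" by simp_all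
      then have "x \<in> cball c r" by (simp add: dist_commute)
      then show "x \<in> U" using r(2) \<open>c \<in> C\<close> by blast
    qed
    show "mollify \<rho> f x = 0" if "x \<notin> {x. infdist x C \<le> r}" for x
    proof -
      have "f (x - y) = 0" if "norm y \<le> d / 2" for y
      proof -
        have "infdist (x - y) C / d \<ge> 2"
          using that \<open>x \<notin> _\<close> near(2)[of x y] d by (auto simp: field_simps d_def)
        then show ?thesis by (auto simp: f_def)
      qed
      then show ?thesis using mollify_between[OF \<rho> f, of 0 x 0] by force
    qed
  qed
qed

lemma exists_smooth_step:
  obtains \<eta> :: "real \<Rightarrow> real" where "smooth \<eta>" "\<And>t. 0 \<le> \<eta> t \<and> \<eta> t \<le> 1"
    "\<And>t. t \<le> 1 \<Longrightarrow> \<eta> t = 0" "\<And>t. t \<ge> 2 \<Longrightarrow> \<eta> t = 1" "2-lipschitz_on UNIV \<eta>"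
proof -
  define f where "f t = max 0 (min 1 (2 * t - 5/2))" for t :: real
  have lip: "2-lipschitz_on UNIV f"
  proof (rule lipschitz_onI)
    fix x y :: real
    have "\<bar>f x - f y\<bar> \<le> 2 * \<bar>x - y\<bar>" unfolding f_def by (simp add: max_def min_def abs_if)
    then show "dist (f x) (f y) \<le> 2 * dist x y" by (simp add: dist_real_def)
  qed simp
  then have f: "continuous_on UNIV f" by (rule lipschitz_on_continuous_on)
  obtain \<rho> :: "real \<Rightarrow> real" where \<rho>: "mollifier (1/4) \<rho>" using exists_mollifier[of "1/4"] by auto
  show ?thesis
  proof (rule that[of "mollify \<rho> f"])
    show "smooth (mollify \<rho> f)" by (rule mollify_smooth[OF \<rho> f])
    show "0 \<le> mollify \<rho> f t \<and> mollify \<rho> f t \<le> 1" for t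
      using mollify_between[OF \<rho> f, of 0 t 1] by (auto simp: f_def)
    show "mollify \<rho> f t = 0" if "t \<le> 1" for t
      using mollify_between[OF \<rho> f, of 0 t 0] that by (force simp: f_def)
    show "mollify \<rho> f t = 1" if "t \<ge> 2" for t
      using mollify_between[OF \<rho> f, of 1 t 1] that by (force simp: f_def)
    show "2-lipschitz_on UNIV (mollify \<rho> f)" by (rule mollify_lipschitz[OF \<rho> f lip])
  qed
qed

section \<open>Square integrable functions\<close>

definition l2 :: "('a::euclidean_space \<Rightarrow> complex) \<Rightarrow> bool" where
  "l2 f \<longleftrightarrow> f \<in> borel_measurable lebesgue \<and> integrable lebesgue (\<lambda>x. (cmod (f x))\<^sup>2)"

definition zero_ext :: "'a set \<Rightarrow> ('a \<Rightarrow> complex) \<Rightarrow> 'a \<Rightarrow> complex" where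
  "zero_ext U f = (\<lambda>x. if x \<in> U then f x else 0)"

lemma continuous_imp_lebesgue_measurable:
  fixes f :: "'a::euclidean_space \<Rightarrow> 'b::topological_space"
  assumes "continuous_on UNIV f" shows "f \<in> borel_measurable lebesgue"
proof -
  have "f \<in> borel_measurable lborel" using borel_measurable_continuous_onI[OF assms] by simp
  then show ?thesis by (rule measurable_completion)
qed

lemma L2_iff: "U \<in> sets lebesgue \<Longrightarrow> f \<in> L2 U \<longleftrightarrow> l2 (zero_ext U f)"
proof -
  assume U: "U \<in> sets lebesgue"
  have "(\<lambda>x. (cmod (zero_ext U f x))\<^sup>2) = (\<lambda>x. if x \<in> U then (cmod (f x))\<^sup>2 else 0)"
    by (auto simp: zero_ext_def)
  then show ?thesis
    using U by (simp add: L2_def l2_def borel_measurable_if zero_ext_def[of U f] Lebesgue_Measure.integrable_restrict_UNIV[OF U, symmetric])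
qed

lemma L2_UNIV_iff: "f \<in> L2 UNIV \<longleftrightarrow> l2 f"
  by (simp add: L2_def l2_def lebesgue_on_UNIV_eq)

lemma l2_measurable: "l2 f \<Longrightarrow> f \<in> borel_measurable lebesgue"
  by (simp add: l2_def)

lemma l2_square_integrable: "l2 f \<Longrightarrow> integrable lebesgue (\<lambda>x. (cmod (f x))\<^sup>2)"
  by (simp add: l2_def)

lemma l2_dominated:
  assumes "l2 f" "g \<in> borel_measurable lebesgue" "AE x in lebesgue. cmod (g x) \<le> C * cmod (f x)"
  shows "l2 g"
proof -
  have [measurable]: "g \<in> borel_measurable lebesgue" by fact
  have "integrable lebesgue (\<lambda>x. (cmod (g x))\<^sup>2)"
  proof (rule Bochner_Integration.integrable_bound)
    show "integrable lebesgue (\<lambda>x. C\<^sup>2 * (cmod (f x))\<^sup>2)"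
      using l2_square_integrable[OF assms(1)] by simp
    show "AE x in lebesgue. norm ((cmod (g x))\<^sup>2) \<le> norm (C\<^sup>2 * (cmod (f x))\<^sup>2)"
      using assms(3)
    proof eventually_elim
      case (elim x)
      then have "(cmod (g x))\<^sup>2 \<le> (C * cmod (f x))\<^sup>2" by (intro power_mono) auto
      then show ?case by (simp add: power_mult_distrib)
    qed
  qed simp
  then show ?thesis using assms(2) by (simp add: l2_def)
qed

lemma l2_bounded_mult:
  assumes "l2 f" "b \<in> borel_measurable lebesgue" "\<And>x. cmod (b x) \<le> C"
  shows "l2 (\<lambda>x. b x * f x)"
proof (rule l2_dominated[OF assms(1)])
  show "(\<lambda>x. b x * f x) \<in> borel_measurable lebesgue"
    using assms(2) l2_measurable[OF assms(1)] by (rule borel_measurable_times)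
  show "AE x in lebesgue. cmod (b x * f x) \<le> C * cmod (f x)"
    using assms(3) by (simp add: norm_mult mult_right_mono)
qed

lemma l2_cmult: "l2 f \<Longrightarrow> l2 (\<lambda>x. c * f x)"
  by (rule l2_bounded_mult[where C="cmod c"]) auto

lemma l2_zero_ext: "l2 f \<Longrightarrow> A \<in> sets lebesgue \<Longrightarrow> l2 (zero_ext A f)"
  by (rule l2_dominated[of f _ 1]) (auto simp: zero_ext_def dest: l2_measurable)

lemma l2_zero: "l2 (\<lambda>x. 0)" by (simp add: l2_def)

lemma l2_add:
  assumes "l2 f" "l2 g" shows "l2 (\<lambda>x. f x + g x)"
proof -
  have [measurable]: "f \<in> borel_measurable lebesgue" "g \<in> borel_measurable lebesgue"
    using assms l2_measurable by auto
  have "integrable lebesgue (\<lambda>x. (cmod (f x + g x))\<^sup>2)"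
  proof (rule Bochner_Integration.integrable_bound)
    show "integrable lebesgue (\<lambda>x. 2 * (cmod (f x))\<^sup>2 + 2 * (cmod (g x))\<^sup>2)"
      using assms by (auto dest!: l2_square_integrable)
    have "(cmod (f x + g x))\<^sup>2 \<le> 2 * (cmod (f x))\<^sup>2 + 2 * (cmod (g x))\<^sup>2" for x
    proof -
      have "(cmod (f x + g x))\<^sup>2 \<le> (cmod (f x) + cmod (g x))\<^sup>2"
        by (intro power_mono norm_triangle_ineq) auto
      also have "\<dots> \<le> 2 * (cmod (f x))\<^sup>2 + 2 * (cmod (g x))\<^sup>2"
        using zero_le_power2[of "cmod (f x) - cmod (g x)"] by (simp add: power2_eq_square algebra_simps)
      finally show ?thesis .
    qed
    then show "AE x in lebesgue. norm ((cmod (f x + g x))\<^sup>2) \<le> norm (2 * (cmod (f x))\<^sup>2 + 2 * (cmod (g x))\<^sup>2)"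
      by (auto simp: abs_of_nonneg)
  qed simp
  then show ?thesis by (simp add: l2_def)
qed

lemma l2_diff: "l2 f \<Longrightarrow> l2 g \<Longrightarrow> l2 (\<lambda>x. f x - g x)"
  using l2_add[of f "\<lambda>x. (-1) * g x"] l2_cmult[of g "-1"] by simp

lemma l2_sum: "(\<And>i. i \<in> I \<Longrightarrow> l2 (f i)) \<Longrightarrow> l2 (\<lambda>x. \<Sum>i\<in>I. f i x)"
  by (induction I rule: infinite_finite_induct) (auto intro: l2_add l2_zero)

lemma l2_mult_integrable:
  assumes "l2 f" "l2 g" shows "integrable lebesgue (\<lambda>x. f x * g x)"
proof (rule Bochner_Integration.integrable_bound)
  show "integrable lebesgue (\<lambda>x. (cmod (f x))\<^sup>2 + (cmod (g x))\<^sup>2)"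
    using assms by (auto dest!: l2_square_integrable)
  show "(\<lambda>x. f x * g x) \<in> borel_measurable lebesgue"
    using assms by (auto dest!: l2_measurable)
  have "cmod (f x * g x) \<le> (cmod (f x))\<^sup>2 + (cmod (g x))\<^sup>2" for x
  proof -
    have "0 \<le> cmod (f x) * cmod (g x)" by simp
    then show ?thesis
      using zero_le_power2[of "cmod (f x) - cmod (g x)"]
      unfolding norm_mult power2_diff by linarith
  qed
  then show "AE x in lebesgue. norm (f x * g x) \<le> norm ((cmod (f x))\<^sup>2 + (cmod (g x))\<^sup>2)"
    by (auto simp: abs_of_nonneg)
qed

definition l2norm :: "('a::euclidean_space \<Rightarrow> complex) \<Rightarrow> real" where
  "l2norm f = sqrt (LINT x|lebesgue. (cmod (f x))\<^sup>2)"

lemma l2norm_nonneg: "l2norm f \<ge> 0"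
  by (simp add: l2norm_def)

lemma l2norm_square: "(l2norm f)\<^sup>2 = (LINT x|lebesgue. (cmod (f x))\<^sup>2)"
  by (simp add: l2norm_def)

text \<open>The pairing is bilinear, without a conjugate, to match the definition of weak derivatives.\<close>

definition pairing :: "('a::euclidean_space \<Rightarrow> complex) \<Rightarrow> ('a \<Rightarrow> complex) \<Rightarrow> complex" where
  "pairing f g = (LINT x|lebesgue. f x * g x)"

text \<open>The best weight is \<open>t = B / A\<close>; adding a small \<open>d\<close> to numerator and denominator keeps it
  admissible when one of them vanishes.\<close>

lemma le_sqrt_mult_if_weighted:
  fixes X A B :: real
  assumes "A \<ge> 0" "B \<ge> 0" "\<And>t. t > 0 \<Longrightarrow> 2 * X \<le> t * A\<^sup>2 + B\<^sup>2 / t"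
  shows "X \<le> A * B"
proof (rule field_le_epsilon)
  fix e :: real assume e: "e > 0"
  define d where "d = e / (A + B + 1)"
  have d: "d > 0" "d * (A + B) \<le> e"
    using assms e by (auto simp: d_def field_simps)
  have "2 * X \<le> (B + d) / (A + d) * A\<^sup>2 + B\<^sup>2 / ((B + d) / (A + d))"
    using assms(1,2) d by (intro assms(3)) auto
  also have "(B + d) / (A + d) * A\<^sup>2 \<le> (B + d) * A"
  proof -
    have "A\<^sup>2 / (A + d) \<le> A" using assms d by (simp add: divide_le_eq power2_eq_square mult_left_mono)
    then have "(B + d) * (A\<^sup>2 / (A + d)) \<le> (B + d) * A" using assms d by (intro mult_left_mono) auto
    then show ?thesis by simp
  qed
  also have "B\<^sup>2 / ((B + d) / (A + d)) \<le> (A + d) * B"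
  proof -
    have "B\<^sup>2 / (B + d) \<le> B" using assms d by (simp add: divide_le_eq power2_eq_square mult_left_mono)
    then have "(A + d) * (B\<^sup>2 / (B + d)) \<le> (A + d) * B" using assms d by (intro mult_left_mono) auto
    then show ?thesis by (simp add: mult.commute)
  qed
  finally have "2 * X \<le> 2 * (A * B) + d * (A + B)" by (simp add: algebra_simps)
  then show "X \<le> A * B + e" using d e by linarith
qed

lemma Cauchy_Schwarz_pairing:
  assumes "l2 f" "l2 g" shows "cmod (pairing f g) \<le> l2norm f * l2norm g"
proof -
  have "cmod (pairing f g) \<le> (LINT x|lebesgue. cmod (f x * g x))"
    unfolding pairing_def by (rule integral_norm_bound)
  also have "\<dots> \<le> l2norm f * l2norm g"
  proof (rule le_sqrt_mult_if_weighted)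
    fix t :: real assume t: "t > 0"
    have "2 * (LINT x|lebesgue. cmod (f x * g x)) = (LINT x|lebesgue. 2 * cmod (f x * g x))" by simp
    also have "\<dots> \<le> (LINT x|lebesgue. t * (cmod (f x))\<^sup>2 + (cmod (g x))\<^sup>2 / t)"
    proof (rule integral_mono)
      show "integrable lebesgue (\<lambda>x. 2 * cmod (f x * g x))"
        using l2_mult_integrable[OF assms] by (intro integrable_mult_right integrable_norm)
      show "integrable lebesgue (\<lambda>x. t * (cmod (f x))\<^sup>2 + (cmod (g x))\<^sup>2 / t)"
        using assms by (auto dest!: l2_square_integrable)
      fix x
      have "0 \<le> (t * cmod (f x) - cmod (g x))\<^sup>2 / t" using t by simp
      also have "\<dots> = t * (cmod (f x))\<^sup>2 + (cmod (g x))\<^sup>2 / t - 2 * cmod (f x * g x)"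
        using t by (simp add: power2_eq_square field_simps norm_mult)
      finally show "2 * cmod (f x * g x) \<le> t * (cmod (f x))\<^sup>2 + (cmod (g x))\<^sup>2 / t" by simp
    qed
    also have "\<dots> = t * (l2norm f)\<^sup>2 + (l2norm g)\<^sup>2 / t"
      using l2_square_integrable[OF assms(1)] l2_square_integrable[OF assms(2)] by (simp add: l2norm_square)
    finally show "2 * (LINT x|lebesgue. cmod (f x * g x)) \<le> t * (l2norm f)\<^sup>2 + (l2norm g)\<^sup>2 / t" .
  qed (auto simp: l2norm_nonneg)
  finally show ?thesis .
qed

lemma l2norm_mono:
  assumes "l2 f" "l2 g" "AE x in lebesgue. cmod (f x) \<le> C * cmod (g x)" "C \<ge> 0"
  shows "l2norm f \<le> C * l2norm g"
proof -
  have "(l2norm f)\<^sup>2 \<le> (LINT x|lebesgue. C\<^sup>2 * (cmod (g x))\<^sup>2)"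
    unfolding l2norm_square
  proof (rule integral_mono_AE)
    show "AE x in lebesgue. (cmod (f x))\<^sup>2 \<le> C\<^sup>2 * (cmod (g x))\<^sup>2"
      using assms(3) by eventually_elim (metis norm_ge_zero power_mono power_mult_distrib)
  qed (use assms l2_square_integrable in auto)
  also have "\<dots> = (C * l2norm g)\<^sup>2" by (simp add: power_mult_distrib l2norm_square)
  finally show ?thesis by (rule power2_le_imp_le) (intro mult_nonneg_nonneg assms(4) l2norm_nonneg)
qed

lemma pairing_add_left: "l2 f \<Longrightarrow> l2 g \<Longrightarrow> l2 h \<Longrightarrow> pairing (\<lambda>x. f x + g x) h = pairing f h + pairing g h"
  unfolding pairing_def by (subst Bochner_Integration.integral_add[symmetric]) (auto simp: l2_mult_integrable distrib_right)

lemma pairing_diff_left: "l2 f \<Longrightarrow> l2 g \<Longrightarrow> l2 h \<Longrightarrow> pairing (\<lambda>x. f x - g x) h = pairing f h - pairing g h"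
  unfolding pairing_def by (subst Bochner_Integration.integral_diff[symmetric]) (auto simp: l2_mult_integrable left_diff_distrib)

lemma pairing_add_right: "l2 f \<Longrightarrow> l2 g \<Longrightarrow> l2 h \<Longrightarrow> pairing h (\<lambda>x. f x + g x) = pairing h f + pairing h g"
  unfolding pairing_def by (subst Bochner_Integration.integral_add[symmetric]) (auto simp: l2_mult_integrable distrib_left)

lemma pairing_diff_right: "l2 f \<Longrightarrow> l2 g \<Longrightarrow> l2 h \<Longrightarrow> pairing h (\<lambda>x. f x - g x) = pairing h f - pairing h g"
  unfolding pairing_def by (subst Bochner_Integration.integral_diff[symmetric]) (auto simp: l2_mult_integrable right_diff_distrib)

lemma pairing_cmult_left: "pairing (\<lambda>x. c * f x) g = c * pairing f g"
  unfolding pairing_def by (simp add: mult.assoc)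

lemma pairing_cmult_right: "pairing f (\<lambda>x. c * g x) = c * pairing f g"
  unfolding pairing_def by (simp add: mult.left_commute)

lemma pairing_sum_left:
  "(\<And>i. i \<in> I \<Longrightarrow> l2 (f i)) \<Longrightarrow> l2 g \<Longrightarrow> pairing (\<lambda>x. \<Sum>i\<in>I. f i x) g = (\<Sum>i\<in>I. pairing (f i) g)"
  unfolding pairing_def sum_distrib_right
  by (rule Bochner_Integration.integral_sum) (auto simp: l2_mult_integrable)

lemma pairing_sum_right:
  "(\<And>i. i \<in> I \<Longrightarrow> l2 (f i)) \<Longrightarrow> l2 g \<Longrightarrow> pairing g (\<lambda>x. \<Sum>i\<in>I. f i x) = (\<Sum>i\<in>I. pairing g (f i))"
  unfolding pairing_def sum_distrib_left
  by (rule Bochner_Integration.integral_sum) (auto simp: l2_mult_integrable)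

lemma pairing_commute: "pairing f g = pairing g f"
  by (simp add: pairing_def mult.commute)

lemma pairing_cong_AE:
  assumes "f \<in> borel_measurable lebesgue" "f' \<in> borel_measurable lebesgue" "g \<in> borel_measurable lebesgue"
    "g' \<in> borel_measurable lebesgue" "AE x in lebesgue. f x * g x = f' x * g' x"
  shows "pairing f g = pairing f' g'"
  unfolding pairing_def using assms by (intro integral_cong_AE) auto

lemma l2_continuous_compact_support:
  fixes g :: "'a::euclidean_space \<Rightarrow> complex"
  assumes "continuous_on UNIV g" "compact S" "\<And>x. x \<notin> S \<Longrightarrow> g x = 0"
  shows "l2 g"
proof -
  have "integrable lborel (\<lambda>x. (cmod (g x))\<^sup>2)"
    by (rule integrable_continuous_compact_support[OF _ assms(2)]) (use assms in \<open>auto intro!: continuous_intros\<close>)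
  then have "integrable lebesgue (\<lambda>x. (cmod (g x))\<^sup>2)"
    by (subst integrable_completion) auto
  moreover have "g \<in> borel_measurable lebesgue"
    using assms(1) by (rule continuous_imp_lebesgue_measurable)
  ultimately show ?thesis by (simp add: l2_def)
qed

lemma l2_indicator_compact:
  assumes "compact C" shows "l2 (indicator C :: 'a::euclidean_space \<Rightarrow> complex)"
proof -
  have C[measurable]: "C \<in> sets borel" using assms by (simp add: compact_imp_closed)
  have "integrable lborel (\<lambda>x. indicator C x *\<^sub>R (1::real))" by (rule borel_integrable_compact[OF assms]) simp
  then have "integrable lebesgue (indicator C :: 'a \<Rightarrow> real)"
    by (subst integrable_completion) auto
  moreover have "(\<lambda>x. (cmod (indicator C x))\<^sup>2) = (indicator C :: 'a \<Rightarrow> real)"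
    by (auto simp: indicator_def)
  moreover have "C \<in> sets lebesgue" using C by simp
  then have "(indicator C :: 'a \<Rightarrow> complex) \<in> borel_measurable lebesgue"
    by (rule borel_measurable_indicator)
  ultimately show ?thesis by (simp add: l2_def)
qed

section \<open>Test functions\<close>

lemma test_functionsI:
  assumes "smooth \<phi>" "compact S" "S \<subseteq> U" "\<And>x. x \<notin> S \<Longrightarrow> \<phi> x = 0"
  shows "\<phi> \<in> test_functions U"
proof -
  have "closure {x. \<phi> x \<noteq> 0} \<subseteq> S"
    by (rule closure_minimal) (use assms compact_imp_closed in auto)
  then show ?thesis
    using assms closed_Int_compact[OF closed_closure[of "{x. \<phi> x \<noteq> 0}"] assms(2)]
    by (auto simp: test_functions_def smooth_def Int_absorb2)
qed

lemma test_functionsE: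
  assumes "\<phi> \<in> test_functions U"
  obtains S where "smooth \<phi>" "compact S" "S \<subseteq> U" "\<And>x. x \<notin> S \<Longrightarrow> \<phi> x = 0"
proof
  show "compact (closure {x. \<phi> x \<noteq> 0})" "closure {x. \<phi> x \<noteq> 0} \<subseteq> U" "smooth \<phi>"
    using assms by (auto simp: test_functions_def smooth_def)
  show "\<phi> x = 0" if "x \<notin> closure {x. \<phi> x \<noteq> 0}" for x
    using that subsetD[OF closure_subset, of x "{x. \<phi> x \<noteq> 0}"] by auto
qed

lemma test_smooth: "\<phi> \<in> test_functions U \<Longrightarrow> smooth \<phi>"
  by (auto elim: test_functionsE)

lemma test_mono: "\<phi> \<in> test_functions U \<Longrightarrow> U \<subseteq> U' \<Longrightarrow> \<phi> \<in> test_functions U'"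
  by (auto simp: test_functions_def)

lemma test_zero_outside: "\<phi> \<in> test_functions U \<Longrightarrow> x \<notin> U \<Longrightarrow> \<phi> x = 0"
  by (auto elim!: test_functionsE)

lemma test_smooth_mult:
  assumes "\<phi> \<in> test_functions U" "smooth \<theta>" "closed T" "\<And>x. x \<notin> T \<Longrightarrow> \<theta> x = 0" "U \<inter> T \<subseteq> W"
  shows "(\<lambda>x. \<theta> x * \<phi> x) \<in> test_functions W"
proof -
  obtain S where S: "smooth \<phi>" "compact S" "S \<subseteq> U" "\<And>x. x \<notin> S \<Longrightarrow> \<phi> x = 0"
    using assms(1) by (auto elim: test_functionsE)
  show ?thesis
    by (rule test_functionsI[of _ "S \<inter> T"])
       (use S assms in \<open>auto intro: smooth_mult compact_Int_closed\<close>)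
qed

lemma test_mult: "\<phi> \<in> test_functions U \<Longrightarrow> smooth \<theta> \<Longrightarrow> (\<lambda>x. \<theta> x * \<phi> x) \<in> test_functions U"
  by (rule test_smooth_mult[where T=UNIV]) auto

lemma test_cmult: "\<phi> \<in> test_functions U \<Longrightarrow> (\<lambda>x. c * \<phi> x) \<in> test_functions U"
  by (rule test_mult[OF _ smooth_const])

lemma test_add:
  assumes "\<phi> \<in> test_functions U" "\<psi> \<in> test_functions U" shows "(\<lambda>x. \<phi> x + \<psi> x) \<in> test_functions U"
proof -
  obtain S where S: "smooth \<phi>" "compact S" "S \<subseteq> U" "\<And>x. x \<notin> S \<Longrightarrow> \<phi> x = 0"
    using assms(1) by (auto elim: test_functionsE)
  obtain T where T: "smooth \<psi>" "compact T" "T \<subseteq> U" "\<And>x. x \<notin> T \<Longrightarrow> \<psi> x = 0"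
    using assms(2) by (auto elim: test_functionsE)
  show ?thesis
    by (rule test_functionsI[of _ "S \<union> T"]) (use S T in \<open>auto intro: smooth_add\<close>)
qed

lemma test_dird:
  assumes "\<phi> \<in> test_functions U" shows "dird v \<phi> \<in> test_functions U"
proof -
  obtain S where S: "smooth \<phi>" "compact S" "S \<subseteq> U" "\<And>x. x \<notin> S \<Longrightarrow> \<phi> x = 0"
    using assms(1) by (auto elim: test_functionsE)
  show ?thesis
    by (rule test_functionsI[of _ "S"])
       (use S dird_zero_outside_closed[OF compact_imp_closed[OF S(2)] S(4)] in \<open>auto intro: smooth_dird\<close>)
qed

lemma test_l2: "\<phi> \<in> test_functions U \<Longrightarrow> l2 \<phi>"
  by (auto elim!: test_functionsE intro: l2_continuous_compact_support smooth_continuous)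

lemma test_measurable: "\<phi> \<in> test_functions U \<Longrightarrow> \<phi> \<in> borel_measurable lebesgue"
  by (simp add: test_l2 l2_measurable)

lemma test_bounded:
  assumes "\<phi> \<in> test_functions U" obtains M where "M \<ge> 0" "\<And>x. cmod (\<phi> x) \<le> M"
proof -
  obtain S where S: "smooth \<phi>" "compact S" "S \<subseteq> U" "\<And>x. x \<notin> S \<Longrightarrow> \<phi> x = 0"
    using assms(1) by (auto elim: test_functionsE)
  have "bounded (\<phi> ` S)"
    using compact_continuous_image[OF smooth_continuous[OF S(1)] S(2)] compact_imp_bounded by blast
  then obtain M where "\<And>x. x \<in> S \<Longrightarrow> cmod (\<phi> x) \<le> M" by (auto simp: bounded_iff)
  then have "cmod (\<phi> x) \<le> max M 0" for x using S(4)[of x] by (cases "x \<in> S") fastforce+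
  then show ?thesis by (intro that[of "max M 0"]) auto
qed

lemma dird_linear: "smooth f \<Longrightarrow> dird v f x = (\<Sum>b\<in>Basis. (v \<bullet> b) *\<^sub>R dird b f x)"
  by (rule linear_Basis_expand) (use smooth_has_derivative has_derivative_linear in blast)

lemma dird_add: "smooth f \<Longrightarrow> smooth g \<Longrightarrow> dird v (\<lambda>x. f x + g x) x = dird v f x + dird v g x"
  by (subst frechet_derivative_eqI[OF has_derivative_add[OF smooth_has_derivative smooth_has_derivative]]) auto

lemma dird_mult:
  fixes f g :: "'a::euclidean_space \<Rightarrow> 'b::real_normed_algebra"
  shows "smooth f \<Longrightarrow> smooth g \<Longrightarrow> dird v (\<lambda>x. f x * g x) x = f x * dird v g x + dird v f x * g x"
  by (subst frechet_derivative_eqI[OF has_derivative_mult[OF smooth_has_derivative smooth_has_derivative]]) auto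

lemma dird_cmult:
  fixes g :: "'a::euclidean_space \<Rightarrow> 'b::real_normed_algebra"
  shows "smooth g \<Longrightarrow> dird v (\<lambda>x. c * g x) x = c * dird v g x"
  by (subst dird_mult[OF smooth_const]) auto

lemma dird_sum:
  "(\<And>i. i \<in> I \<Longrightarrow> smooth (f i)) \<Longrightarrow> dird v (\<lambda>x. \<Sum>i\<in>I. f i x) x = (\<Sum>i\<in>I. dird v (f i) x)"
  by (subst frechet_derivative_eqI[OF has_derivative_sum[OF smooth_has_derivative]]) auto

lemma test_lipschitz:
  assumes "\<phi> \<in> test_functions U" obtains M where "M-lipschitz_on UNIV \<phi>"
proof -
  have "\<exists>M\<ge>0. \<forall>x. cmod (dird b \<phi> x) \<le> M" for b
    using test_bounded[OF test_dird[OF assms, of b]] by metis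
  then obtain M where M: "\<And>b. M b \<ge> 0" "\<And>b x. cmod (dird b \<phi> x) \<le> M b" by metis
  have sm: "smooth \<phi>" using assms by (rule test_smooth)
  have "onorm (frechet_derivative \<phi> (at x)) \<le> (\<Sum>b\<in>Basis. M b)" for x
  proof (rule onorm_le)
    fix v
    have "cmod (dird v \<phi> x) \<le> (\<Sum>b\<in>Basis. cmod ((v \<bullet> b) *\<^sub>R dird b \<phi> x))"
      by (subst dird_linear[OF sm]) (rule norm_sum)
    also have "\<dots> \<le> (\<Sum>b\<in>Basis. M b * norm v)"
    proof (rule sum_mono)
      fix b :: 'a assume "b \<in> Basis"
      have "\<bar>v \<bullet> b\<bar> * cmod (dird b \<phi> x) \<le> norm v * M b"
        using M \<open>b \<in> Basis\<close> by (intro mult_mono) (auto simp: Basis_le_norm)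
      then show "cmod ((v \<bullet> b) *\<^sub>R dird b \<phi> x) \<le> M b * norm v" by (simp add: mult.commute)
    qed
    finally show "cmod (dird v \<phi> x) \<le> (\<Sum>b\<in>Basis. M b) * norm v" by (simp add: sum_distrib_right)
  qed
  then have "(\<Sum>b\<in>Basis. M b)-lipschitz_on UNIV \<phi>"
    by (intro bounded_derivative_imp_lipschitz[where f'="\<lambda>x. frechet_derivative \<phi> (at x)"])
       (use smooth_has_derivative[OF sm] M in \<open>auto intro: sum_nonneg\<close>)
  then show ?thesis by (rule that)
qed

lemma smooth_complex_of_real: "smooth f \<Longrightarrow> smooth (\<lambda>x. complex_of_real (f x))"
  by (rule smooth_linear_compose[OF bounded_linear_of_real])

lemma integral_translate:
  fixes f :: "'a::euclidean_space \<Rightarrow> complex"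
  assumes "f \<in> borel_measurable borel"
  shows "(LINT y|lborel. f (c + y)) = integral\<^sup>L lborel f"
proof -
  have "integral\<^sup>L lborel f = integral\<^sup>L (distr lborel borel ((+) c)) f"
    by (simp only: lborel_distr_plus)
  also have "\<dots> = (LINT y|lborel. f (c + y))"
    using assms by (intro integral_distr) auto
  finally show ?thesis by simp
qed

text \<open>Difference quotients have integral zero by translation invariance, and they converge to the
  derivative under a common integrable bound.\<close>

lemma integral_dird_test:
  assumes "\<phi> \<in> test_functions U" shows "(LINT x|lebesgue. dird v \<phi> x) = 0"
proof -
  obtain S where S: "smooth \<phi>" "compact S" "S \<subseteq> U" "\<And>x. x \<notin> S \<Longrightarrow> \<phi> x = 0"
    using assms(1) by (auto elim: test_functionsE)
  obtain K where K: "K-lipschitz_on UNIV \<phi>" using test_lipschitz[OF assms] .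
  obtain R where R: "\<And>x. x \<in> S \<Longrightarrow> norm x \<le> R" using compact_imp_bounded[OF S(2)] by (auto simp: bounded_iff)
  have cont: "continuous_on UNIV \<phi>" by (rule smooth_continuous[OF S(1)])
  have [measurable]: "\<phi> \<in> borel_measurable borel" using cont by (rule borel_measurable_continuous_onI)
  have [measurable]: "dird v \<phi> \<in> borel_measurable borel"
    using smooth_continuous[OF smooth_dird[OF S(1)]] by (rule borel_measurable_continuous_onI)
  have int: "integrable lborel \<phi>" by (rule integrable_continuous_compact_support[OF cont S(2,4)])
  define t where "t n = inverse (real (Suc n))" for n
  define D where "D n x = (\<phi> (x + t n *\<^sub>R v) - \<phi> x) /\<^sub>R t n" for n x
  have t: "t \<longlonglongrightarrow> 0" "t n > 0" "t n \<le> 1" for n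
    unfolding t_def by (rule LIMSEQ_inverse_real_of_nat) (auto simp: field_simps)
  have Dm: "D n \<in> borel_measurable lborel" for n
  proof -
    have "continuous_on UNIV (D n)"
      unfolding D_def by (intro continuous_intros continuous_on_compose2[OF cont] cont) auto
    then show ?thesis using borel_measurable_continuous_onI by simp
  qed
  have D0: "integral\<^sup>L lborel (D n) = 0" for n
  proof -
    have "integrable lborel (\<lambda>x. \<phi> (t n *\<^sub>R v + x))"
      using int integrable_distr[of "(+) (t n *\<^sub>R v)" lborel borel \<phi>]
      by (simp add: lborel_distr_plus)
    then show ?thesis
      unfolding D_def using int integral_translate[of \<phi> "t n *\<^sub>R v"] by (simp add: add.commute)
  qed
  have "(\<lambda>n. integral\<^sup>L lborel (D n)) \<longlonglongrightarrow> integral\<^sup>L lborel (dird v \<phi>)"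
  proof (rule integral_dominated_convergence)
    show "AE x in lborel. (\<lambda>n. D n x) \<longlonglongrightarrow> dird v \<phi> x"
    proof (rule AE_I2)
      fix x
      have "filterlim t (at 0) sequentially"
        using t(1,2) by (auto simp: filterlim_at less_imp_neq[symmetric] intro!: always_eventually)
      from filterlim_compose[OF directional_quotient_tendsto[OF smooth_has_derivative[OF S(1)]] this]
      show "(\<lambda>n. D n x) \<longlonglongrightarrow> dird v \<phi> x" by (simp add: D_def)
    qed
    show "integrable lborel (\<lambda>x. indicator (cball (0::'a) (R + norm v)) x *\<^sub>R (K * norm v))"
      by (rule borel_integrable_compact) auto
    show "AE x in lborel. norm (D n x) \<le> indicator (cball (0::'a) (R + norm v)) x *\<^sub>R (K * norm v)" for n
    proof (rule AE_I2)
      fix x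
      show "norm (D n x) \<le> indicator (cball (0::'a) (R + norm v)) x *\<^sub>R (K * norm v)"
      proof (cases "x \<in> cball 0 (R + norm v)")
        case True
        have "norm (\<phi> (x + t n *\<^sub>R v) - \<phi> x) \<le> K * (t n * norm v)"
          using lipschitz_onD[OF K, of "x + t n *\<^sub>R v" x] t(2)[of n] by (simp add: dist_norm)
        then have "norm (D n x) \<le> inverse (t n) * (K * (t n * norm v))"
          using t(2)[of n] by (simp add: D_def)
        also have "\<dots> = K * norm v" using t(2)[of n] by (simp add: field_simps)
        finally show ?thesis using True by simp
      next
        case False
        have "norm (t n *\<^sub>R v) \<le> norm v" using t(2,3)[of n] by (simp add: mult_left_le_one_le)
        then have "norm (x + t n *\<^sub>R v) > R"
          using False norm_triangle_ineq4[of "x + t n *\<^sub>R v" "t n *\<^sub>R v"] by simp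
        moreover have "norm x > R" using False norm_ge_zero[of v] unfolding mem_cball_0 by linarith
        ultimately have "x + t n *\<^sub>R v \<notin> S" "x \<notin> S" using R by (auto simp: not_le[symmetric])
        then have "D n x = 0" using S(4) by (simp add: D_def)
        then show ?thesis using False by simp
      qed
    qed
  qed (use Dm in \<open>simp_all\<close>)
  then have "integral\<^sup>L lborel (dird v \<phi>) = 0" unfolding D0 by (rule LIMSEQ_unique[OF _ tendsto_const])
  then show ?thesis by (subst integral_completion) auto
qed

lemma pairing_dird_smooth:
  assumes "\<phi> \<in> test_functions U" "smooth f"
  shows "pairing f (dird v \<phi>) = - pairing (dird v f) \<phi>"
proof -
  have sm: "smooth \<phi>" using assms by (simp add: test_smooth)
  have t1: "(\<lambda>x. f x * dird v \<phi> x) \<in> test_functions U"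
    by (intro test_mult test_dird assms)
  have t2: "(\<lambda>x. dird v f x * \<phi> x) \<in> test_functions U"
    by (intro test_mult smooth_dird assms)
  have int: "integrable lebesgue \<psi>" if "\<psi> \<in> test_functions U" for \<psi> :: "'a \<Rightarrow> complex"
    using that by (elim test_functionsE)
      (auto simp: integrable_completion borel_measurable_continuous_onI[OF smooth_continuous]
        intro: integrable_continuous_compact_support smooth_continuous)
  have "0 = (LINT x|lebesgue. dird v (\<lambda>x. f x * \<phi> x) x)"
    by (rule integral_dird_test[symmetric, OF test_mult[OF assms]])
  also have "\<dots> = (LINT x|lebesgue. f x * dird v \<phi> x + dird v f x * \<phi> x)"
    by (simp add: dird_mult assms sm)
  also have "\<dots> = pairing f (dird v \<phi>) + pairing (dird v f) \<phi>"
    unfolding pairing_def by (rule Bochner_Integration.integral_add[OF int[OF t1] int[OF t2]])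
  finally show ?thesis by (simp add: eq_neg_iff_add_eq_0)
qed

section \<open>Fundamental lemma of the calculus of variations\<close>

text \<open>Cutoff functions that equal one on \<open>C\<close> and are supported in shrinking neighbourhoods of \<open>C\<close>
  converge to the indicator of \<open>C\<close>.\<close>

lemma integral_compact_zero:
  assumes "open U" "compact C" "C \<subseteq> U" "l2 f" "\<And>\<phi>. \<phi> \<in> test_functions U \<Longrightarrow> pairing f \<phi> = 0"
  shows "(LINT x|lebesgue. indicator C x * f x) = 0"
proof (cases "C = {}")
  case False
  define V where "V n = U \<inter> {x. infdist x C < inverse (real (Suc n))}" for n
  have V: "open (V n)" "C \<subseteq> V n" for n
    unfolding V_def using assms by (auto intro!: open_Int open_Collect_less continuous_intros)
  have "\<exists>\<theta>::'a \<Rightarrow> real. smooth \<theta> \<and> (\<forall>x. 0 \<le> \<theta> x \<and> \<theta> x \<le> 1) \<and> (\<forall>x\<in>C. \<theta> x = 1) \<and>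
     (\<exists>S. compact S \<and> S \<subseteq> V n \<and> (\<forall>x. x \<notin> S \<longrightarrow> \<theta> x = 0))" for n
    by (rule exists_smooth_cutoff[OF assms(2) V(1)[of n] V(2)[of n]]) (metis subsetD)
  then obtain \<theta> :: "nat \<Rightarrow> 'a \<Rightarrow> real" where \<theta>: "\<And>n. smooth (\<theta> n)" "\<And>n x. 0 \<le> \<theta> n x \<and> \<theta> n x \<le> 1"
    "\<And>n x. x \<in> C \<Longrightarrow> \<theta> n x = 1" "\<And>n. \<exists>S. compact S \<and> S \<subseteq> V n \<and> (\<forall>x. x \<notin> S \<longrightarrow> \<theta> n x = 0)"
    by metis
  have test: "(\<lambda>x. complex_of_real (\<theta> n x)) \<in> test_functions (V n)" for n
    using \<theta>(4)[of n] by (auto intro!: test_functionsI smooth_complex_of_real \<theta>(1))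
  have z: "\<theta> n x = 0" if "x \<notin> V n" for n x
    using test_zero_outside[OF test that] by simp
  have [measurable]: "f \<in> borel_measurable lebesgue" by (rule l2_measurable[OF assms(4)])
  have [measurable]: "C \<in> sets lebesgue" using assms(2) by (simp add: compact_imp_closed)
  have [measurable]: "\<theta> n \<in> borel_measurable lebesgue" for n
    by (intro continuous_imp_lebesgue_measurable smooth_continuous \<theta>(1))
  let ?B = "{x. infdist x C \<le> 1}"
  have B: "compact ?B" by (rule compact_infdist_le[OF False assms(2)]) simp
  have "(\<lambda>n. pairing f (\<lambda>x. complex_of_real (\<theta> n x))) \<longlonglongrightarrow> (LINT x|lebesgue. indicator C x * f x)"
    unfolding pairing_def
  proof (rule integral_dominated_convergence)
    show "AE x in lebesgue. (\<lambda>n. f x * complex_of_real (\<theta> n x)) \<longlonglongrightarrow> indicator C x * f x"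
    proof (rule AE_I2)
      fix x
      have "\<forall>\<^sub>F n in sequentially. complex_of_real (\<theta> n x) = indicator C x"
      proof (cases "x \<in> C")
        case True then show ?thesis using \<theta>(3) by simp
      next
        case False
        then have "infdist x C > 0"
          using in_closed_iff_infdist_zero[of C x] compact_imp_closed[OF assms(2)] \<open>C \<noteq> {}\<close> infdist_nonneg[of x C]
          by (metis less_eq_real_def)
        then have "\<forall>\<^sub>F n in sequentially. inverse (real (Suc n)) < infdist x C"
          using LIMSEQ_inverse_real_of_nat order_tendstoD(2) by blast
        then show ?thesis
          by eventually_elim (use False z in \<open>auto simp: V_def\<close>)
      qed
      then have "(\<lambda>n. complex_of_real (\<theta> n x)) \<longlonglongrightarrow> indicator C x"
        by (rule tendsto_eventually)
      then show "(\<lambda>n. f x * complex_of_real (\<theta> n x)) \<longlonglongrightarrow> indicator C x * f x"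
        unfolding mult.commute[of "indicator C x"] by (rule tendsto_mult_left)
    qed
    from l2_mult_integrable[OF assms(4) l2_indicator_compact[OF B]]
    show "integrable lebesgue (\<lambda>x. cmod (f x * indicator ?B x))" by simp
    show "AE x in lebesgue. norm (f x * complex_of_real (\<theta> n x)) \<le> cmod (f x * indicator ?B x)" for n
    proof (rule AE_I2)
      fix x
      show "norm (f x * complex_of_real (\<theta> n x)) \<le> cmod (f x * indicator ?B x)"
      proof (cases "x \<in> V n")
        case True
        then have "infdist x C < inverse (real (Suc n))" by (simp add: V_def)
        also have "\<dots> \<le> 1" by (simp add: field_simps)
        finally have "x \<in> ?B" by simp
        then show ?thesis using \<theta>(2)[of n x] by (auto simp: norm_mult intro: mult_left_le)
      qed (use z in simp)
    qed
  qed measurable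
  moreover have "pairing f (\<lambda>x. complex_of_real (\<theta> n x)) = 0" for n
    by (rule assms(5)[OF test_mono[OF test]]) (simp add: V_def)
  ultimately show ?thesis by (simp add: LIMSEQ_const_iff)
qed simp

text \<open>Up to a null set, the set where \<open>Re f\<close> is positive is a countable union of compact sets. On each
  of them a positive function has integral zero, so each is a null set.\<close>

lemma Re_nonpos_AE:
  assumes "open U" "l2 f" "\<And>\<phi>. \<phi> \<in> test_functions U \<Longrightarrow> pairing f \<phi> = 0"
  shows "AE x in lebesgue. x \<in> U \<longrightarrow> Re (f x) \<le> 0"
proof -
  define S where "S = {x \<in> U. Re (f x) > 0}"
  have [measurable]: "f \<in> borel_measurable lebesgue" by (rule l2_measurable[OF assms(2)])
  have [measurable]: "U \<in> sets lebesgue" using assms(1) by simp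
  have "S \<in> sets lebesgue" unfolding S_def by measurable
  then obtain C T where CT: "fsigma C" "T \<in> null_sets lebesgue" "C \<union> T = S"
    by (metis lebesgue_set_almost_fsigma)
  then obtain F :: "nat \<Rightarrow> 'a set" where F: "range F \<subseteq> Collect compact" "C = \<Union>(F ` UNIV)"
    using fsigma_Union_compact by blast
  have "F n \<in> null_sets lebesgue" for n
  proof -
    have cp: "compact (F n)" and sub: "F n \<subseteq> S" using F CT(3) by auto
    have [measurable]: "F n \<in> sets lebesgue" using cp by (simp add: compact_imp_closed)
    have *: "(LINT x|lebesgue. indicator (F n) x * f x) = 0"
      by (rule integral_compact_zero[OF assms(1) cp _ assms(2,3)]) (use sub in \<open>auto simp: S_def\<close>)
    have int: "integrable lebesgue (\<lambda>x. indicator (F n) x * f x)"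
      by (rule l2_mult_integrable[OF l2_indicator_compact[OF cp] assms(2)])
    have "(LINT x|lebesgue. Re (indicator (F n) x * f x)) = 0"
      by (subst integral_Re[OF int]) (simp only: * zero_complex.simps)
    moreover have "Re (indicator (F n) x * f x) \<ge> 0" for x
      using sub by (auto simp: indicator_def S_def)
    ultimately have "AE x in lebesgue. Re (indicator (F n) x * f x) = 0"
      using integral_nonneg_eq_0_iff_AE[of lebesgue "\<lambda>x. Re (indicator (F n) x * f x)", OF integrable_Re[OF int]]
      by blast
    then have "AE x in lebesgue. x \<notin> F n"
    proof eventually_elim
      case (elim x)
      show ?case
      proof
        assume "x \<in> F n"
        then have "Re (f x) > 0" using sub by (auto simp: S_def)
        then show False using elim \<open>x \<in> F n\<close> by simp
      qed
    qed
    then show ?thesis by (subst (asm) AE_iff_null) auto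
  qed
  then have "C \<in> null_sets lebesgue" using F(2) by auto
  then have "S \<in> null_sets lebesgue" using CT by (metis null_sets.Un)
  then have "AE x in lebesgue. x \<notin> S" by (rule AE_not_in)
  then show ?thesis by eventually_elim (auto simp: S_def)
qed

lemma fundamental_lemma:
  assumes "open U" "l2 f" "\<And>\<phi>. \<phi> \<in> test_functions U \<Longrightarrow> pairing f \<phi> = 0"
  shows "AE x in lebesgue. x \<in> U \<longrightarrow> f x = 0"
proof -
  have *: "AE x in lebesgue. x \<in> U \<longrightarrow> Re (c * f x) \<le> 0" for c
    by (rule Re_nonpos_AE[OF assms(1) l2_cmult[OF assms(2)]]) (simp add: pairing_cmult_left assms(3))
  show ?thesis
    using *[of 1] *[of "-1"] *[of \<i>] *[of "-\<i>"]
  proof eventually_elim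
    case (elim x)
    then show ?case by (simp add: complex_eq_iff) linarith
  qed
qed

lemma pairing_eq_imp_AE_eq:
  assumes "open U" "l2 f" "l2 g" "\<And>\<phi>. \<phi> \<in> test_functions U \<Longrightarrow> pairing f \<phi> = pairing g \<phi>"
  shows "AE x in lebesgue. x \<in> U \<longrightarrow> f x = g x"
  using fundamental_lemma[OF assms(1) l2_diff[OF assms(2,3)]] assms(4)
  by (simp add: pairing_diff_left assms(2,3) test_l2)

section \<open>Fourier series on a cube\<close>

definition wave :: "'a::euclidean_space \<Rightarrow> 'a \<Rightarrow> complex" where
  "wave m x = cis (m \<bullet> x)"

lemma norm_wave [simp]: "cmod (wave m x) = 1"
  by (simp add: wave_def)

lemma wave_mult: "wave m x * wave k x = wave (m + k) x"
  by (simp add: wave_def cis_mult inner_add_left)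

lemma wave_zero: "wave 0 x = 1"
  by (simp add: wave_def)

lemma cnj_wave: "cnj (wave m x) = wave (- m) x"
  by (simp add: wave_def cis_cnj)

lemma wave_has_derivative:
  "((\<lambda>x. c * wave m x) has_derivative (\<lambda>v. c * (\<i> * of_real (m \<bullet> v)) * wave m x)) (at x)"
proof -
  have 1: "((\<lambda>x. \<i> * of_real (m \<bullet> x)) has_derivative (\<lambda>v. \<i> * of_real (m \<bullet> v))) (at x)"
    by (auto intro!: derivative_eq_intros)
  have 2: "((\<lambda>z. c * exp z) has_derivative (\<lambda>h. c * exp w * h)) (at w)" for w :: complex
    using DERIV_cmult[OF DERIV_exp[of w], of c] unfolding has_field_derivative_def .
  show ?thesis
    using has_derivative_compose[OF 1 2]
    by (simp add: wave_def cis_conv_exp mult_ac)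
qed

lemma smooth_wave: "smooth (wave m)"
proof -
  have "smooth (\<lambda>x. 1 * wave m x)"
    by (rule smooth_family[where I=UNIV and f="\<lambda>c x. c * wave m x" and
          f'="\<lambda>c x v. c * (\<i> * of_real (m \<bullet> v)) * wave m x", OF wave_has_derivative]) auto
  then show ?thesis by simp
qed

lemma dird_wave: "dird v (wave m) x = \<i> * of_real (m \<bullet> v) * wave m x"
  using frechet_derivative_eqI[OF wave_has_derivative[of 1 m x]] by simp

definition cube :: "real \<Rightarrow> 'a::euclidean_space set" where
  "cube l = cbox (- (pi * l) *\<^sub>R One) ((pi * l) *\<^sub>R One)"

definition open_cube :: "real \<Rightarrow> 'a::euclidean_space set" where
  "open_cube l = box (- (pi * l) *\<^sub>R One) ((pi * l) *\<^sub>R One)"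

lemma mem_cube: "x \<in> cube l \<longleftrightarrow> (\<forall>b\<in>Basis. \<bar>x \<bullet> b\<bar> \<le> pi * l)"
  by (auto simp: cube_def mem_box abs_le_iff)

lemma mem_open_cube: "x \<in> open_cube l \<longleftrightarrow> (\<forall>b\<in>Basis. \<bar>x \<bullet> b\<bar> < pi * l)"
  by (auto simp: open_cube_def mem_box abs_less_iff)

lemma compact_cube: "compact (cube l)" by (simp add: cube_def)

lemma open_open_cube: "open (open_cube l)" unfolding open_cube_def by (rule open_box)

lemma open_cube_subset: "open_cube l \<subseteq> cube l" by (simp add: open_cube_def cube_def box_subset_cbox)

definition cube_wave :: "real \<Rightarrow> 'a::euclidean_space \<Rightarrow> 'a \<Rightarrow> complex" where
  "cube_wave l m = zero_ext (cube l) (wave m)"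

text \<open>The half-integer shift keeps zero away from the frequencies, with distance at least \<open>1 / (2 l)\<close>,
  so that no mode is exceptional when a differential operator is inverted. A sum of waves with these
  frequencies is a periodic function times the wave with frequency \<open>(1 / (2 l)) One\<close>.\<close>

definition frequencies :: "real \<Rightarrow> 'a::euclidean_space set" where
  "frequencies l = {m. \<forall>b\<in>Basis. \<exists>j::int. l * (m \<bullet> b) = of_int j + 1/2}"

definition periods :: "real \<Rightarrow> 'a::euclidean_space set" where
  "periods l = {m. \<forall>b\<in>Basis. \<exists>j::int. l * (m \<bullet> b) = of_int j}"

lemma frequencies_diff: "m \<in> frequencies l \<Longrightarrow> k \<in> frequencies l \<Longrightarrow> m - k \<in> periods l"
  unfolding frequencies_def periods_def
proof safe
  fix b :: 'a assume *: "\<forall>b\<in>Basis. \<exists>j::int. l * (m \<bullet> b) = of_int j + 1/2" "\<forall>b\<in>Basis. \<exists>j::int. l * (k \<bullet> b) = of_int j + 1/2" "b \<in> Basis"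
  then obtain i j :: int where "l * (m \<bullet> b) = of_int i + 1/2" "l * (k \<bullet> b) = of_int j + 1/2" by blast
  then show "\<exists>j::int. l * ((m - k) \<bullet> b) = of_int j"
    by (intro exI[of _ "i - j"]) (simp add: inner_diff_left algebra_simps)
qed

lemma frequencies_uminus: "m \<in> frequencies l \<Longrightarrow> - m \<in> frequencies l"
  unfolding frequencies_def
proof safe
  fix b :: 'a assume *: "\<forall>b\<in>Basis. \<exists>j::int. l * (m \<bullet> b) = of_int j + 1/2" "b \<in> Basis"
  then obtain j :: int where "l * (m \<bullet> b) = of_int j + 1/2" by blast
  then show "\<exists>j::int. l * (- m \<bullet> b) = of_int j + 1/2"
    by (intro exI[of _ "- j - 1"]) simp
qed

lemma lborel_integral_prod:
  fixes g :: "'a::euclidean_space \<Rightarrow> real \<Rightarrow> complex"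
  assumes "\<And>b. b \<in> Basis \<Longrightarrow> integrable lborel (g b)"
  shows "(LINT x|lborel. (\<Prod>b\<in>Basis. g b (x \<bullet> b))) = (\<Prod>b\<in>Basis. LINT t|lborel. g b t)"
proof -
  interpret product_sigma_finite "\<lambda>b::'a. lborel :: real measure" ..
  have [measurable]: "\<And>b. b \<in> Basis \<Longrightarrow> g b \<in> borel_measurable borel"
    using assms by (auto dest: borel_measurable_integrable)
  have "(LINT x|lborel. (\<Prod>b\<in>Basis. g b (x \<bullet> b))) =
     (LINT f|(\<Pi>\<^sub>M b\<in>Basis. lborel). (\<Prod>b\<in>Basis. g b ((\<Sum>c\<in>Basis. f c *\<^sub>R c) \<bullet> b)))"
    by (subst lborel_eq, subst integral_distr) auto
  also have "\<dots> = (LINT f|(\<Pi>\<^sub>M b\<in>Basis. lborel). (\<Prod>b\<in>Basis. g b (f b)))"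
    by (intro Bochner_Integration.integral_cong prod.cong) auto
  also have "\<dots> = (\<Prod>b\<in>Basis. LINT t|lborel. g b t)"
    by (rule product_integral_prod) (use assms in auto)
  finally show ?thesis .
qed

lemma integral_interval_cis:
  fixes l \<kappa> :: real and j :: int
  assumes "l > 0" "l * \<kappa> = of_int j"
  shows "has_bochner_integral lborel (\<lambda>t. indicator {- (pi * l)..pi * l} t *\<^sub>R cis (\<kappa> * t))
     (if \<kappa> = 0 then of_real (2 * pi * l) else 0)"
proof (cases "\<kappa> = 0")
  case True
  have "has_bochner_integral lborel (\<lambda>t. indicator {- (pi * l)..pi * l} t *\<^sub>R cis (\<kappa> * t))
      (of_real (pi * l) - of_real (- (pi * l)) :: complex)"
    by (rule has_bochner_integral_FTC_Icc)
       (use True assms in \<open>auto intro!: derivative_eq_intros continuous_intros simp: has_vector_derivative_def scaleR_conv_of_real\<close>)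
  then show ?thesis using True by (simp add: mult.assoc)
next
  case False
  let ?F = "\<lambda>t. cis (\<kappa> * t) / (\<i> * of_real \<kappa>)"
  have "has_bochner_integral lborel (\<lambda>t. indicator {- (pi * l)..pi * l} t *\<^sub>R cis (\<kappa> * t))
      (?F (pi * l) - ?F (- (pi * l)))"
  proof (rule has_bochner_integral_FTC_Icc)
    fix t :: real
    have "((\<lambda>z. exp (\<i> * of_real \<kappa> * z) / (\<i> * of_real \<kappa>)) has_field_derivative exp (\<i> * of_real \<kappa> * of_real t)) (at (of_real t))"
      using False by (auto intro!: derivative_eq_intros)
    then have "((\<lambda>t. exp (\<i> * of_real \<kappa> * of_real t) / (\<i> * of_real \<kappa>)) has_vector_derivative exp (\<i> * of_real \<kappa> * of_real t)) (at t within {- (pi * l)..pi * l})"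
      by (rule has_vector_derivative_real_field)
    then show "(?F has_vector_derivative cis (\<kappa> * t)) (at t within {- (pi * l)..pi * l})"
      by (simp add: cis_conv_exp mult.assoc)
  qed (use assms in \<open>auto intro!: continuous_intros\<close>)
  moreover have "cis (\<kappa> * (pi * l)) = cis (\<kappa> * (- (pi * l)))"
  proof -
    have "\<kappa> * (pi * l) = pi * of_int j" using assms(2) by (simp add: mult.assoc mult.commute)
    then show ?thesis by (simp only: mult_minus_right complex_eq_iff cis.simps) simp
  qed
  ultimately show ?thesis using False by simp
qed

definition vol :: "'a::euclidean_space itself \<Rightarrow> real \<Rightarrow> real" where
  "vol _ l = (2 * pi * l) ^ DIM('a)"

lemma integral_cube_wave:
  fixes m :: "'a::euclidean_space"
  assumes "l > 0" "m \<in> periods l"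
  shows "(LINT x|lebesgue. cube_wave l m x) = (if m = 0 then of_real (vol TYPE('a) l) else 0)"
proof -
  let ?g = "\<lambda>b t. indicator {- (pi * l)..pi * l} t *\<^sub>R cis ((m \<bullet> b) * t)"
  have g: "has_bochner_integral lborel (?g b) (if m \<bullet> b = 0 then of_real (2 * pi * l) else 0)" if "b \<in> Basis" for b
  proof -
    obtain j :: int where "l * (m \<bullet> b) = of_int j" using assms(2) \<open>b \<in> Basis\<close> by (auto simp: periods_def)
    then show ?thesis by (rule integral_interval_cis[OF assms(1)])
  qed
  have eq: "cube_wave l m x = (\<Prod>b\<in>Basis. ?g b (x \<bullet> b))" for x
  proof -
    have "(\<Prod>b\<in>Basis. cis ((m \<bullet> b) * (x \<bullet> b))) = wave m x"
      unfolding wave_def by (subst euclidean_inner) (simp add: cis_conv_exp exp_sum sum_distrib_left)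
    moreover have "(\<Prod>b\<in>Basis. of_real (indicator {- (pi * l)..pi * l} (x \<bullet> b))) = (if x \<in> cube l then 1 else (0::complex))"
    proof (cases "x \<in> cube l")
      case True
      then have "indicator {- (pi * l)..pi * l} (x \<bullet> b) = (1::real)" if "b \<in> Basis" for b
        using that by (auto simp: mem_cube abs_le_iff)
      then show ?thesis using True by simp
    next
      case False
      then obtain b where "b \<in> Basis" "indicator {- (pi * l)..pi * l} (x \<bullet> b) = (0::real)"
        by (auto simp: mem_cube abs_le_iff)
      then show ?thesis using False by (auto simp: prod_zero_iff)
    qed
    ultimately show ?thesis
      by (simp add: cube_wave_def zero_ext_def scaleR_conv_of_real prod.distrib)
  qed
  have "(LINT x|lebesgue. cube_wave l m x) = (LINT x|lborel. cube_wave l m x)"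
  proof (rule integral_completion)
    have "wave m \<in> borel_measurable lborel"
      using borel_measurable_continuous_onI[OF smooth_continuous[OF smooth_wave]] by simp
    then show "cube_wave l m \<in> borel_measurable lborel"
      unfolding cube_wave_def zero_ext_def by (rule measurable_If) (auto simp: cube_def)
  qed
  also have "\<dots> = (\<Prod>b\<in>Basis. LINT t|lborel. ?g b t)"
    unfolding eq by (rule lborel_integral_prod) (use g has_bochner_integral_iff in blast)
  also have "\<dots> = (\<Prod>b\<in>(Basis::'a set). if m \<bullet> b = 0 then of_real (2 * pi * l) else 0)"
    by (intro prod.cong refl has_bochner_integral_integral_eq g)
  also have "\<dots> = (if m = 0 then of_real (vol TYPE('a) l) else 0)"
    by (auto simp: vol_def prod_zero_iff euclidean_eq_iff[of m 0])
  finally show ?thesis .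
qed

lemma l2_cube_wave: "l2 (cube_wave l m)"
proof -
  have "l2 (\<lambda>x. wave m x * indicator (cube l) x)"
    by (rule l2_bounded_mult[OF l2_indicator_compact[OF compact_cube], where C=1])
       (auto intro: continuous_imp_lebesgue_measurable smooth_continuous smooth_wave)
  moreover have "(\<lambda>x. wave m x * indicator (cube l) x) = cube_wave l m"
    by (auto simp: cube_wave_def zero_ext_def)
  ultimately show ?thesis by simp
qed

lemma cube_wave_outside: "x \<notin> cube l \<Longrightarrow> cube_wave l m x = 0"
  by (simp add: cube_wave_def zero_ext_def)

lemma cnj_cube_wave: "cnj (cube_wave l m x) = cube_wave l (- m) x"
  by (simp add: cube_wave_def zero_ext_def cnj_wave)

lemma pairing_cube_wave:
  fixes m k :: "'a::euclidean_space"
  assumes "l > 0" "m \<in> frequencies l" "k \<in> frequencies l"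
  shows "pairing (cube_wave l m) (cube_wave l (- k)) = (if m = k then of_real (vol TYPE('a) l) else 0)"
proof -
  have "(\<lambda>x. cube_wave l m x * cube_wave l (- k) x) = cube_wave l (m - k)"
    by (auto simp: cube_wave_def zero_ext_def wave_mult)
  then show ?thesis
    using integral_cube_wave[OF assms(1) frequencies_diff[OF assms(2,3)]] by (simp add: pairing_def)
qed

lemma vol_pos: "l > 0 \<Longrightarrow> vol TYPE('a::euclidean_space) l > 0"
  by (simp add: vol_def)

text \<open>There is no conjugate here, so this is the coefficient that belongs to the wave with
  frequency \<open>-m\<close>; the signs below follow from that.\<close>

definition fcoeff :: "real \<Rightarrow> ('a::euclidean_space \<Rightarrow> complex) \<Rightarrow> 'a \<Rightarrow> complex" where
  "fcoeff l u m = pairing u (cube_wave l m)"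

lemma l2_cnj: "l2 f \<Longrightarrow> l2 (\<lambda>x. cnj (f x))"
  by (rule l2_dominated[of f _ 1])
     (auto intro: measurable_compose[OF l2_measurable borel_measurable_continuous_onI] continuous_intros)

lemma pairing_cnj: "of_real ((l2norm f)\<^sup>2) = pairing f (\<lambda>x. cnj (f x))"
proof -
  have "pairing f (\<lambda>x. cnj (f x)) = (LINT x|lebesgue. of_real ((cmod (f x))\<^sup>2))"
    unfolding pairing_def by (intro Bochner_Integration.integral_cong) (auto simp: complex_norm_square[symmetric])
  also have "\<dots> = of_real ((l2norm f)\<^sup>2)" by (simp add: l2norm_square del: of_real_power)
  finally show ?thesis by simp
qed

lemma pairing_of_cnj: "pairing (\<lambda>x. cnj (f x)) (\<lambda>x. cnj (g x)) = cnj (pairing f g)"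
  using Bochner_Integration.integral_cnj[of lebesgue "\<lambda>x. f x * g x"] by (simp add: pairing_def)

lemma pairing_trig_cnj:
  fixes c :: "'a::euclidean_space \<Rightarrow> complex"
  assumes "l > 0" "finite F" "F \<subseteq> frequencies l"
  shows "pairing (\<lambda>x. \<Sum>m\<in>F. c m * cube_wave l m x) (\<lambda>x. cnj (\<Sum>m\<in>F. d m * cube_wave l m x)) =
    of_real (vol TYPE('a) l) * (\<Sum>m\<in>F. c m * cnj (d m))"
proof -
  have "pairing (\<lambda>x. \<Sum>m\<in>F. c m * cube_wave l m x) (\<lambda>x. cnj (\<Sum>m\<in>F. d m * cube_wave l m x)) =
     pairing (\<lambda>x. \<Sum>m\<in>F. c m * cube_wave l m x) (\<lambda>x. \<Sum>k\<in>F. cnj (d k) * cube_wave l (- k) x)"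
    by (simp add: cnj_cube_wave)
  also have "\<dots> = (\<Sum>k\<in>F. \<Sum>m\<in>F. pairing (\<lambda>x. c m * cube_wave l m x) (\<lambda>x. cnj (d k) * cube_wave l (- k) x))"
    by (subst pairing_sum_right, (intro l2_cmult l2_sum l2_cube_wave)+)
       (intro sum.cong refl pairing_sum_left l2_cmult l2_cube_wave)
  also have "\<dots> = (\<Sum>k\<in>F. \<Sum>m\<in>F. if m = k then of_real (vol TYPE('a) l) * (c k * cnj (d k)) else 0)"
    using assms by (intro sum.cong refl) (auto simp: pairing_cmult_left pairing_cmult_right pairing_cube_wave subset_iff)
  also have "\<dots> = (\<Sum>k\<in>F. of_real (vol TYPE('a) l) * (c k * cnj (d k)))"
    using assms(2) by (intro sum.cong refl) (simp add: sum.delta)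
  finally show ?thesis by (simp add: sum_distrib_left)
qed

lemma trig_energy:
  fixes c :: "'a::euclidean_space \<Rightarrow> complex"
  assumes "l > 0" "finite F" "F \<subseteq> frequencies l"
  shows "(l2norm (\<lambda>x. \<Sum>m\<in>F. c m * cube_wave l m x))\<^sup>2 = vol TYPE('a) l * (\<Sum>m\<in>F. (cmod (c m))\<^sup>2)"
proof -
  have "complex_of_real ((l2norm (\<lambda>x. \<Sum>m\<in>F. c m * cube_wave l m x))\<^sup>2) = of_real (vol TYPE('a) l * (\<Sum>m\<in>F. (cmod (c m))\<^sup>2))"
    unfolding pairing_cnj pairing_trig_cnj[OF assms] by (simp add: complex_norm_square[symmetric])
  then show ?thesis using of_real_eq_iff by blast
qed

text \<open>Completing the square in the coefficients. This contains both the inequality of Bessel and the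
  fact that the Fourier sum is the best approximation among all combinations of the same waves.\<close>

lemma best_approximation:
  fixes \<phi> :: "'a::euclidean_space \<Rightarrow> complex"
  assumes "l > 0" "finite F" "F \<subseteq> frequencies l" "l2 \<phi>"
  defines "V \<equiv> vol TYPE('a) l"
  shows "(l2norm (\<lambda>x. \<phi> x - (\<Sum>m\<in>F. c m * cube_wave l m x)))\<^sup>2 =
    (l2norm \<phi>)\<^sup>2 - (\<Sum>m\<in>F. (cmod (fcoeff l \<phi> (- m)))\<^sup>2) / V +
    V * (\<Sum>m\<in>F. (cmod (c m - fcoeff l \<phi> (- m) / of_real V))\<^sup>2)"
proof -
  define p where "p x = (\<Sum>m\<in>F. c m * cube_wave l m x)" for x
  have V: "V > 0" unfolding V_def by (rule vol_pos[OF assms(1)])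
  have p: "l2 p" unfolding p_def by (intro l2_sum l2_cmult l2_cube_wave)
  let ?a = "\<lambda>m. fcoeff l \<phi> (- m)"
  have 1: "pairing \<phi> (\<lambda>x. cnj (p x)) = (\<Sum>m\<in>F. cnj (c m) * ?a m)"
    unfolding p_def fcoeff_def
    by (simp add: cnj_cube_wave, subst pairing_sum_right)
       (auto intro!: l2_cmult l2_cube_wave assms(4) simp: pairing_cmult_right)
  have 2: "pairing p (\<lambda>x. cnj (\<phi> x)) = cnj (\<Sum>m\<in>F. cnj (c m) * ?a m)"
    unfolding 1[symmetric] pairing_of_cnj[symmetric] by (simp add: pairing_commute)
  have 3: "pairing p (\<lambda>x. cnj (p x)) = of_real V * (\<Sum>m\<in>F. c m * cnj (c m))"
    unfolding p_def V_def by (rule pairing_trig_cnj[OF assms(1-3)])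
  have "complex_of_real ((l2norm (\<lambda>x. \<phi> x - p x))\<^sup>2) = pairing (\<lambda>x. \<phi> x - p x) (\<lambda>x. cnj (\<phi> x) - cnj (p x))"
    unfolding pairing_cnj by simp
  also have "\<dots> = pairing \<phi> (\<lambda>x. cnj (\<phi> x)) - pairing p (\<lambda>x. cnj (\<phi> x)) - (pairing \<phi> (\<lambda>x. cnj (p x)) - pairing p (\<lambda>x. cnj (p x)))"
    by (simp add: pairing_diff_left pairing_diff_right l2_cnj l2_diff p assms(4))
  also have "\<dots> = of_real ((l2norm \<phi>)\<^sup>2) + (\<Sum>m\<in>F. of_real V * (c m * cnj (c m)) - cnj (c m) * ?a m - c m * cnj (?a m))"
    unfolding 1 2 3 pairing_cnj by (simp add: sum_subtractf sum_distrib_left)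
  also have "(\<Sum>m\<in>F. of_real V * (c m * cnj (c m)) - cnj (c m) * ?a m - c m * cnj (?a m)) =
     (\<Sum>m\<in>F. of_real (V * (cmod (c m - ?a m / of_real V))\<^sup>2 - (cmod (?a m))\<^sup>2 / V))"
  proof (rule sum.cong[OF refl])
    fix m
    show "of_real V * (c m * cnj (c m)) - cnj (c m) * ?a m - c m * cnj (?a m) =
      of_real (V * (cmod (c m - ?a m / of_real V))\<^sup>2 - (cmod (?a m))\<^sup>2 / V)"
      using V unfolding of_real_diff of_real_mult of_real_divide complex_norm_square
      by (simp add: field_simps)
  qed
  finally have "complex_of_real ((l2norm (\<lambda>x. \<phi> x - p x))\<^sup>2) =
     of_real ((l2norm \<phi>)\<^sup>2 + (\<Sum>m\<in>F. V * (cmod (c m - ?a m / of_real V))\<^sup>2 - (cmod (?a m))\<^sup>2 / V))"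
    by simp
  then have "(l2norm (\<lambda>x. \<phi> x - p x))\<^sup>2 = (l2norm \<phi>)\<^sup>2 + (\<Sum>m\<in>F. V * (cmod (c m - ?a m / of_real V))\<^sup>2 - (cmod (?a m))\<^sup>2 / V)"
    using of_real_eq_iff by blast
  then show ?thesis
    by (simp add: p_def sum_subtractf sum_distrib_left sum_divide_distrib)
qed

lemma Bessel:
  fixes u :: "'a::euclidean_space \<Rightarrow> complex"
  assumes "l > 0" "finite F" "F \<subseteq> frequencies l" "l2 u"
  shows "(\<Sum>m\<in>F. (cmod (fcoeff l u m))\<^sup>2) \<le> vol TYPE('a) l * (l2norm u)\<^sup>2"
proof -
  let ?V = "vol TYPE('a) l"
  have V: "?V > 0" by (rule vol_pos[OF assms(1)])
  have F': "finite (uminus ` F)" "uminus ` F \<subseteq> frequencies l"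
    using assms frequencies_uminus by auto
  have "0 \<le> (l2norm (\<lambda>x. u x - (\<Sum>m\<in>uminus ` F. (fcoeff l u (- m) / of_real ?V) * cube_wave l m x)))\<^sup>2" by simp
  also have "\<dots> = (l2norm u)\<^sup>2 - (\<Sum>m\<in>uminus ` F. (cmod (fcoeff l u (- m)))\<^sup>2) / ?V"
    by (subst best_approximation[OF assms(1) F' assms(4)]) simp
  also have "(\<Sum>m\<in>uminus ` F. (cmod (fcoeff l u (- m)))\<^sup>2) = (\<Sum>m\<in>F. (cmod (fcoeff l u m))\<^sup>2)"
    by (subst sum.reindex) (auto simp: inj_on_def)
  finally show ?thesis using V by (simp add: field_simps)
qed

section \<open>Completeness and the Riesz-Fischer theorem\<close>

text \<open>On a compact set a Cauchy sequence in the square norm is also one in the \<open>L\<^sup>1\<close> norm, hence has a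
  subsequence that converges almost everywhere. By the lemma of Fatou the limit is a limit in the
  square norm.\<close>

lemma l2_complete:
  fixes s :: "nat \<Rightarrow> 'a::euclidean_space \<Rightarrow> complex"
  assumes s: "\<And>n. l2 (s n)" and C: "compact C" "\<And>n x. x \<notin> C \<Longrightarrow> s n x = 0"
    and cauchy: "\<And>e. e > 0 \<Longrightarrow> \<exists>N. \<forall>i\<ge>N. \<forall>j\<ge>N. l2norm (\<lambda>x. s i x - s j x) < e"
  obtains u where "l2 u" "\<And>x. x \<notin> C \<Longrightarrow> u x = 0"
    "\<And>e. e > 0 \<Longrightarrow> \<exists>N. \<forall>n\<ge>N. l2norm (\<lambda>x. u x - s n x) \<le> e"
proof -
  have meas[measurable]: "s n \<in> borel_measurable lebesgue" for n by (rule l2_measurable[OF s])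
  let ?I = "indicator C :: 'a \<Rightarrow> complex"
  have I: "l2 ?I" by (rule l2_indicator_compact[OF C(1)])
  have sI: "s n x * ?I x = s n x" for n x using C(2) by (auto simp: indicator_def)
  have L1: "(LINT x|lebesgue. norm (s i x - s j x)) \<le> l2norm (\<lambda>x. s i x - s j x) * l2norm ?I" for i j
  proof -
    let ?d = "\<lambda>x. complex_of_real (cmod (s i x - s j x))"
    have d: "l2 ?d" by (rule l2_dominated[OF l2_diff[OF s[of i] s[of j]], where C=1]) auto
    have "?d x * ?I x = ?d x" for x using C(2)[of x] by (cases "x \<in> C") auto
    then have "pairing ?d ?I = (LINT x|lebesgue. ?d x)" unfolding pairing_def by (simp only:)
    then have "pairing ?d ?I = of_real (LINT x|lebesgue. norm (s i x - s j x))"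
      by (simp only: integral_complex_of_real)
    then have "(LINT x|lebesgue. norm (s i x - s j x)) \<le> cmod (pairing ?d ?I)" by simp
    also have "\<dots> \<le> l2norm ?d * l2norm ?I" by (rule Cauchy_Schwarz_pairing[OF d I])
    also have "l2norm ?d = l2norm (\<lambda>x. s i x - s j x)" by (simp add: l2norm_def)
    finally show ?thesis .
  qed
  obtain r where r: "strict_mono r" "AE x in lebesgue. Cauchy (\<lambda>i. s (r i) x)"
  proof (rule cauchy_L1_AE_cauchy_subseq[of lebesgue s])
    show "integrable lebesgue (s n)" for n
      using l2_mult_integrable[OF s I, of n] by (simp add: sI)
    fix e :: real assume "e > 0"
    then have "e / (l2norm ?I + 1) > 0" using l2norm_nonneg[of ?I] by simp
    then obtain N where N: "\<forall>i\<ge>N. \<forall>j\<ge>N. l2norm (\<lambda>x. s i x - s j x) < e / (l2norm ?I + 1)" using cauchy by blast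
    have "(LINT x|lebesgue. norm (s i x - s j x)) < e" if "i \<ge> N" "j \<ge> N" for i j
    proof -
      have "l2norm (\<lambda>x. s i x - s j x) * l2norm ?I \<le> l2norm (\<lambda>x. s i x - s j x) * (l2norm ?I + 1)"
        using l2norm_nonneg[of "\<lambda>x. s i x - s j x"] by (intro mult_left_mono) auto
      also have "\<dots> < e" using N that l2norm_nonneg[of ?I] by (simp add: pos_less_divide_eq)
      finally show ?thesis using L1[of i j] by simp
    qed
    then show "\<exists>N. \<forall>i\<ge>N. \<forall>j\<ge>N. (LINT x|lebesgue. norm (s i x - s j x)) < e" by blast
  qed (use that in blast)
  define u where "u x = lim (\<lambda>i. s (r i) x)" for x
  have [measurable]: "u \<in> borel_measurable lebesgue" unfolding u_def by measurable
  have lim: "AE x in lebesgue. (\<lambda>i. s (r i) x) \<longlonglongrightarrow> u x"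
    using r(2) by eventually_elim (simp add: u_def Cauchy_convergent_iff convergent_LIMSEQ_iff)
  have fatou: "l2 (\<lambda>x. u x - s n x) \<and> l2norm (\<lambda>x. u x - s n x) \<le> e"
    if e: "e > 0" and N: "\<forall>i\<ge>N. \<forall>j\<ge>N. l2norm (\<lambda>x. s i x - s j x) < e" and n: "n \<ge> N" for e N n
  proof -
    have "(\<integral>\<^sup>+x. ennreal ((cmod (u x - s n x))\<^sup>2) \<partial>lebesgue) = (\<integral>\<^sup>+x. liminf (\<lambda>i. ennreal ((cmod (s (r i) x - s n x))\<^sup>2)) \<partial>lebesgue)"
    proof (rule nn_integral_cong_AE)
      show "AE x in lebesgue. ennreal ((cmod (u x - s n x))\<^sup>2) = liminf (\<lambda>i. ennreal ((cmod (s (r i) x - s n x))\<^sup>2))"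
        using lim
      proof eventually_elim
        case (elim x)
        then have "(\<lambda>i. ennreal ((cmod (s (r i) x - s n x))\<^sup>2)) \<longlonglongrightarrow> ennreal ((cmod (u x - s n x))\<^sup>2)"
          by (intro tendsto_intros)
        from lim_imp_Liminf[OF _ this] show ?case by simp
      qed
    qed
    also have "\<dots> \<le> liminf (\<lambda>i. (\<integral>\<^sup>+x. ennreal ((cmod (s (r i) x - s n x))\<^sup>2) \<partial>lebesgue))"
      by (rule nn_integral_liminf) measurable
    also have "\<dots> \<le> ennreal (e\<^sup>2)"
    proof (rule Liminf_le)
      have "(\<integral>\<^sup>+x. ennreal ((cmod (s (r i) x - s n x))\<^sup>2) \<partial>lebesgue) \<le> ennreal (e\<^sup>2)" if "i \<ge> N" for i
      proof -
        have "(\<integral>\<^sup>+x. ennreal ((cmod (s (r i) x - s n x))\<^sup>2) \<partial>lebesgue) = ennreal ((l2norm (\<lambda>x. s (r i) x - s n x))\<^sup>2)"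
          unfolding l2norm_square by (rule nn_integral_eq_integral[OF l2_square_integrable[OF l2_diff[OF s s]]]) simp
        also have "\<dots> \<le> ennreal (e\<^sup>2)"
        proof (rule ennreal_leI)
          have "r i \<ge> N" using that seq_suble[OF r(1), of i] by simp
          then have "l2norm (\<lambda>x. s (r i) x - s n x) < e" using N n by blast
          then show "(l2norm (\<lambda>x. s (r i) x - s n x))\<^sup>2 \<le> e\<^sup>2"
            by (intro power_mono l2norm_nonneg) simp
        qed
        finally show ?thesis .
      qed
      then show "\<forall>\<^sub>F i in sequentially. (\<integral>\<^sup>+x. ennreal ((cmod (s (r i) x - s n x))\<^sup>2) \<partial>lebesgue) \<le> ennreal (e\<^sup>2)"
        using eventually_sequentially by blast
    qed simp
    finally have le: "(\<integral>\<^sup>+x. ennreal ((cmod (u x - s n x))\<^sup>2) \<partial>lebesgue) \<le> ennreal (e\<^sup>2)" .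
    then have int: "integrable lebesgue (\<lambda>x. (cmod (u x - s n x))\<^sup>2)"
      by (intro integrableI_bounded) (auto simp: le_less_trans[OF _ ennreal_less_top])
    then have "ennreal ((l2norm (\<lambda>x. u x - s n x))\<^sup>2) \<le> ennreal (e\<^sup>2)"
      using le unfolding l2norm_square by (subst nn_integral_eq_integral[symmetric]) auto
    then have "(l2norm (\<lambda>x. u x - s n x))\<^sup>2 \<le> e\<^sup>2" by (simp add: ennreal_le_iff)
    then have "l2norm (\<lambda>x. u x - s n x) \<le> e" by (rule power2_le_imp_le) (rule less_imp_le[OF e])
    moreover have "l2 (\<lambda>x. u x - s n x)" using int by (simp add: l2_def)
    ultimately show ?thesis by blast
  qed
  show thesis
  proof (rule that[of u])
    obtain N where N: "\<forall>i\<ge>N. \<forall>j\<ge>N. l2norm (\<lambda>x. s i x - s j x) < 1" using cauchy[of 1] by auto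
    have "l2 (\<lambda>x. (u x - s N x) + s N x)"
      using fatou[OF _ N, of N] s by (intro l2_add) auto
    then show "l2 u" by simp
    show "u x = 0" if "x \<notin> C" for x using C(2)[OF that] by (simp add: u_def)
    show "\<exists>N. \<forall>n\<ge>N. l2norm (\<lambda>x. u x - s n x) \<le> e" if "e > 0" for e
      using fatou[OF that] cauchy[OF that] by blast
  qed
qed

text \<open>A finite set whose sum almost attains the supremum leaves only small sums outside of it.\<close>

lemma exhaust_square_sums:
  fixes a :: "'a \<Rightarrow> complex"
  assumes "\<And>F. finite F \<Longrightarrow> F \<subseteq> A \<Longrightarrow> (\<Sum>m\<in>F. (cmod (a m))\<^sup>2) \<le> C" "e > 0"
  obtains F where "finite F" "F \<subseteq> A"
    "\<And>G. finite G \<Longrightarrow> G \<subseteq> A \<Longrightarrow> G \<inter> F = {} \<Longrightarrow> (\<Sum>m\<in>G. (cmod (a m))\<^sup>2) < e"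
proof -
  define S where "S = (\<lambda>F. \<Sum>m\<in>F. (cmod (a m))\<^sup>2) ` {F. finite F \<and> F \<subseteq> A}"
  have ne: "S \<noteq> {}" unfolding S_def by auto
  have bdd: "bdd_above S" unfolding S_def using assms(1) by (auto intro!: bdd_aboveI[of _ C])
  have "Sup S - e < Sup S" using assms(2) by simp
  then obtain y where "y \<in> S" "Sup S - e < y" using less_cSup_iff[OF ne bdd] by blast
  then obtain F where F: "finite F" "F \<subseteq> A" "Sup S - e < (\<Sum>m\<in>F. (cmod (a m))\<^sup>2)" by (auto simp: S_def)
  show thesis
  proof (rule that[OF F(1,2)])
    fix G assume G: "finite G" "G \<subseteq> A" "G \<inter> F = {}"
    have "(\<Sum>m\<in>G \<union> F. (cmod (a m))\<^sup>2) \<le> Sup S"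
      by (rule cSup_upper[OF _ bdd]) (use F G in \<open>auto simp: S_def\<close>)
    moreover have "(\<Sum>m\<in>G \<union> F. (cmod (a m))\<^sup>2) = (\<Sum>m\<in>G. (cmod (a m))\<^sup>2) + (\<Sum>m\<in>F. (cmod (a m))\<^sup>2)"
      using F G by (intro sum.union_disjoint) auto
    ultimately show "(\<Sum>m\<in>G. (cmod (a m))\<^sup>2) < e" using F(3) by linarith
  qed
qed

text \<open>The partial sums over a growing sequence of finite sets of frequencies, chosen to leave small
  remainders, form a Cauchy sequence.\<close>

lemma Riesz_Fischer:
  fixes a :: "'a::euclidean_space \<Rightarrow> complex"
  assumes l: "l > 0" and a: "\<And>F. finite F \<Longrightarrow> F \<subseteq> frequencies l \<Longrightarrow> (\<Sum>m\<in>F. (cmod (a m))\<^sup>2) \<le> C"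
  obtains u where "l2 u" "\<And>x. x \<notin> cube l \<Longrightarrow> u x = 0" "\<And>m. m \<in> frequencies l \<Longrightarrow> fcoeff l u m = a m"
proof -
  let ?V = "vol TYPE('a) l"
  have V: "?V > 0" by (rule vol_pos[OF l])
  have "\<forall>k::nat. \<exists>F. finite F \<and> F \<subseteq> frequencies l \<and>
    (\<forall>G. finite G \<longrightarrow> G \<subseteq> frequencies l \<longrightarrow> G \<inter> F = {} \<longrightarrow> (\<Sum>m\<in>G. (cmod (a m))\<^sup>2) < inverse (real (Suc k)))"
  proof
    fix k :: nat
    have "inverse (real (Suc k)) > 0" by simp
    from exhaust_square_sums[OF a this] show "\<exists>F. finite F \<and> F \<subseteq> frequencies l \<and>
      (\<forall>G. finite G \<longrightarrow> G \<subseteq> frequencies l \<longrightarrow> G \<inter> F = {} \<longrightarrow> (\<Sum>m\<in>G. (cmod (a m))\<^sup>2) < inverse (real (Suc k)))"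
      by metis
  qed
  then obtain F where F: "\<And>k::nat. finite (F k)" "\<And>k. F k \<subseteq> frequencies l"
    "\<And>k G. finite G \<Longrightarrow> G \<subseteq> frequencies l \<Longrightarrow> G \<inter> F k = {} \<Longrightarrow> (\<Sum>m\<in>G. (cmod (a m))\<^sup>2) < inverse (real (Suc k))"
    by metis
  define G where "G k = (\<Union>j\<le>k. F j)" for k
  have G: "finite (G k)" "G k \<subseteq> frequencies l" "F k \<subseteq> G k" for k using F by (auto simp: G_def)
  have Gmono: "G i \<subseteq> G j" if "i \<le> j" for i j using that by (auto simp: G_def intro: order_trans)
  define H where "H k = uminus ` G k" for k
  have H: "finite (H k)" "H k \<subseteq> frequencies l" for k using G[of k] frequencies_uminus by (auto simp: H_def)
  define s where "s k x = (\<Sum>m\<in>H k. (a (- m) / of_real ?V) * cube_wave l m x)" for k x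
  have s: "l2 (s k)" for k unfolding s_def by (intro l2_sum l2_cmult l2_cube_wave)
  have diff: "(l2norm (\<lambda>x. s j x - s i x))\<^sup>2 \<le> inverse (real (Suc i)) / ?V" if "i \<le> j" for i j
  proof -
    have sub: "H i \<subseteq> H j" using Gmono[OF that] by (auto simp: H_def)
    have "(\<lambda>x. s j x - s i x) = (\<lambda>x. \<Sum>m\<in>H j - H i. (a (- m) / of_real ?V) * cube_wave l m x)"
      using sub H(1) by (auto simp: s_def sum_diff)
    then have "(l2norm (\<lambda>x. s j x - s i x))\<^sup>2 = ?V * (\<Sum>m\<in>H j - H i. (cmod (a (- m) / of_real ?V))\<^sup>2)"
      using H by (simp only:) (intro trig_energy[OF l], auto)
    also have "\<dots> = (\<Sum>m\<in>H j - H i. (cmod (a (- m)))\<^sup>2) / ?V"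
      using V by (simp add: norm_divide power_divide sum_divide_distrib[symmetric] power2_eq_square)
    also have "(\<Sum>m\<in>H j - H i. (cmod (a (- m)))\<^sup>2) = (\<Sum>m\<in>G j - G i. (cmod (a m))\<^sup>2)"
    proof -
      have "H j - H i = uminus ` (G j - G i)" by (auto simp: H_def)
      then show ?thesis by (simp add: sum.reindex)
    qed
    also have "\<dots> \<le> inverse (real (Suc i))"
      using F(3)[of "G j - G i" i] G(1)[of j] G(2)[of j] G(3)[of i] by fastforce
    finally show ?thesis using V by (simp add: divide_right_mono)
  qed
  have sym: "l2norm (\<lambda>x. s i x - s j x) = l2norm (\<lambda>x. s j x - s i x)" for i j
    by (simp add: l2norm_def norm_minus_commute)
  have cauchy: "\<exists>N. \<forall>i\<ge>N. \<forall>j\<ge>N. l2norm (\<lambda>x. s i x - s j x) < e" if e: "e > 0" for e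
  proof -
    obtain N where N: "inverse (real (Suc N)) < e\<^sup>2 * ?V"
      using reals_Archimedean[of "e\<^sup>2 * ?V"] e V by auto
    have *: "l2norm (\<lambda>x. s j x - s i x) < e" if "N \<le> i" "i \<le> j" for i j
    proof -
      have "inverse (real (Suc i)) \<le> inverse (real (Suc N))" using that by (simp add: le_imp_inverse_le)
      then have "inverse (real (Suc i)) < e\<^sup>2 * ?V" using N by linarith
      then have "inverse (real (Suc i)) / ?V < e\<^sup>2" using V by (simp add: pos_divide_less_eq)
      then have "(l2norm (\<lambda>x. s j x - s i x))\<^sup>2 < e\<^sup>2" using diff[OF that(2)] by linarith
      then show ?thesis using e by (simp add: power_less_imp_less_base)
    qed
    have "l2norm (\<lambda>x. s i x - s j x) < e" if "N \<le> i" "N \<le> j" for i j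
      using *[of i j] *[of j i] that sym[of i j] by (cases "i \<le> j") auto
    then show ?thesis by blast
  qed
  obtain u where u: "l2 u" "\<And>x. x \<notin> cube l \<Longrightarrow> u x = 0" "\<And>e. e > 0 \<Longrightarrow> \<exists>N. \<forall>n\<ge>N. l2norm (\<lambda>x. u x - s n x) \<le> e"
  proof (rule l2_complete[OF s compact_cube _ cauchy])
    show "s n x = 0" if "x \<notin> cube l" for n x using that by (simp add: s_def cube_wave_outside)
  qed (use that in blast)+
  have fs: "fcoeff l (s k) m = (\<Sum>n\<in>H k. (a (- n) / of_real ?V) * pairing (cube_wave l n) (cube_wave l m))" for k m
    unfolding fcoeff_def s_def
    by (subst pairing_sum_left) (simp_all only: pairing_cmult_left l2_cmult l2_cube_wave)
  have coeff_s: "fcoeff l (s k) m = a m" if m: "m \<in> G k" for k m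
  proof -
    have "fcoeff l (s k) m = (\<Sum>n\<in>H k. (a (- n) / of_real ?V) * pairing (cube_wave l n) (cube_wave l (- (- m))))"
      by (simp only: fs minus_minus)
    also have "\<dots> = (\<Sum>n\<in>H k. if n = - m then a m else 0)"
    proof (rule sum.cong[OF refl])
      fix n assume "n \<in> H k"
      then show "(a (- n) / of_real ?V) * pairing (cube_wave l n) (cube_wave l (- (- m))) = (if n = - m then a m else 0)"
        using V m H(2)[of k] G(2)[of k] by (subst pairing_cube_wave[OF l]) (auto intro: frequencies_uminus)
    qed
    also have "\<dots> = a m" using m H(1) by (simp add: sum.delta H_def)
    finally show ?thesis .
  qed
  have small: "cmod (fcoeff l u m - a m) < e" if m: "m \<in> frequencies l" "e > 0" for m e
  proof -
    \<comment> \<open>outside the exhausting sets the coefficient is zero, inside it is reproduced by the partial sums\<close>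
    let ?n = "l2norm (cube_wave l m)"
    have d: "e / (?n + 1) / 2 > 0" using l2norm_nonneg[of "cube_wave l m"] m by simp
    obtain N where N: "\<forall>n\<ge>N. l2norm (\<lambda>x. u x - s n x) \<le> e / (?n + 1) / 2" using u(3)[OF d] by blast
    have close: "cmod (fcoeff l u m - fcoeff l (s n) m) < e" if "n \<ge> N" for n
    proof -
      have "fcoeff l u m - fcoeff l (s n) m = pairing (\<lambda>x. u x - s n x) (cube_wave l m)"
        by (simp add: fcoeff_def pairing_diff_left u(1) s l2_cube_wave)
      also have "cmod \<dots> \<le> l2norm (\<lambda>x. u x - s n x) * ?n"
        by (rule Cauchy_Schwarz_pairing) (auto intro: l2_diff u s l2_cube_wave)
      also have "\<dots> \<le> (e / (?n + 1) / 2) * (?n + 1)"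
        using N that l2norm_nonneg[of "cube_wave l m"] l2norm_nonneg[of "\<lambda>x. u x - s n x"] d
        by (intro mult_mono) auto
      also have "\<dots> = e / 2" using l2norm_nonneg[of "cube_wave l m"] by (simp add: field_simps)
      also have "\<dots> < e" using m by simp
      finally show ?thesis .
    qed
    show ?thesis
    proof (cases "\<exists>k. m \<in> G k")
      case True
      then obtain k where "m \<in> G k" by blast
      then have "m \<in> G (max k N)" using Gmono[of k "max k N"] by auto
      then show ?thesis using close[of "max k N"] coeff_s by simp
    next
      case False
      have a0: "a m = 0"
      proof (rule ccontr)
        assume "a m \<noteq> 0"
        then obtain k where k: "inverse (real (Suc k)) < (cmod (a m))\<^sup>2"
          using reals_Archimedean[of "(cmod (a m))\<^sup>2"] by auto
        have "(\<Sum>n\<in>{m}. (cmod (a n))\<^sup>2) < inverse (real (Suc k))"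
          using False G(3)[of k] m by (intro F(3)) auto
        then show False using k by simp
      qed
      have "fcoeff l (s N) m = (\<Sum>n\<in>H N. (a (- n) / of_real ?V) * pairing (cube_wave l n) (cube_wave l (- (- m))))"
        by (simp only: fs minus_minus)
      also have "\<dots> = (\<Sum>n\<in>H N. 0)"
      proof (rule sum.cong[OF refl])
        fix n assume n: "n \<in> H N"
        then have "n \<noteq> - m" using False by (auto simp: H_def)
        then show "(a (- n) / of_real ?V) * pairing (cube_wave l n) (cube_wave l (- (- m))) = 0"
          using n m H(2)[of N] by (subst pairing_cube_wave[OF l]) (auto intro: frequencies_uminus)
      qed
      finally show ?thesis using close[of N] a0 by simp
    qed
  qed
  show thesis
  proof (rule that[OF u(1,2)])
    fix m :: 'a assume "m \<in> frequencies l"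
    then have "\<forall>e>0. cmod (fcoeff l u m - a m) < e" using small by blast
    then show "fcoeff l u m = a m"
      by (metis less_irrefl right_minus_eq zero_less_norm_iff)
  qed
qed

lemma pairing_cong: "(\<And>x. f x * g x = f' x * g' x) \<Longrightarrow> pairing f g = pairing f' g'"
  unfolding pairing_def by (rule Bochner_Integration.integral_cong) auto

section \<open>Density of trigonometric polynomials\<close>

inductive_set trig_polys :: "'a::euclidean_space set \<Rightarrow> ('a \<Rightarrow> complex) set" for \<Lambda> where
  trig_zero: "(\<lambda>x. 0) \<in> trig_polys \<Lambda>"
| trig_step: "p \<in> trig_polys \<Lambda> \<Longrightarrow> m \<in> \<Lambda> \<Longrightarrow> (\<lambda>x. c * wave m x + p x) \<in> trig_polys \<Lambda>"

lemma trig_normal_form: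
  assumes "p \<in> trig_polys \<Lambda>"
  obtains F c where "finite F" "F \<subseteq> \<Lambda>" "\<And>x. p x = (\<Sum>m\<in>F. c m * wave m x)"
proof -
  have "\<exists>F c. finite F \<and> F \<subseteq> \<Lambda> \<and> (\<forall>x. p x = (\<Sum>m\<in>F. c m * wave m x))"
    using assms
  proof induction
    case trig_zero
    show ?case by (intro exI[of _ "{}"]) auto
  next
    case (trig_step p m a)
    then obtain F c where F: "finite F" "F \<subseteq> \<Lambda>" "\<And>x. p x = (\<Sum>m\<in>F. c m * wave m x)" by blast
    have "a * wave m x + p x = (\<Sum>k\<in>insert m F. ((if k \<in> F then c k else 0) + (if k = m then a else 0)) * wave k x)" for x
    proof -
      have "(\<Sum>k\<in>insert m F. ((if k \<in> F then c k else 0) + (if k = m then a else 0)) * wave k x) =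
         (\<Sum>k\<in>insert m F. (if k \<in> F then c k * wave k x else 0)) + (\<Sum>k\<in>insert m F. (if k = m then a * wave m x else 0))"
        unfolding sum.distrib[symmetric] by (intro sum.cong) (auto simp: distrib_right)
      also have "(\<Sum>k\<in>insert m F. (if k \<in> F then c k * wave k x else 0)) = p x"
        unfolding F(3) using F(1) by (intro sum.mono_neutral_cong_right) auto
      also have "(\<Sum>k\<in>insert m F. (if k = m then a * wave m x else 0)) = a * wave m x"
        using F(1) by (simp add: sum.delta)
      finally show ?thesis by simp
    qed
    then show ?case
      using F trig_step
      by (intro exI[of _ "insert m F"] exI[of _ "\<lambda>k. (if k \<in> F then c k else 0) + (if k = m then a else 0)"]) auto
  qed
  then show thesis using that by blast
qed

lemma trig_monom: "m \<in> \<Lambda> \<Longrightarrow> (\<lambda>x. c * wave m x) \<in> trig_polys \<Lambda>"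
  using trig_step[OF trig_zero, of m \<Lambda> c] by simp

lemma trig_add: "p \<in> trig_polys \<Lambda> \<Longrightarrow> q \<in> trig_polys \<Lambda> \<Longrightarrow> (\<lambda>x. p x + q x) \<in> trig_polys \<Lambda>"
proof (induction p rule: trig_polys.induct)
  case (trig_step p m c)
  then show ?case using trig_polys.trig_step[of "\<lambda>x. p x + q x" \<Lambda> m c] by (simp add: add.assoc)
qed simp

lemma trig_mult_wave:
  assumes "\<And>k. k \<in> \<Lambda> \<Longrightarrow> k + m \<in> \<Lambda>'"
  shows "p \<in> trig_polys \<Lambda> \<Longrightarrow> (\<lambda>x. p x * (c * wave m x)) \<in> trig_polys \<Lambda>'"
proof (induction p rule: trig_polys.induct)
  case (trig_step p k d)
  have "(\<lambda>x. (c * d) * wave (k + m) x + p x * (c * wave m x)) \<in> trig_polys \<Lambda>'"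
    by (rule trig_polys.trig_step) (use trig_step assms in auto)
  then show ?case by (simp add: wave_mult[symmetric] algebra_simps)
qed (simp add: trig_zero)

lemma trig_mult:
  assumes "\<And>k m. k \<in> \<Lambda> \<Longrightarrow> m \<in> \<Lambda> \<Longrightarrow> k + m \<in> \<Lambda>"
  shows "q \<in> trig_polys \<Lambda> \<Longrightarrow> p \<in> trig_polys \<Lambda> \<Longrightarrow> (\<lambda>x. p x * q x) \<in> trig_polys \<Lambda>"
proof (induction q rule: trig_polys.induct)
  case (trig_step q m c)
  have "(\<lambda>x. p x * (c * wave m x) + p x * q x) \<in> trig_polys \<Lambda>"
    by (intro trig_add trig_mult_wave[of \<Lambda>]) (use trig_step assms in auto)
  then show ?case by (simp add: distrib_left)
qed (simp add: trig_zero)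

lemma periods_add: "k \<in> periods l \<Longrightarrow> m \<in> periods l \<Longrightarrow> k + m \<in> periods l"
  unfolding periods_def
proof safe
  fix b :: 'a assume *: "\<forall>b\<in>Basis. \<exists>j::int. l * (k \<bullet> b) = of_int j" "\<forall>b\<in>Basis. \<exists>j::int. l * (m \<bullet> b) = of_int j" "b \<in> Basis"
  then obtain i j :: int where "l * (k \<bullet> b) = of_int i" "l * (m \<bullet> b) = of_int j" by blast
  then show "\<exists>j::int. l * ((k + m) \<bullet> b) = of_int j"
    by (intro exI[of _ "i + j"]) (simp add: inner_add_left algebra_simps)
qed

lemma periods_Basis: 
  assumes "l > 0" "b \<in> Basis" "s = 1 \<or> s = -1"
  shows "(s / l) *\<^sub>R b \<in> periods l"
  unfolding periods_def
proof safe
  fix c :: 'a assume "c \<in> Basis"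
  then have "l * ((s / l) *\<^sub>R b \<bullet> c) = of_int (if b = c then (if s = 1 then 1 else -1) else 0)"
    using assms by (auto simp: inner_Basis)
  then show "\<exists>j::int. l * ((s / l) *\<^sub>R b \<bullet> c) = of_int j" by blast
qed

lemma half_frequency: "l > 0 \<Longrightarrow> (1 / (2 * l)) *\<^sub>R One \<in> frequencies l"
  unfolding frequencies_def by (auto intro!: exI[of _ 0])

lemma periods_add_frequency:
  assumes "k \<in> periods l" "m \<in> frequencies l" shows "k + m \<in> frequencies l"
  unfolding frequencies_def
proof safe
  fix b :: 'a assume "b \<in> Basis"
  then obtain i j :: int where "l * (k \<bullet> b) = of_int i" "l * (m \<bullet> b) = of_int j + 1/2"
    using assms unfolding periods_def frequencies_def by blast
  then show "\<exists>j::int. l * ((k + m) \<bullet> b) = of_int j + 1/2"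
    by (intro exI[of _ "i + j"]) (simp add: inner_add_left algebra_simps)
qed

lemma trig_cos_sin:
  assumes "l > 0" "b \<in> Basis"
  shows "(\<lambda>x. complex_of_real (cos (x \<bullet> b / l))) \<in> trig_polys (periods l)"
    "(\<lambda>x. complex_of_real (sin (x \<bullet> b / l))) \<in> trig_polys (periods l)"
proof -
  have 1: "wave ((1 / l) *\<^sub>R b) x = cis (x \<bullet> b / l)" "wave ((- 1 / l) *\<^sub>R b) x = cis (- (x \<bullet> b / l))" for x
    by (simp_all add: wave_def inner_commute)
  have p: "(1 / l) *\<^sub>R b \<in> periods l" "(- 1 / l) *\<^sub>R b \<in> periods l"
    using periods_Basis[OF assms, of 1] periods_Basis[OF assms, of "-1"] by auto
  have "(\<lambda>x. (1/2) * wave ((1 / l) *\<^sub>R b) x + (1/2) * wave ((- 1 / l) *\<^sub>R b) x) \<in> trig_polys (periods l)"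
    by (intro trig_add trig_monom p)
  moreover have "(1/2) * wave ((1 / l) *\<^sub>R b) x + (1/2) * wave ((- 1 / l) *\<^sub>R b) x = complex_of_real (cos (x \<bullet> b / l))" for x
    unfolding 1 by (simp add: complex_eq_iff)
  ultimately show "(\<lambda>x. complex_of_real (cos (x \<bullet> b / l))) \<in> trig_polys (periods l)" by simp
  have "(\<lambda>x. (-\<i>/2) * wave ((1 / l) *\<^sub>R b) x + (\<i>/2) * wave ((- 1 / l) *\<^sub>R b) x) \<in> trig_polys (periods l)"
    by (intro trig_add trig_monom p)
  moreover have "(-\<i>/2) * wave ((1 / l) *\<^sub>R b) x + (\<i>/2) * wave ((- 1 / l) *\<^sub>R b) x = complex_of_real (sin (x \<bullet> b / l))" for x
    unfolding 1 by (simp add: complex_eq_iff)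
  ultimately show "(\<lambda>x. complex_of_real (sin (x \<bullet> b / l))) \<in> trig_polys (periods l)" by simp
qed

text \<open>The theorem of Stone and Weierstrass on the torus. A function that vanishes outside the open cube
  descends continuously to the torus, because opposite faces are identified where it is zero.\<close>

lemma real_trig_dense:
  fixes \<psi> :: "'a::euclidean_space \<Rightarrow> real"
  assumes l: "l > 0" and \<psi>: "continuous_on UNIV \<psi>" "\<And>x. x \<notin> open_cube l \<Longrightarrow> \<psi> x = 0" and e: "e > 0"
  shows "\<exists>g. (\<lambda>x. complex_of_real (g x)) \<in> trig_polys (periods l) \<and> (\<forall>x\<in>cube l. \<bar>\<psi> x - g x\<bar> < e)"
proof -
  \<comment> \<open>the quotient map onto the torus, realised in the square of the space\<close>
  define \<tau> :: "'a \<Rightarrow> 'a \<times> 'a" where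
    "\<tau> x = ((\<Sum>b\<in>Basis. cos (x \<bullet> b / l) *\<^sub>R b), (\<Sum>b\<in>Basis. sin (x \<bullet> b / l) *\<^sub>R b))" for x
  have \<tau>_comp: "fst (\<tau> x) \<bullet> b = cos (x \<bullet> b / l)" "snd (\<tau> x) \<bullet> b = sin (x \<bullet> b / l)" if "b \<in> Basis" for x b
    using that by (simp_all add: \<tau>_def)
  have cont\<tau>: "continuous_on A \<tau>" for A
    unfolding \<tau>_def using l by (intro continuous_intros) auto
  define S where "S = \<tau> ` cube l"
  have S: "compact S" unfolding S_def by (intro compact_continuous_image cont\<tau> compact_cube)
  have inj: "x = y" if "x \<in> open_cube l" "y \<in> cube l" "\<tau> x = \<tau> y" for x y
  proof (rule euclidean_eqI)
    fix b :: 'a assume b: "b \<in> Basis"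
    have "sin (x \<bullet> b / l) = sin (y \<bullet> b / l) \<and> cos (x \<bullet> b / l) = cos (y \<bullet> b / l)"
      using \<tau>_comp[OF b, of x] \<tau>_comp[OF b, of y] that(3) by metis
    then obtain n :: int where n: "x \<bullet> b / l = y \<bullet> b / l + 2 * pi * of_int n"
      using sin_cos_eq_iff by blast
    have "\<bar>x \<bullet> b / l\<bar> < pi" "\<bar>y \<bullet> b / l\<bar> \<le> pi"
      using that b l by (auto simp: mem_open_cube mem_cube abs_divide field_simps)
    then have "\<bar>2 * pi * of_int n\<bar> < 2 * pi" using n by linarith
    then have "n = 0" by (simp add: abs_mult)
    then show "x \<bullet> b = y \<bullet> b" using n l by simp
  qed
  define \<psi>' where "\<psi>' y = \<psi> (inv_into (cube l) \<tau> y)" for y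
  have \<psi>': "\<psi>' (\<tau> x) = \<psi> x" if x: "x \<in> cube l" for x
  proof -
    define z where "z = inv_into (cube l) \<tau> (\<tau> x)"
    have z: "z \<in> cube l" "\<tau> z = \<tau> x"
      unfolding z_def using x by (auto intro: inv_into_into f_inv_into_f)
    have "\<psi> z = \<psi> x"
    proof (cases "x \<in> open_cube l \<or> z \<in> open_cube l")
      case True
      then show ?thesis using inj[of x z] inj[of z x] x z by auto
    next
      case False
      then show ?thesis using \<psi>(2) by simp
    qed
    then show ?thesis by (simp add: \<psi>'_def z_def)
  qed
  have cont\<psi>': "continuous_on S \<psi>'"
  proof (subst continuous_on_closed_vimage[OF compact_imp_closed[OF S]], intro allI impI)
    fix B :: "real set" assume B: "closed B"
    have "\<psi>' -` B \<inter> S = \<tau> ` (cube l \<inter> \<psi> -` B)"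
      unfolding S_def using \<psi>' by auto
    moreover have "closed (\<psi> -` B)"
      using continuous_closed_vimage[OF B] \<psi>(1) by (metis UNIV_I continuous_on_eq_continuous_at open_UNIV)
    ultimately have "compact (\<psi>' -` B \<inter> S)"
      by (simp add: compact_continuous_image[OF cont\<tau>] compact_Int_closed[OF compact_cube])
    then show "closed (\<psi>' -` B \<inter> S)" by (rule compact_imp_closed)
  qed
  define R where "R = {g. continuous_on S g \<and> (\<exists>t. (\<lambda>x. complex_of_real (t x)) \<in> trig_polys (periods l) \<and> (\<forall>x\<in>cube l. g (\<tau> x) = t x))}"
  have 0: "0 \<in> periods l" by (auto simp: periods_def intro!: exI[of _ 0])
  interpret function_ring_on R S
  proof
    show "compact S" by (rule S)
    show "continuous_on S f" if "f \<in> R" for f using that by (simp add: R_def)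
    show "(\<lambda>x. f x + g x) \<in> R" if "f \<in> R" "g \<in> R" for f g
    proof -
      obtain s t where "continuous_on S f" "continuous_on S g"
        "(\<lambda>x. complex_of_real (s x)) \<in> trig_polys (periods l)" "\<forall>x\<in>cube l. f (\<tau> x) = s x"
        "(\<lambda>x. complex_of_real (t x)) \<in> trig_polys (periods l)" "\<forall>x\<in>cube l. g (\<tau> x) = t x"
        using \<open>f \<in> R\<close> \<open>g \<in> R\<close> by (auto simp: R_def)
      then show ?thesis
        using trig_add[of "\<lambda>x. complex_of_real (s x)" "periods l" "\<lambda>x. complex_of_real (t x)"]
        by (auto simp: R_def intro!: continuous_on_add exI[of _ "\<lambda>x. s x + t x"])
    qed
    show "(\<lambda>x. f x * g x) \<in> R" if "f \<in> R" "g \<in> R" for f g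
    proof -
      obtain s t where "continuous_on S f" "continuous_on S g"
        "(\<lambda>x. complex_of_real (s x)) \<in> trig_polys (periods l)" "\<forall>x\<in>cube l. f (\<tau> x) = s x"
        "(\<lambda>x. complex_of_real (t x)) \<in> trig_polys (periods l)" "\<forall>x\<in>cube l. g (\<tau> x) = t x"
        using \<open>f \<in> R\<close> \<open>g \<in> R\<close> by (auto simp: R_def)
      then show ?thesis
        using trig_mult[where \<Lambda>="periods l" and p="\<lambda>x. complex_of_real (s x)" and q="\<lambda>x. complex_of_real (t x)", OF periods_add]
        by (auto simp: R_def intro!: continuous_on_mult exI[of _ "\<lambda>x. s x * t x"])
    qed
    show "(\<lambda>_. c) \<in> R" for c
      using trig_monom[OF 0, of "complex_of_real c"]
      by (auto simp: R_def wave_zero intro!: exI[of _ "\<lambda>_. c"])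
    show "\<exists>f\<in>R. f x \<noteq> f y" if xy: "x \<in> S" "y \<in> S" "x \<noteq> y" for x y
    proof -
      have c: "(\<lambda>z. fst z \<bullet> b) \<in> R" "(\<lambda>z. snd z \<bullet> b) \<in> R" if "b \<in> Basis" for b
      proof -
        show "(\<lambda>z. fst z \<bullet> b) \<in> R"
          unfolding R_def using trig_cos_sin(1)[OF l that] \<tau>_comp(1)[OF that]
          by (auto intro!: continuous_intros exI[of _ "\<lambda>x. cos (x \<bullet> b / l)"])
        show "(\<lambda>z. snd z \<bullet> b) \<in> R"
          unfolding R_def using trig_cos_sin(2)[OF l that] \<tau>_comp(2)[OF that]
          by (auto intro!: continuous_intros exI[of _ "\<lambda>x. sin (x \<bullet> b / l)"])
      qed
      from xy(3) have "fst x \<noteq> fst y \<or> snd x \<noteq> snd y" by (auto simp: prod_eq_iff)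
      then show ?thesis
      proof
        assume "fst x \<noteq> fst y"
        then obtain b where "b \<in> Basis" "fst x \<bullet> b \<noteq> fst y \<bullet> b" using euclidean_eqI by blast
        then show ?thesis using c(1) by (intro bexI[of _ "\<lambda>z. fst z \<bullet> b"]) auto
      next
        assume "snd x \<noteq> snd y"
        then obtain b where "b \<in> Basis" "snd x \<bullet> b \<noteq> snd y \<bullet> b" using euclidean_eqI by blast
        then show ?thesis using c(2) by (intro bexI[of _ "\<lambda>z. snd z \<bullet> b"]) auto
      qed
    qed
  qed
  obtain g where g: "g \<in> R" "\<forall>x\<in>S. \<bar>\<psi>' x - g x\<bar> < e"
    using Stone_Weierstrass_basic[OF cont\<psi>' e] by blast
  then obtain t where t: "(\<lambda>x. complex_of_real (t x)) \<in> trig_polys (periods l)" "\<forall>x\<in>cube l. g (\<tau> x) = t x"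
    by (auto simp: R_def)
  have "\<bar>\<psi> x - t x\<bar> < e" if "x \<in> cube l" for x
  proof -
    have "\<tau> x \<in> S" using that by (simp add: S_def)
    with g(2) have "\<bar>\<psi>' (\<tau> x) - g (\<tau> x)\<bar> < e" by blast
    then show ?thesis using t(2) \<psi>'[OF that] that by simp
  qed
  then show ?thesis using t(1) by blast
qed

text \<open>Multiplication with a half-integer wave reduces the shifted frequencies to the periodic case.\<close>

lemma trig_dense:
  fixes \<phi> :: "'a::euclidean_space \<Rightarrow> complex"
  assumes l: "l > 0" and \<phi>: "continuous_on UNIV \<phi>" "\<And>x. x \<notin> open_cube l \<Longrightarrow> \<phi> x = 0" and e: "e > 0"
  obtains F c where "finite F" "F \<subseteq> frequencies l" "\<And>x. x \<in> cube l \<Longrightarrow> cmod (\<phi> x - (\<Sum>m\<in>F. c m * wave m x)) < e"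
proof -
  define \<theta> :: 'a where "\<theta> = (1 / (2 * l)) *\<^sub>R One"
  have \<theta>: "\<theta> \<in> frequencies l" unfolding \<theta>_def by (rule half_frequency[OF l])
  define \<psi> where "\<psi> x = \<phi> x * wave (- \<theta>) x" for x
  have c: "continuous_on UNIV \<psi>"
    unfolding \<psi>_def by (intro continuous_intros \<phi> smooth_continuous smooth_wave)
  have z: "\<psi> x = 0" if "x \<notin> open_cube l" for x using \<phi>(2)[OF that] by (simp add: \<psi>_def)
  obtain g where g: "(\<lambda>x. complex_of_real (g x)) \<in> trig_polys (periods l)" "\<forall>x\<in>cube l. \<bar>Re (\<psi> x) - g x\<bar> < e / 2"
    using real_trig_dense[OF l, of "\<lambda>x. Re (\<psi> x)" "e/2"] c z e by (auto intro: continuous_on_Re)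
  obtain h where h: "(\<lambda>x. complex_of_real (h x)) \<in> trig_polys (periods l)" "\<forall>x\<in>cube l. \<bar>Im (\<psi> x) - h x\<bar> < e / 2"
    using real_trig_dense[OF l, of "\<lambda>x. Im (\<psi> x)" "e/2"] c z e by (auto intro: continuous_on_Im)
  have 0: "0 \<in> periods l" by (auto simp: periods_def intro!: exI[of _ 0])
  have i: "(\<lambda>x. complex_of_real (h x) * \<i>) \<in> trig_polys (periods l)"
    using trig_mult_wave[of "periods l" 0 "periods l", OF _ h(1), of \<i>] by (simp add: wave_zero)
  define p where "p x = (of_real (g x) + of_real (h x) * \<i>) * (1 * wave \<theta> x)" for x
  have "p \<in> trig_polys (frequencies l)"
    unfolding p_def
    by (rule trig_mult_wave[OF _ trig_add[OF g(1) i]]) (use \<theta> periods_add_frequency in blast)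
  then obtain F c where F: "finite F" "F \<subseteq> frequencies l" "\<And>x. p x = (\<Sum>m\<in>F. c m * wave m x)"
    by (rule trig_normal_form) blast
  have "cmod (\<phi> x - p x) < e" if x: "x \<in> cube l" for x
  proof -
    have "wave (- \<theta>) x * wave \<theta> x = 1" by (simp add: wave_mult wave_zero)
    then have "\<phi> x = \<psi> x * wave \<theta> x" by (simp add: \<psi>_def mult.assoc)
    then have "\<phi> x - p x = (\<psi> x - (of_real (g x) + of_real (h x) * \<i>)) * wave \<theta> x"
      by (simp add: p_def algebra_simps)
    then have "cmod (\<phi> x - p x) = cmod (\<psi> x - (of_real (g x) + of_real (h x) * \<i>))" by (simp add: norm_mult)
    also have "\<dots> \<le> \<bar>Re (\<psi> x) - g x\<bar> + \<bar>Im (\<psi> x) - h x\<bar>"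
      using cmod_le[of "\<psi> x - (of_real (g x) + of_real (h x) * \<i>)"] by simp
    also have "\<dots> < e" using g(2) h(2) x by fastforce
    finally show ?thesis .
  qed
  then show thesis using that[OF F(1,2)] F(3) by metis
qed

text \<open>A bilinear identity between Fourier coefficients holds between the functions themselves. All \<open>\<phi> i\<close>
  are approximated in the square norm by their Fourier sums over one common finite set of
  frequencies, and for these sums the identity is a finite sum of the assumed ones.\<close>

lemma pairing_transfer:
  fixes u \<phi> :: "'i \<Rightarrow> 'a::euclidean_space \<Rightarrow> complex"
  assumes l: "l > 0" and I: "finite I"
    and u: "\<And>i. i \<in> I \<Longrightarrow> l2 (u i)"
    and \<phi>: "\<And>i. i \<in> I \<Longrightarrow> continuous_on UNIV (\<phi> i)" "\<And>i x. i \<in> I \<Longrightarrow> x \<notin> open_cube l \<Longrightarrow> \<phi> i x = 0"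
    and eq: "\<And>m. m \<in> frequencies l \<Longrightarrow> (\<Sum>i\<in>I. fcoeff l (u i) m * fcoeff l (\<phi> i) (- m)) = 0"
  shows "(\<Sum>i\<in>I. pairing (u i) (\<phi> i)) = 0"
proof -
  let ?V = "vol TYPE('a) l"
  have V: "?V > 0" by (rule vol_pos[OF l])
  let ?J = "l2norm (indicator (cube l :: 'a set))"
  define K where "K = (\<Sum>i\<in>I. l2norm (u i)) * ?J"
  have l2I: "l2 (indicator (cube l) :: 'a \<Rightarrow> complex)" by (rule l2_indicator_compact[OF compact_cube])
  have l2\<phi>: "l2 (\<phi> i)" if "i \<in> I" for i
    by (rule l2_continuous_compact_support[OF \<phi>(1) compact_cube[of l]]) (use that \<phi>(2) open_cube_subset in blast)+
  have bound: "cmod (\<Sum>i\<in>I. pairing (u i) (\<phi> i)) \<le> e * K" if e: "e > 0" for e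
  proof -
    have "\<forall>i\<in>I. \<exists>F c. finite F \<and> F \<subseteq> frequencies l \<and> (\<forall>x\<in>cube l. cmod (\<phi> i x - (\<Sum>m\<in>F. c m * wave m x)) < e)"
      using trig_dense[OF l \<phi> e] by metis
    then obtain F c where F: "\<And>i. i \<in> I \<Longrightarrow> finite (F i)" "\<And>i. i \<in> I \<Longrightarrow> F i \<subseteq> frequencies l"
      "\<And>i x. i \<in> I \<Longrightarrow> x \<in> cube l \<Longrightarrow> cmod (\<phi> i x - (\<Sum>m\<in>F i. c i m * wave m x)) < e"
      by metis
    define G where "G = (\<Union>i\<in>I. F i)"
    have G: "finite G" "G \<subseteq> frequencies l" using F I by (auto simp: G_def)
    define d where "d i m = (if m \<in> F i then c i m else 0)" for i m
    define s where "s i x = (\<Sum>m\<in>G. (fcoeff l (\<phi> i) (- m) / of_real ?V) * cube_wave l m x)" for i x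
    have l2s: "l2 (s i)" for i unfolding s_def by (intro l2_sum l2_cmult l2_cube_wave)
    have near: "l2norm (\<lambda>x. \<phi> i x - s i x) \<le> e * ?J" if i: "i \<in> I" for i
    proof -
      define p where "p x = (\<Sum>m\<in>G. d i m * cube_wave l m x)" for x
      have l2p: "l2 p" unfolding p_def by (intro l2_sum l2_cmult l2_cube_wave)
      have "(l2norm (\<lambda>x. \<phi> i x - s i x))\<^sup>2 \<le> (l2norm (\<lambda>x. \<phi> i x - p x))\<^sup>2"
        unfolding s_def p_def best_approximation[OF l G l2\<phi>[OF i]] using V by (simp add: sum_nonneg)
      then have "l2norm (\<lambda>x. \<phi> i x - s i x) \<le> l2norm (\<lambda>x. \<phi> i x - p x)"
        by (rule power2_le_imp_le) (rule l2norm_nonneg)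
      also have "\<dots> \<le> e * ?J"
      proof (rule l2norm_mono[OF l2_diff[OF l2\<phi>[OF i] l2p] l2I])
        show "AE x in lebesgue. cmod (\<phi> i x - p x) \<le> e * cmod (indicator (cube l) x)"
        proof (rule AE_I2)
          fix x
          show "cmod (\<phi> i x - p x) \<le> e * cmod (indicator (cube l) x)"
          proof (cases "x \<in> cube l")
            case True
            have "p x = (\<Sum>m\<in>F i. c i m * wave m x)"
              unfolding p_def using True G(1) i
              by (intro sum.mono_neutral_cong_right) (auto simp: d_def G_def cube_wave_def zero_ext_def)
            then show ?thesis using F(3)[OF i True] True by simp
          next
            case False
            then have "x \<notin> open_cube l" using open_cube_subset by blast
            then show ?thesis using False \<phi>(2)[OF i] by (simp add: p_def cube_wave_outside)
          qed
        qed
      qed (use e in simp)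
      finally show ?thesis .
    qed
    have zero: "(\<Sum>i\<in>I. pairing (u i) (s i)) = 0"
    proof -
      have "(\<Sum>i\<in>I. pairing (u i) (s i)) = (\<Sum>i\<in>I. \<Sum>m\<in>G. (fcoeff l (\<phi> i) (- m) / of_real ?V) * fcoeff l (u i) m)"
        unfolding s_def fcoeff_def
      proof (rule sum.cong[OF refl])
        fix i assume "i \<in> I"
        then show "pairing (u i) (\<lambda>x. \<Sum>m\<in>G. pairing (\<phi> i) (cube_wave l (- m)) / of_real ?V * cube_wave l m x) =
          (\<Sum>m\<in>G. pairing (\<phi> i) (cube_wave l (- m)) / of_real ?V * pairing (u i) (cube_wave l m))"
          by (subst pairing_sum_right) (simp_all only: l2_cmult l2_cube_wave u pairing_cmult_right)
      qed
      also have "\<dots> = (\<Sum>m\<in>G. (\<Sum>i\<in>I. fcoeff l (u i) m * fcoeff l (\<phi> i) (- m)) / of_real ?V)"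
        by (subst sum.swap) (simp add: sum_divide_distrib mult.commute)
      also have "\<dots> = 0" using eq G(2) by (intro sum.neutral) auto
      finally show ?thesis .
    qed
    have "(\<Sum>i\<in>I. pairing (u i) (\<phi> i)) = (\<Sum>i\<in>I. pairing (u i) (\<phi> i)) - (\<Sum>i\<in>I. pairing (u i) (s i))"
      using zero by simp
    also have "\<dots> = (\<Sum>i\<in>I. pairing (u i) (\<lambda>x. \<phi> i x - s i x))"
      unfolding sum_subtractf[symmetric] by (intro sum.cong refl pairing_diff_right[symmetric] l2\<phi> l2s u)
    finally have "cmod (\<Sum>i\<in>I. pairing (u i) (\<phi> i)) \<le> (\<Sum>i\<in>I. cmod (pairing (u i) (\<lambda>x. \<phi> i x - s i x)))"
      by (simp add: norm_sum)
    also have "\<dots> \<le> (\<Sum>i\<in>I. l2norm (u i) * (e * ?J))"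
    proof (rule sum_mono)
      fix i assume i: "i \<in> I"
      have "cmod (pairing (u i) (\<lambda>x. \<phi> i x - s i x)) \<le> l2norm (u i) * l2norm (\<lambda>x. \<phi> i x - s i x)"
        by (rule Cauchy_Schwarz_pairing[OF u[OF i] l2_diff[OF l2\<phi>[OF i] l2s]])
      also have "\<dots> \<le> l2norm (u i) * (e * ?J)" by (rule mult_left_mono[OF near[OF i] l2norm_nonneg])
      finally show "cmod (pairing (u i) (\<lambda>x. \<phi> i x - s i x)) \<le> l2norm (u i) * (e * ?J)" .
    qed
    also have "\<dots> = e * K" by (simp add: K_def sum_distrib_right sum_distrib_left mult_ac)
    finally show ?thesis .
  qed
  have K: "K \<ge> 0" unfolding K_def by (intro mult_nonneg_nonneg sum_nonneg l2norm_nonneg)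
  have "cmod (\<Sum>i\<in>I. pairing (u i) (\<phi> i)) \<le> 0 + e" if "e > 0" for e
  proof -
    have "cmod (\<Sum>i\<in>I. pairing (u i) (\<phi> i)) \<le> e / (K + 1) * K" by (rule bound) (use that K in simp)
    also have "\<dots> \<le> e" using that K by (simp add: field_simps)
    finally show ?thesis by simp
  qed
  then have "cmod (\<Sum>i\<in>I. pairing (u i) (\<phi> i)) \<le> 0" by (rule field_le_epsilon)
  then show ?thesis by simp
qed

section \<open>Weak derivatives through Fourier coefficients\<close>

definition weak_dird :: "'a::euclidean_space set \<Rightarrow> 'a \<Rightarrow> ('a \<Rightarrow> complex) \<Rightarrow> ('a \<Rightarrow> complex) \<Rightarrow> bool" where
  "weak_dird U v f g \<longleftrightarrow> (\<forall>\<phi>\<in>test_functions U. pairing f (dird v \<phi>) = - pairing g \<phi>)"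

lemma fcoeff_dird_test:
  assumes "\<phi> \<in> test_functions (open_cube l)"
  shows "fcoeff l (dird v \<phi>) (- m) = \<i> * of_real (m \<bullet> v) * fcoeff l \<phi> (- m)"
proof -
  have red: "pairing \<psi> (cube_wave l (- m)) = pairing (wave (- m)) \<psi>" if "\<psi> \<in> test_functions (open_cube l)" for \<psi>
  proof -
    have "\<psi> x * cube_wave l (- m) x = wave (- m) x * \<psi> x" for x
    proof (cases "x \<in> cube l")
      case False
      then have "\<psi> x = 0" using test_zero_outside[OF that] open_cube_subset by blast
      then show ?thesis by simp
    qed (simp add: cube_wave_def zero_ext_def)
    then show ?thesis by (rule pairing_cong)
  qed
  have "dird v (wave (- m)) = (\<lambda>x. (- \<i> * of_real (m \<bullet> v)) * wave (- m) x)"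
    by (auto simp: dird_wave)
  then have "pairing (wave (- m)) (dird v \<phi>) = \<i> * of_real (m \<bullet> v) * pairing (wave (- m)) \<phi>"
    using pairing_dird_smooth[OF assms smooth_wave, of "- m" v] by (simp only: pairing_cmult_left) simp
  then show ?thesis
    unfolding fcoeff_def red[OF assms] red[OF test_dird[OF assms]] .
qed

lemma weak_dird_if_coeffs:
  assumes l: "l > 0" and u: "l2 u" "l2 g"
    and eq: "\<And>m. m \<in> frequencies l \<Longrightarrow> fcoeff l g m = - \<i> * of_real (m \<bullet> v) * fcoeff l u m"
  shows "weak_dird (open_cube l) v u g"
  unfolding weak_dird_def
proof
  fix \<phi> :: "'a \<Rightarrow> complex" assume \<phi>: "\<phi> \<in> test_functions (open_cube l)"
  have "(\<Sum>i\<in>UNIV. pairing (if i then u else g) (if i then dird v \<phi> else \<phi>)) = 0"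
  proof (rule pairing_transfer[OF l])
    fix m :: 'a assume "m \<in> frequencies l"
    then show "(\<Sum>i\<in>UNIV. fcoeff l (if i then u else g) m * fcoeff l (if i then dird v \<phi> else \<phi>) (- m)) = 0"
      by (simp add: UNIV_bool eq fcoeff_dird_test[OF \<phi>])
  next
    fix i :: bool
    have t: "(if i then dird v \<phi> else \<phi>) \<in> test_functions (open_cube l)" using \<phi> test_dird by auto
    show "continuous_on UNIV (if i then dird v \<phi> else \<phi>)" by (rule smooth_continuous[OF test_smooth[OF t]])
    show "(if i then dird v \<phi> else \<phi>) x = 0" if "x \<notin> open_cube l" for x by (rule test_zero_outside[OF t that])
    show "l2 (if i then u else g)" using u by simp
  qed simp
  then show "pairing u (dird v \<phi>) = - pairing g \<phi>"
    by (simp add: UNIV_bool eq_neg_iff_add_eq_0 add.commute)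
qed

text \<open>The product rule. By the last assumption \<open>\<theta>\<close> times a test function on \<open>U'\<close> is a test function
  on \<open>U\<close>; this form is also needed with \<open>U'\<close> different from the whole space, near a boundary point.\<close>

lemma weak_dird_localize:
  assumes wd: "weak_dird U v f g" and f: "l2 f" "l2 g" and \<theta>: "\<theta> \<in> test_functions W" and sub: "U' \<inter> W \<subseteq> U"
  shows "l2 (\<lambda>x. \<theta> x * f x)" "l2 (\<lambda>x. \<theta> x * g x + dird v \<theta> x * f x)"
    "weak_dird U' v (\<lambda>x. \<theta> x * f x) (\<lambda>x. \<theta> x * g x + dird v \<theta> x * f x)"
proof -
  have mult: "l2 (\<lambda>x. \<psi> x * h x)" if "\<psi> \<in> test_functions W" "l2 h" for \<psi> h
    using test_bounded[OF that(1)] l2_bounded_mult[OF that(2) test_measurable[OF that(1)]] by metis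
  show 1: "l2 (\<lambda>x. \<theta> x * f x)" by (rule mult[OF \<theta> f(1)])
  have 2: "l2 (\<lambda>x. \<theta> x * g x)" by (rule mult[OF \<theta> f(2)])
  have 3: "l2 (\<lambda>x. dird v \<theta> x * f x)" by (rule mult[OF test_dird[OF \<theta>] f(1)])
  show "l2 (\<lambda>x. \<theta> x * g x + dird v \<theta> x * f x)" by (rule l2_add[OF 2 3])
  obtain S where S: "smooth \<theta>" "compact S" "S \<subseteq> W" "\<And>x. x \<notin> S \<Longrightarrow> \<theta> x = 0"
    using \<theta> by (auto elim: test_functionsE)
  have sub': "U' \<inter> S \<subseteq> U" using Int_mono[OF subset_refl[of U'] S(3)] sub by (rule subset_trans)
  have dS: "dird v \<theta> x = 0" if "x \<notin> S" for x
    by (rule dird_zero_outside_closed[OF compact_imp_closed[OF S(2)] S(4) that])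
  show "weak_dird U' v (\<lambda>x. \<theta> x * f x) (\<lambda>x. \<theta> x * g x + dird v \<theta> x * f x)"
    unfolding weak_dird_def
  proof
    fix \<phi> :: "'a \<Rightarrow> complex" assume \<phi>: "\<phi> \<in> test_functions U'"
    have sm: "smooth \<theta>" "smooth \<phi>" using \<theta> \<phi> test_smooth by auto
    have t1: "(\<lambda>x. \<theta> x * \<phi> x) \<in> test_functions U"
      by (rule test_smooth_mult[OF \<phi> S(1) compact_imp_closed[OF S(2)] S(4) sub'])
    have t2: "(\<lambda>x. dird v \<theta> x * \<phi> x) \<in> test_functions U"
      by (rule test_smooth_mult[OF \<phi> smooth_dird[OF S(1)] compact_imp_closed[OF S(2)] dS sub'])
    have "pairing (\<lambda>x. \<theta> x * f x) (dird v \<phi>) = pairing f (\<lambda>x. \<theta> x * dird v \<phi> x)"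
      unfolding pairing_def by (simp add: mult_ac)
    also have "(\<lambda>x. \<theta> x * dird v \<phi> x) = (\<lambda>x. dird v (\<lambda>x. \<theta> x * \<phi> x) x - dird v \<theta> x * \<phi> x)"
      by (simp add: dird_mult sm)
    also have "pairing f \<dots> = pairing f (dird v (\<lambda>x. \<theta> x * \<phi> x)) - pairing f (\<lambda>x. dird v \<theta> x * \<phi> x)"
      by (rule pairing_diff_right[OF test_l2[OF test_dird[OF t1]] test_l2[OF t2] f(1)])
    also have "pairing f (dird v (\<lambda>x. \<theta> x * \<phi> x)) = - pairing g (\<lambda>x. \<theta> x * \<phi> x)"
      using wd t1 by (simp add: weak_dird_def)
    also have "\<dots> - pairing f (\<lambda>x. dird v \<theta> x * \<phi> x) = - (pairing (\<lambda>x. \<theta> x * g x) \<phi> + pairing (\<lambda>x. dird v \<theta> x * f x) \<phi>)"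
      unfolding pairing_def by (simp add: mult_ac)
    also have "\<dots> = - pairing (\<lambda>x. \<theta> x * g x + dird v \<theta> x * f x) \<phi>"
      by (simp add: pairing_add_left[OF 2 3 test_l2[OF \<phi>]])
    finally show "pairing (\<lambda>x. \<theta> x * f x) (dird v \<phi>) = - pairing (\<lambda>x. \<theta> x * g x + dird v \<theta> x * f x) \<phi>" .
  qed
qed

lemmas weak_dird_cutoff = weak_dird_localize[where U'=UNIV, OF _ _ _ _ Int_lower2[THEN subset_trans, OF subset_refl]]

lemma compact_subset_open_cube:
  assumes "compact C" obtains l where "l > 0" "C \<subseteq> open_cube l"
proof -
  obtain R where R: "\<And>x. x \<in> C \<Longrightarrow> norm x \<le> R" using compact_imp_bounded[OF assms] by (auto simp: bounded_iff)
  define l where "l = max R 0 + 1"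
  have "\<bar>x \<bullet> b\<bar> < pi * l" if "x \<in> C" "b \<in> Basis" for x b
  proof -
    have "\<bar>x \<bullet> b\<bar> < l" using Basis_le_norm[OF that(2), of x] R[OF that(1)] by (simp add: l_def)
    also have "l \<le> pi * l" using mult_right_mono[of 1 pi l] pi_ge_two by (simp add: l_def)
    finally show ?thesis .
  qed
  then show thesis by (intro that[of l]) (auto simp: mem_open_cube l_def)
qed

lemma exists_test_cutoff:
  fixes C U :: "'a::euclidean_space set"
  assumes "compact C" "open U" "C \<subseteq> U"
  obtains \<theta> W where "\<theta> \<in> test_functions U" "open W" "C \<subseteq> W" "\<And>x. x \<in> W \<Longrightarrow> \<theta> x = 1" "\<And>x. cmod (\<theta> x) \<le> 1"
proof (rule exists_smooth_cutoff[OF assms])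
  fix \<theta> :: "'a \<Rightarrow> real" and W S
  assume *: "smooth \<theta>" "\<And>x. 0 \<le> \<theta> x \<and> \<theta> x \<le> 1" "open W" "C \<subseteq> W" "\<And>x. x \<in> W \<Longrightarrow> \<theta> x = 1"
    "compact S" "S \<subseteq> U" "\<And>x. x \<notin> S \<Longrightarrow> \<theta> x = 0"
  show thesis
    by (rule that[of "\<lambda>x. complex_of_real (\<theta> x)" W])
       (use * in \<open>auto intro!: test_functionsI[of _ S] smooth_complex_of_real\<close>)
qed

text \<open>A substitute for the representation theorem of Riesz: a distributional derivative that is bounded
  in the square norm is a square integrable function. Testing with the combination of waves whose
  coefficients are the conjugates of the expected ones bounds their square sum.\<close>

lemma weak_dird_if_bounded:
  fixes F :: "'a::euclidean_space \<Rightarrow> complex"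
  assumes F: "l2 F" and C: "compact C" "\<And>x. x \<notin> C \<Longrightarrow> F x = 0" and A: "A \<ge> 0"
    and bound: "\<And>\<phi>. \<phi> \<in> test_functions UNIV \<Longrightarrow> cmod (pairing F (dird v \<phi>)) \<le> A * l2norm \<phi>"
  obtains G where "l2 G" "weak_dird UNIV v F G"
proof -
  obtain l where l: "l > 0" "C \<subseteq> open_cube l" using compact_subset_open_cube[OF C(1)] .
  obtain \<theta> W where \<theta>: "\<theta> \<in> test_functions (open_cube l)" "open W" "C \<subseteq> W" "\<And>x. x \<in> W \<Longrightarrow> \<theta> x = 1" "\<And>x. cmod (\<theta> x) \<le> 1"
    using exists_test_cutoff[OF C(1) open_open_cube l(2)] by metis
  let ?V = "vol TYPE('a) l"
  have V: "?V > 0" by (rule vol_pos[OF l(1)])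
  define a where "a m = - \<i> * of_real (m \<bullet> v) * fcoeff l F m" for m
  have "(\<Sum>m\<in>K. (cmod (a m))\<^sup>2) \<le> A\<^sup>2 * ?V" if K: "finite K" "K \<subseteq> frequencies l" for K
  proof -
    define p where "p x = (\<Sum>m\<in>K. cnj (a m) * wave m x)" for x
    define q where "q x = (\<Sum>m\<in>K. cnj (a m) * cube_wave l m x)" for x
    define \<phi> where "\<phi> x = \<theta> x * p x" for x
    have smp: "smooth p" unfolding p_def by (intro smooth_sum smooth_mult smooth_const smooth_wave)
    have \<phi>t: "\<phi> \<in> test_functions (open_cube l)"
      unfolding \<phi>_def using test_mult[OF \<theta>(1) smp] by (simp add: mult.commute)
    have l2q: "l2 q" unfolding q_def by (intro l2_sum l2_cmult l2_cube_wave)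
    have "l2norm \<phi> \<le> 1 * l2norm q"
    proof (rule l2norm_mono[OF test_l2[OF \<phi>t] l2q])
      show "AE x in lebesgue. cmod (\<phi> x) \<le> 1 * cmod (q x)"
      proof (rule AE_I2)
        fix x
        show "cmod (\<phi> x) \<le> 1 * cmod (q x)"
        proof (cases "x \<in> cube l")
          case True
          then have "q x = p x" by (simp add: q_def p_def cube_wave_def zero_ext_def)
          then show ?thesis using mult_right_mono[OF \<theta>(5), of "cmod (p x)" x] by (simp add: \<phi>_def norm_mult)
        next
          case False
          then have "\<phi> x = 0" using test_zero_outside[OF \<phi>t] open_cube_subset by blast
          then show ?thesis by simp
        qed
      qed
    qed simp
    moreover have "(l2norm q)\<^sup>2 = ?V * (\<Sum>m\<in>K. (cmod (a m))\<^sup>2)"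
      unfolding q_def trig_energy[OF l(1) K] by simp
    ultimately have n: "(l2norm \<phi>)\<^sup>2 \<le> ?V * (\<Sum>m\<in>K. (cmod (a m))\<^sup>2)"
      using power_mono[of "l2norm \<phi>" "l2norm q" 2] l2norm_nonneg by auto
    have "pairing F (dird v \<phi>) = pairing F (\<lambda>x. \<Sum>m\<in>K. (cnj (a m) * (\<i> * of_real (m \<bullet> v))) * cube_wave l m x)"
    proof -
      have "F x * dird v \<phi> x = F x * (\<Sum>m\<in>K. (cnj (a m) * (\<i> * of_real (m \<bullet> v))) * cube_wave l m x)" for x
      proof (cases "x \<in> C")
        case True
        have "(p has_derivative frechet_derivative p (at x)) (at x)" by (rule smooth_has_derivative[OF smp])
        then have "(\<phi> has_derivative frechet_derivative p (at x)) (at x)"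
          by (rule has_derivative_transform_within_open[OF _ \<theta>(2)]) (use True \<theta> in \<open>auto simp: \<phi>_def\<close>)
        then have "dird v \<phi> x = dird v p x" by (simp add: frechet_derivative_eqI)
        also have "\<dots> = (\<Sum>m\<in>K. cnj (a m) * dird v (wave m) x)"
          unfolding p_def by (subst dird_sum) (auto intro!: sum.cong smooth_mult smooth_const smooth_wave simp: dird_cmult smooth_wave)
        also have "\<dots> = (\<Sum>m\<in>K. (cnj (a m) * (\<i> * of_real (m \<bullet> v))) * cube_wave l m x)"
          using True l(2) open_cube_subset[of l] by (auto simp: dird_wave cube_wave_def zero_ext_def mult_ac intro!: sum.cong)
        finally show ?thesis by simp
      qed (simp add: C(2))
      then show ?thesis by (rule pairing_cong)
    qed
    also have "\<dots> = (\<Sum>m\<in>K. (cnj (a m) * (\<i> * of_real (m \<bullet> v))) * fcoeff l F m)"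
      unfolding fcoeff_def by (subst pairing_sum_right) (simp_all only: l2_cmult l2_cube_wave F pairing_cmult_right)
    also have "\<dots> = - of_real (\<Sum>m\<in>K. (cmod (a m))\<^sup>2)"
      unfolding of_real_sum sum_negf[symmetric]
      by (intro sum.cong refl) (simp only: complex_norm_square, simp add: a_def mult_ac)
    finally have "pairing F (dird v \<phi>) = - of_real (\<Sum>m\<in>K. (cmod (a m))\<^sup>2)" .
    then have "(\<Sum>m\<in>K. (cmod (a m))\<^sup>2) \<le> cmod (pairing F (dird v \<phi>))"
      by (simp only: norm_minus_cancel norm_of_real)
    also have "\<dots> \<le> A * l2norm \<phi>" by (rule bound[OF test_mono[OF \<phi>t]]) simp
    finally have "(\<Sum>m\<in>K. (cmod (a m))\<^sup>2)\<^sup>2 \<le> (A * l2norm \<phi>)\<^sup>2"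
      by (intro power_mono sum_nonneg) auto
    also have "\<dots> \<le> A\<^sup>2 * (?V * (\<Sum>m\<in>K. (cmod (a m))\<^sup>2))"
      unfolding power_mult_distrib by (rule mult_left_mono[OF n]) simp
    finally have le: "(\<Sum>m\<in>K. (cmod (a m))\<^sup>2) * (\<Sum>m\<in>K. (cmod (a m))\<^sup>2) \<le> (A\<^sup>2 * ?V) * (\<Sum>m\<in>K. (cmod (a m))\<^sup>2)"
      by (simp add: power2_eq_square mult_ac)
    show ?thesis
    proof (cases "(\<Sum>m\<in>K. (cmod (a m))\<^sup>2) = 0")
      case True
      then show ?thesis using V by simp
    next
      case False
      then have "(\<Sum>m\<in>K. (cmod (a m))\<^sup>2) > 0" using sum_nonneg[of K "\<lambda>m. (cmod (a m))\<^sup>2"] by auto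
      then show ?thesis using le by (simp only: mult_le_cancel_right_pos)
    qed
  qed
  then obtain G where G: "l2 G" "\<And>m. m \<in> frequencies l \<Longrightarrow> fcoeff l G m = a m"
    using Riesz_Fischer[OF l(1), of a] by metis
  have "weak_dird (open_cube l) v F G"
    by (rule weak_dird_if_coeffs[OF l(1) F G(1)]) (simp add: G(2) a_def)
  from weak_dird_cutoff[OF this F G(1) \<theta>(1)]
  have "l2 (\<lambda>x. \<theta> x * G x + dird v \<theta> x * F x)"
    "weak_dird UNIV v (\<lambda>x. \<theta> x * F x) (\<lambda>x. \<theta> x * G x + dird v \<theta> x * F x)" by auto
  moreover have "(\<lambda>x. \<theta> x * F x) = F"
  proof
    fix x show "\<theta> x * F x = F x" using \<theta>(3,4) C(2) by (cases "x \<in> C") auto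
  qed
  ultimately show thesis using that by metis
qed

section \<open>Sobolev functions and the weak dbar operator\<close>

lemma lebesgue_on_integral_eq_pairing:
  "U \<in> sets lebesgue \<Longrightarrow> (LINT x|lebesgue_on U. f x * g x) = pairing (zero_ext U f) g"
  unfolding pairing_def
  by (subst Lebesgue_Measure.integral_restrict_UNIV[symmetric])
     (auto simp: zero_ext_def intro!: Bochner_Integration.integral_cong)

lemma zero_ext_UNIV [simp]: "zero_ext UNIV f = f"
  by (simp add: zero_ext_def)

lemma pairing_zero_ext_test:
  assumes "\<phi> \<in> test_functions U" "U \<subseteq> A" shows "pairing (zero_ext A f) \<phi> = pairing f \<phi>"
  using test_zero_outside[OF assms(1)] assms(2) by (intro pairing_cong) (auto simp: zero_ext_def)

lemma weak_derivative_iff: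
  "U \<in> sets lebesgue \<Longrightarrow> weak_derivative U v f g \<longleftrightarrow> weak_dird U v (zero_ext U f) (zero_ext U g)"
  by (simp add: weak_derivative_def weak_dird_def lebesgue_on_integral_eq_pairing)

lemma W1_iff:
  assumes "open U"
  shows "f \<in> W1 U \<longleftrightarrow> l2 (zero_ext U f) \<and> (\<forall>v\<in>Basis. \<exists>g. l2 g \<and> weak_dird U v (zero_ext U f) g)"
proof -
  have U: "U \<in> sets lebesgue" using assms by simp
  have "(\<exists>g\<in>L2 U. weak_derivative U v f g) \<longleftrightarrow> (\<exists>g. l2 g \<and> weak_dird U v (zero_ext U f) g)" for v
  proof
    assume "\<exists>g\<in>L2 U. weak_derivative U v f g"
    then show "\<exists>g. l2 g \<and> weak_dird U v (zero_ext U f) g"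
      using U by (auto simp: weak_derivative_iff L2_iff)
  next
    assume "\<exists>g. l2 g \<and> weak_dird U v (zero_ext U f) g"
    then obtain g where g: "l2 g" "weak_dird U v (zero_ext U f) g" by blast
    then have "weak_dird U v (zero_ext U f) (zero_ext U g)"
      by (simp add: weak_dird_def pairing_zero_ext_test)
    then show "\<exists>g\<in>L2 U. weak_derivative U v f g"
      using U g(1) by (intro bexI[of _ g]) (auto simp: weak_derivative_iff L2_iff intro: l2_zero_ext)
  qed
  then show ?thesis using U by (simp add: W1_def L2_iff)
qed

lemma W1_UNIV_iff: "f \<in> W1 UNIV \<longleftrightarrow> l2 f \<and> (\<forall>v\<in>Basis. \<exists>g. l2 g \<and> weak_dird UNIV v f g)"
  by (simp add: W1_iff)

lemma weak_dird_add:
  assumes "weak_dird U v f g" "weak_dird U v f' g'" "l2 f" "l2 f'" "l2 g" "l2 g'"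
  shows "weak_dird U v (\<lambda>x. f x + f' x) (\<lambda>x. g x + g' x)"
  using assms by (simp add: weak_dird_def pairing_add_left test_l2[OF test_dird] test_l2)

lemma weak_dird_cmult:
  assumes "weak_dird U v f g" shows "weak_dird U v (\<lambda>x. c * f x) (\<lambda>x. c * g x)"
  using assms by (simp add: weak_dird_def pairing_cmult_left)

lemma W1_UNIV_add:
  assumes "f \<in> W1 UNIV" "g \<in> W1 UNIV" shows "(\<lambda>x. f x + g x) \<in> W1 UNIV"
  unfolding W1_UNIV_iff
proof (intro conjI ballI)
  show "l2 (\<lambda>x. f x + g x)" using assms by (auto simp: W1_UNIV_iff intro: l2_add)
  fix v :: 'a assume v: "v \<in> Basis"
  obtain f' where f': "l2 f'" "weak_dird UNIV v f f'" using assms(1) v by (auto simp: W1_UNIV_iff)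
  obtain g' where g': "l2 g'" "weak_dird UNIV v g g'" using assms(2) v by (auto simp: W1_UNIV_iff)
  show "\<exists>h. l2 h \<and> weak_dird UNIV v (\<lambda>x. f x + g x) h"
    using l2_add[OF f'(1) g'(1)] weak_dird_add[OF f'(2) g'(2) _ _ f'(1) g'(1)] assms
    by (auto simp: W1_UNIV_iff)
qed

lemma W1_UNIV_cmult:
  assumes "f \<in> W1 UNIV" shows "(\<lambda>x. c * f x) \<in> W1 UNIV"
  unfolding W1_UNIV_iff
proof (intro conjI ballI)
  show "l2 (\<lambda>x. c * f x)" using assms by (auto simp: W1_UNIV_iff intro: l2_cmult)
  fix v :: 'a assume "v \<in> Basis"
  then obtain g where "l2 g" "weak_dird UNIV v f g" using assms by (auto simp: W1_UNIV_iff)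
  then show "\<exists>h. l2 h \<and> weak_dird UNIV v (\<lambda>x. c * f x) h"
    using l2_cmult weak_dird_cmult by blast
qed

lemma W1_UNIV_zero: "(\<lambda>x. 0) \<in> W1 UNIV"
  unfolding W1_UNIV_iff by (auto intro!: l2_zero exI[of _ "\<lambda>x. 0"] simp: weak_dird_def pairing_def)

lemma weak_dird_any_direction:
  assumes "l2 f" "\<And>b. b \<in> Basis \<Longrightarrow> l2 (g b)" "\<And>b. b \<in> Basis \<Longrightarrow> weak_dird U b f (g b)"
  shows "weak_dird U v f (\<lambda>x. \<Sum>b\<in>Basis. of_real (v \<bullet> b) * g b x)"
  unfolding weak_dird_def
proof
  fix \<phi> :: "'a \<Rightarrow> complex" assume \<phi>: "\<phi> \<in> test_functions U"
  have "dird v \<phi> = (\<lambda>x. \<Sum>b\<in>Basis. of_real (v \<bullet> b) * dird b \<phi> x)"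
    using dird_linear[OF test_smooth[OF \<phi>], where v=v] by (simp add: scaleR_conv_of_real fun_eq_iff)
  then have "pairing f (dird v \<phi>) = pairing f (\<lambda>x. \<Sum>b\<in>Basis. of_real (v \<bullet> b) * dird b \<phi> x)" by simp
  also have "\<dots> = (\<Sum>b\<in>Basis. of_real (v \<bullet> b) * pairing f (dird b \<phi>))"
    by (subst pairing_sum_right) (simp_all only: pairing_cmult_right l2_cmult[OF test_l2[OF test_dird[OF \<phi>]]] assms(1))
  also have "\<dots> = (\<Sum>b\<in>Basis. - (of_real (v \<bullet> b) * pairing (g b) \<phi>))"
    using assms(3) \<phi> by (intro sum.cong) (auto simp: weak_dird_def)
  also have "\<dots> = - pairing (\<lambda>x. \<Sum>b\<in>Basis. of_real (v \<bullet> b) * g b x) \<phi>"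
    by (subst pairing_sum_left) (auto intro: l2_cmult test_l2 \<phi> assms simp: pairing_cmult_left sum_negf)
  finally show "pairing f (dird v \<phi>) = - pairing (\<lambda>x. \<Sum>b\<in>Basis. of_real (v \<bullet> b) * g b x) \<phi>" .
qed

lemma axis_complex_Basis: "axis k 1 \<in> (Basis :: (complex^'n) set)" "axis k \<i> \<in> (Basis :: (complex^'n) set)"
  by (auto simp: axis_in_Basis_iff Basis_complex_def)

lemma test_zbar:
  assumes "\<phi> \<in> test_functions U" shows "zbar_derivative k \<phi> \<in> test_functions U"
proof -
  have "(\<lambda>x. (1/2) * (dird (axis k 1) \<phi> x + \<i> * dird (axis k \<i>) \<phi> x)) \<in> test_functions U"
    by (intro test_cmult test_add test_dird assms)
  then show ?thesis by (simp add: zbar_derivative_def[abs_def])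
qed

lemma pairing_zbar:
  assumes "l2 f" "\<phi> \<in> test_functions U"
  shows "pairing f (zbar_derivative k \<phi>) = (pairing f (dird (axis k 1) \<phi>) + \<i> * pairing f (dird (axis k \<i>) \<phi>)) / 2"
proof -
  have "zbar_derivative k \<phi> = (\<lambda>x. (1/2) * (dird (axis k 1) \<phi> x + \<i> * dird (axis k \<i>) \<phi> x))"
    by (simp add: zbar_derivative_def[abs_def])
  then show ?thesis
    using assms by (simp only: pairing_cmult_right) (simp add: pairing_add_right pairing_cmult_right l2_cmult test_l2[OF test_dird])
qed

lemma W1_zbar:
  assumes "f \<in> W1 UNIV"
  shows "\<exists>g. l2 g \<and> (\<forall>\<phi>\<in>test_functions UNIV. pairing f (zbar_derivative k \<phi>) = - pairing g \<phi>)"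
proof -
  note B = axis_complex_Basis[of k]
  obtain g where g: "l2 g" "weak_dird UNIV (axis k 1) f g" using assms B(1) unfolding W1_UNIV_iff by blast
  obtain h where h: "l2 h" "weak_dird UNIV (axis k \<i>) f h" using assms B(2) unfolding W1_UNIV_iff by blast
  have f: "l2 f" using assms by (simp add: W1_UNIV_iff)
  have "pairing f (zbar_derivative k \<phi>) = - pairing (\<lambda>x. (1/2) * (g x + \<i> * h x)) \<phi>" if "\<phi> \<in> test_functions UNIV" for \<phi>
    unfolding pairing_zbar[OF f that] pairing_cmult_left using g h that
    by (simp add: pairing_add_left pairing_cmult_left l2_cmult test_l2[OF that] weak_dird_def field_simps)
  moreover have "l2 (\<lambda>x. (1/2) * (g x + \<i> * h x))" by (intro l2_cmult l2_add g h)
  ultimately show ?thesis by blast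
qed

lemma weak_dbar_iff:
  assumes "U \<in> sets lebesgue"
  shows "weak_dbar p q U f h \<longleftrightarrow>
     (\<forall>I L. card I = p \<and> card L = Suc q \<longrightarrow> (\<forall>\<phi>\<in>test_functions U.
        (\<Sum>k\<in>L. (-1) ^ (p + card {l\<in>L. l < k}) * pairing (f I (L - {k})) (zbar_derivative k \<phi>)) = - pairing (h I L) \<phi>))"
proof -
  have *: "(\<Sum>k\<in>L. (-1) ^ (p + card {l\<in>L. l < k}) * pairing (zero_ext U (f I (L - {k}))) (zbar_derivative k \<phi>)) =
    (\<Sum>k\<in>L. (-1) ^ (p + card {l\<in>L. l < k}) * pairing (f I (L - {k})) (zbar_derivative k \<phi>))"
    "pairing (zero_ext U (h I L)) \<phi> = pairing (h I L) \<phi>"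
    if "\<phi> \<in> test_functions U" for \<phi> I L
    using that by (auto simp: pairing_zero_ext_test[OF test_zbar] pairing_zero_ext_test)
  show ?thesis
    unfolding weak_dbar_def lebesgue_on_integral_eq_pairing[OF assms]
    by (simp add: * cong: ball_cong)
qed

lemma weak_dbar_mono:
  assumes "weak_dbar p q U f h" "V \<subseteq> U" "open U" "open V"
  shows "weak_dbar p q V f h"
  using assms(1) test_mono[OF _ assms(2)] by (simp add: weak_dbar_iff assms(3,4))

lemma weak_dbar_unique:
  fixes f :: "'n::{finite,linorder} form"
  assumes "open U" "weak_dbar p q U f h" "weak_dbar p q U f h'"
    "h \<in> L2_forms p (Suc q) UNIV" "h' \<in> L2_forms p (Suc q) UNIV"
  shows "form_eq_on p (Suc q) U h h'"
  unfolding form_eq_on_def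
proof (intro allI impI)
  have Uleb: "U \<in> sets lebesgue" using assms(1) by simp
  fix I L :: "'n set" assume IL: "card I = p \<and> card L = Suc q"
  show "AE x in lebesgue. x \<in> U \<longrightarrow> h I L x = h' I L x"
  proof (rule pairing_eq_imp_AE_eq[OF assms(1)])
    show "l2 (h I L)" "l2 (h' I L)" using IL assms(4,5) by (auto simp: L2_forms_def L2_UNIV_iff)
    fix \<phi> assume \<phi>: "\<phi> \<in> test_functions U"
    note d = assms(2,3)[unfolded weak_dbar_iff[OF Uleb], rule_format, OF IL \<phi>]
    have "- pairing (h I L) \<phi> = - pairing (h' I L) \<phi>"
      by (rule trans[OF d(1)[symmetric] d(2)])
    then show "pairing (h I L) \<phi> = pairing (h' I L) \<phi>" by simp
  qed
qed

lemma W1_forms_dbar: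
  fixes f :: "'n::{finite,linorder} form"
  assumes "f \<in> W1_forms p q UNIV"
  shows "\<exists>h\<in>L2_forms p (Suc q) UNIV. weak_dbar p q UNIV f h"
proof -
  have "\<forall>I J k. card I = p \<and> card J = q \<longrightarrow> (\<exists>g. l2 g \<and> (\<forall>\<phi>\<in>test_functions UNIV. pairing (f I J) (zbar_derivative k \<phi>) = - pairing g \<phi>))"
    using assms by (auto simp: W1_forms_def intro!: W1_zbar)
  then obtain G where G: "\<And>I J k. card I = p \<Longrightarrow> card J = q \<Longrightarrow> l2 (G I J k)"
    "\<And>I J k \<phi>. card I = p \<Longrightarrow> card J = q \<Longrightarrow> \<phi> \<in> test_functions UNIV \<Longrightarrow> pairing (f I J) (zbar_derivative k \<phi>) = - pairing (G I J k) \<phi>"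
    by metis
  define h where "h I L x = (\<Sum>k\<in>L. (-1) ^ (p + card {l\<in>L. l < k}) * G I (L - {k}) k x)" for I L x
  have card: "card (L - {k}) = q" if "card L = Suc q" "k \<in> L" for L :: "'n set" and k
    using that by simp
  have "l2 (h I L)" if "card I = p" "card L = Suc q" for I L
    unfolding h_def using that card by (intro l2_sum l2_cmult G) auto
  then have "h \<in> L2_forms p (Suc q) UNIV" by (auto simp: L2_forms_def L2_UNIV_iff)
  moreover have "weak_dbar p q UNIV f h"
  proof (subst weak_dbar_iff, simp, intro allI impI ballI)
    fix I L :: "'n set" and \<phi> :: "complex^('n::{finite,linorder}) \<Rightarrow> complex"
    assume IL: "card I = p \<and> card L = Suc q" and \<phi>: "\<phi> \<in> test_functions UNIV"
    have "pairing (h I L) \<phi> = (\<Sum>k\<in>L. (-1) ^ (p + card {l\<in>L. l < k}) * pairing (G I (L - {k}) k) \<phi>)"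
      unfolding h_def using IL card \<phi>
      by (subst pairing_sum_left) (use test_l2[OF \<phi>] in \<open>auto intro!: l2_cmult G(1) simp: pairing_cmult_left\<close>)
    then show "(\<Sum>k\<in>L. (-1) ^ (p + card {l\<in>L. l < k}) * pairing (f I (L - {k})) (zbar_derivative k \<phi>)) = - pairing (h I L) \<phi>"
      using IL card \<phi> by (simp add: G(2) sum_negf)
  qed
  ultimately show ?thesis by blast
qed

section \<open>Solving the dbar equation in top degree\<close>

lemma fcoeff_zbar_test:
  fixes m :: "complex^'n::finite"
  assumes "\<phi> \<in> test_functions (open_cube l)"
  shows "fcoeff l (zbar_derivative k \<phi>) (- m) = (\<i> * (m $ k) / 2) * fcoeff l \<phi> (- m)"
proof -
  have z: "of_real (m \<bullet> axis k 1) + \<i> * of_real (m \<bullet> axis k \<i>) = m $ k"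
    by (simp add: inner_axis complex_eq_iff)
  have "fcoeff l (zbar_derivative k \<phi>) (- m) = (fcoeff l (dird (axis k 1) \<phi>) (- m) + \<i> * fcoeff l (dird (axis k \<i>) \<phi>) (- m)) / 2"
    unfolding fcoeff_def
    by (simp add: pairing_commute[of _ "cube_wave l (- m)"] pairing_zbar[OF l2_cube_wave assms])
  also have "\<dots> = (\<i> * (of_real (m \<bullet> axis k 1) + \<i> * of_real (m \<bullet> axis k \<i>)) / 2) * fcoeff l \<phi> (- m)"
    unfolding fcoeff_dird_test[OF assms] by (simp add: field_simps)
  finally show ?thesis unfolding z .
qed

text \<open>In top degree there is one scalar equation for all the coefficients \<open>w k\<close>. The solution
  proportional to the conjugate symbols is of size \<open>2 / norm m\<close> times the data, so it is square
  summable, and so are its products with the components of \<open>m\<close>.\<close>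

lemma top_degree_dbar:
  fixes H :: "complex^'n::finite \<Rightarrow> complex" and s :: "'n \<Rightarrow> complex"
  assumes H: "l2 H" and s: "\<And>k. s k * s k = 1"
  shows "\<exists>w. (\<forall>k. w k \<in> W1 UNIV) \<and>
    (\<forall>\<phi>\<in>test_functions (ball 0 R). (\<Sum>k\<in>UNIV. s k * pairing (w k) (zbar_derivative k \<phi>)) = - pairing H \<phi>)"
proof -
  obtain l where l: "l > 0" "cball (0 :: complex^'n) R \<subseteq> open_cube l"
    using compact_subset_open_cube[OF compact_cball[of "0::complex^'n" R]] .
  obtain \<theta> W where \<theta>: "\<theta> \<in> test_functions (open_cube l)" "open W" "cball (0::complex^'n) R \<subseteq> W" "\<And>x. x \<in> W \<Longrightarrow> \<theta> x = 1"
    using exists_test_cutoff[OF compact_cball open_open_cube l(2)] by metis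
  \<comment> \<open>The k-th dbar derivative acts on the wave of frequency \<open>m\<close> as multiplication by \<open>\<i> * (m $ k) / 2\<close>.
    These symbols have square sum \<open>(norm m)\<^sup>2 / 4\<close>, so multiplying with their conjugates inverts the sum.\<close>
  define B where "B = vol TYPE(complex^'n) l * (l2norm H)\<^sup>2"
  define a where "a k m = - s k * cnj (\<i> * (m $ k) / 2) * (4 / of_real ((norm m)\<^sup>2)) * fcoeff l H m" for k m
  have s1: "cmod (s k) = 1" for k
  proof -
    have "(cmod (s k))\<^sup>2 = 1" using s[of k] by (metis norm_mult norm_one power2_eq_square)
    then show ?thesis by (simp add: power2_eq_1_iff) (use norm_ge_zero[of "s k"] in linarith)
  qed
  have mpos: "norm m \<ge> 1 / (2 * l)" if "m \<in> frequencies l" for m :: "complex^'n"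
  proof -
    obtain b :: "complex^'n" where b: "b \<in> Basis" using nonempty_Basis by blast
    then obtain j :: int where j: "l * (m \<bullet> b) = of_int j + 1/2" using \<open>m \<in> frequencies l\<close> by (auto simp: frequencies_def)
    have "\<bar>of_int j + 1/2 :: real\<bar> \<ge> 1/2" by (cases "j \<ge> 0") (auto simp: abs_if)
    then have "l * \<bar>m \<bullet> b\<bar> \<ge> 1/2" using j l(1) by (metis abs_mult abs_of_pos)
    then have "1 / (2 * l) \<le> \<bar>m \<bullet> b\<bar>" using l(1) by (simp add: field_simps)
    also have "\<dots> \<le> norm m" by (rule Basis_le_norm[OF b])
    finally show ?thesis .
  qed
  have an: "cmod (a k m) \<le> (2 / norm m) * cmod (fcoeff l H m)" if "m \<in> frequencies l" for k m
  proof -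
    have pos: "norm m > 0" using mpos[OF that] l(1) by (smt (verit) zero_less_divide_1_iff)
    have "cmod (a k m) = (cmod (m $ k) / 2) * (4 / (norm m)\<^sup>2) * cmod (fcoeff l H m)"
      by (simp add: a_def norm_mult norm_divide s1 norm_power)
    also have "\<dots> \<le> (norm m / 2) * (4 / (norm m)\<^sup>2) * cmod (fcoeff l H m)"
      by (intro mult_right_mono divide_right_mono Finite_Cartesian_Product.norm_nth_le) auto
    also have "\<dots> = (2 / norm m) * cmod (fcoeff l H m)" using pos by (simp add: power2_eq_square)
    finally show ?thesis .
  qed
  have sumb: "(\<Sum>m\<in>F. (cmod (b m))\<^sup>2) \<le> c\<^sup>2 * B"
    if F: "finite F" "F \<subseteq> frequencies l" and b: "\<And>m. m \<in> F \<Longrightarrow> cmod (b m) \<le> c * cmod (fcoeff l H m)" for F b c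
  proof -
    have "(\<Sum>m\<in>F. (cmod (b m))\<^sup>2) \<le> (\<Sum>m\<in>F. c\<^sup>2 * (cmod (fcoeff l H m))\<^sup>2)"
    proof (rule sum_mono)
      fix m assume "m \<in> F"
      then have "(cmod (b m))\<^sup>2 \<le> (c * cmod (fcoeff l H m))\<^sup>2" by (intro power_mono b) auto
      then show "(cmod (b m))\<^sup>2 \<le> c\<^sup>2 * (cmod (fcoeff l H m))\<^sup>2" by (simp add: power_mult_distrib)
    qed
    also have "\<dots> \<le> c\<^sup>2 * B"
      unfolding sum_distrib_left[symmetric] B_def by (intro mult_left_mono Bessel[OF l(1) F H]) simp
    finally show ?thesis .
  qed
  have "\<exists>u. l2 u \<and> (\<forall>m\<in>frequencies l. fcoeff l u m = a k m)" for k
  proof -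
    have "(\<Sum>m\<in>F. (cmod (a k m))\<^sup>2) \<le> (4 * l)\<^sup>2 * B" if F: "finite F" "F \<subseteq> frequencies l" for F
    proof (rule sumb[OF F])
      fix m assume "m \<in> F"
      then have m: "m \<in> frequencies l" using F by blast
      have "2 / norm m \<le> 4 * l" 
      proof -
        have "norm m > 0" using mpos[OF m] l(1) by (smt (verit) zero_less_divide_1_iff)
        moreover have "1 \<le> (2 * l) * norm m" using mpos[OF m] l(1) by (simp add: divide_le_eq mult.commute)
        ultimately show ?thesis by (simp add: divide_le_eq)
      qed
      then show "cmod (a k m) \<le> 4 * l * cmod (fcoeff l H m)"
        using an[OF m, of k] by (meson mult_right_mono norm_ge_zero order_trans)
    qed
    then show ?thesis using Riesz_Fischer[OF l(1), of "a k"] by metis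
  qed
  then obtain u where u: "\<And>k. l2 (u k)" "\<And>k m. m \<in> frequencies l \<Longrightarrow> fcoeff l (u k) m = a k m" by metis
  have wk: "\<exists>g. l2 g \<and> weak_dird (open_cube l) v (u k) g" if v: "v \<in> Basis" for k v
  proof -
    have "(\<Sum>m\<in>F. (cmod (- \<i> * of_real (m \<bullet> v) * a k m))\<^sup>2) \<le> 2\<^sup>2 * B" if F: "finite F" "F \<subseteq> frequencies l" for F
    proof (rule sumb[OF F])
      fix m assume "m \<in> F"
      then have m: "m \<in> frequencies l" using F by blast
      have pos: "norm m > 0" using mpos[OF m] l(1) by (smt (verit) zero_less_divide_1_iff)
      have "cmod (- \<i> * of_real (m \<bullet> v) * a k m) = \<bar>m \<bullet> v\<bar> * cmod (a k m)" by (simp add: norm_mult)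
      also have "\<dots> \<le> norm m * ((2 / norm m) * cmod (fcoeff l H m))"
        by (intro mult_mono an m Basis_le_norm v) auto
      also have "\<dots> = 2 * cmod (fcoeff l H m)" using pos by simp
      finally show "cmod (- \<i> * of_real (m \<bullet> v) * a k m) \<le> 2 * cmod (fcoeff l H m)" .
    qed
    then obtain g where g: "l2 g" "\<And>m. m \<in> frequencies l \<Longrightarrow> fcoeff l g m = - \<i> * of_real (m \<bullet> v) * a k m"
      by (rule Riesz_Fischer[OF l(1), of "\<lambda>m. - \<i> * of_real (m \<bullet> v) * a k m"]) blast+
    have "weak_dird (open_cube l) v (u k) g"
      by (rule weak_dird_if_coeffs[OF l(1) u(1) g(1)]) (simp add: g(2) u(2))
    then show ?thesis using g(1) by blast
  qed
  have W: "(\<lambda>x. \<theta> x * u k x) \<in> W1 UNIV" for k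
    unfolding W1_UNIV_iff
  proof (intro conjI ballI)
    have "\<exists>b. b \<in> (Basis :: (complex^'n) set)" using nonempty_Basis by blast
    with wk
    show "l2 (\<lambda>x. \<theta> x * u k x)" using weak_dird_cutoff(1)[OF _ u(1) _ \<theta>(1)] by blast
    fix v :: "complex^'n" assume "v \<in> Basis"
    with wk
    obtain g where g: "l2 g" "weak_dird (open_cube l) v (u k) g" by blast
    show "\<exists>h. l2 h \<and> weak_dird UNIV v (\<lambda>x. \<theta> x * u k x) h"
      using weak_dird_cutoff(2,3)[OF g(2) u(1) g(1) \<theta>(1)] by blast
  qed
  have "(\<Sum>k\<in>UNIV. s k * pairing (\<lambda>x. \<theta> x * u k x) (zbar_derivative k \<phi>)) = - pairing H \<phi>"
    if \<phi>: "\<phi> \<in> test_functions (ball 0 R)" for \<phi>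
  proof -
    have \<phi>': "\<phi> \<in> test_functions (open_cube l)"
      by (rule test_mono[OF \<phi>]) (use l(2) ball_subset_cball in blast)
    have "pairing (\<lambda>x. \<theta> x * u k x) (zbar_derivative k \<phi>) = pairing (u k) (zbar_derivative k \<phi>)" for k
    proof (rule pairing_cong)
      fix x show "\<theta> x * u k x * zbar_derivative k \<phi> x = u k x * zbar_derivative k \<phi> x"
        using test_zero_outside[OF test_zbar[OF \<phi>], of x k] \<theta>(3,4) by (cases "x \<in> ball 0 R") (auto simp: subset_iff)
    qed
    then have "(\<Sum>k\<in>UNIV. s k * pairing (\<lambda>x. \<theta> x * u k x) (zbar_derivative k \<phi>)) =
       (\<Sum>k\<in>UNIV. pairing (\<lambda>x. s k * u k x) (zbar_derivative k \<phi>))"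
      by (simp add: pairing_cmult_left)
    moreover have "(\<Sum>i\<in>UNIV. pairing (case i of None \<Rightarrow> H | Some k \<Rightarrow> \<lambda>x. s k * u k x)
        (case i of None \<Rightarrow> \<phi> | Some k \<Rightarrow> zbar_derivative k \<phi>)) = 0"
    proof (rule pairing_transfer[OF l(1)])
      fix m :: "complex^'n" assume m: "m \<in> frequencies l"
      have pos: "norm m > 0" using mpos[OF m] l(1) by (smt (verit) zero_less_divide_1_iff)
      have nm: "(\<Sum>k\<in>UNIV. (cmod (m $ k))\<^sup>2) = (norm m)\<^sup>2"
        by (simp add: norm_vec_def L2_set_def sum_nonneg)
      have summand: "s k * fcoeff l (u k) m * (\<i> * (m $ k) / 2) = - (of_real ((cmod (m $ k))\<^sup>2) / of_real ((norm m)\<^sup>2)) * fcoeff l H m" for k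
      proof -
        have "s k * fcoeff l (u k) m * (\<i> * (m $ k) / 2) = - (s k * s k) * ((m $ k) * cnj (m $ k)) / of_real ((norm m)\<^sup>2) * fcoeff l H m"
          unfolding u(2)[OF m] a_def by (simp add: field_simps)
        then show ?thesis by (simp add: s complex_norm_square[symmetric])
      qed
      have "(\<Sum>k\<in>UNIV. fcoeff l (\<lambda>x. s k * u k x) m * fcoeff l (zbar_derivative k \<phi>) (- m)) =
         (\<Sum>k\<in>UNIV. (s k * fcoeff l (u k) m * (\<i> * (m $ k) / 2)) * fcoeff l \<phi> (- m))"
        unfolding fcoeff_zbar_test[OF \<phi>'] by (simp add: fcoeff_def pairing_cmult_left mult_ac)
      also have "\<dots> = - (of_real (\<Sum>k\<in>UNIV. (cmod (m $ k))\<^sup>2) / of_real ((norm m)\<^sup>2)) * fcoeff l H m * fcoeff l \<phi> (- m)"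
        unfolding summand by (simp add: sum_distrib_right sum_divide_distrib sum_negf)
      also have "\<dots> = - (fcoeff l H m * fcoeff l \<phi> (- m))"
        unfolding nm using pos by simp
      finally show "(\<Sum>i\<in>UNIV. fcoeff l (case i of None \<Rightarrow> H | Some k \<Rightarrow> \<lambda>x. s k * u k x) m *
          fcoeff l (case i of None \<Rightarrow> \<phi> | Some k \<Rightarrow> zbar_derivative k \<phi>) (- m)) = 0"
        by (simp add: UNIV_option_conv sum.reindex)
    next
      fix i :: "'n option"
      have t: "(case i of None \<Rightarrow> \<phi> | Some k \<Rightarrow> zbar_derivative k \<phi>) \<in> test_functions (open_cube l)"
        using \<phi>' by (auto split: option.split intro: test_zbar)
      show "continuous_on UNIV (case i of None \<Rightarrow> \<phi> | Some k \<Rightarrow> zbar_derivative k \<phi>)"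
        by (rule smooth_continuous[OF test_smooth[OF t]])
      show "(case i of None \<Rightarrow> \<phi> | Some k \<Rightarrow> zbar_derivative k \<phi>) x = 0" if "x \<notin> open_cube l" for x
        by (rule test_zero_outside[OF t that])
      show "l2 (case i of None \<Rightarrow> H | Some k \<Rightarrow> \<lambda>x. s k * u k x)"
        using H u(1) by (auto split: option.split intro: l2_cmult)
    qed simp
    then have "pairing H \<phi> + (\<Sum>k\<in>UNIV. pairing (\<lambda>x. s k * u k x) (zbar_derivative k \<phi>)) = 0"
      by (simp add: UNIV_option_conv sum.reindex)
    ultimately show ?thesis by (simp add: add_eq_0_iff)
  qed
  then show ?thesis using W by (intro exI[of _ "\<lambda>k x. \<theta> x * u k x"]) blast
qed

section \<open>Reflection across a Lipschitz graph\<close>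

lemma nn_integral_translate:
  fixes F :: "'a::euclidean_space \<Rightarrow> ennreal"
  assumes [measurable]: "F \<in> borel_measurable borel"
  shows "(\<integral>\<^sup>+x. F (c + x) \<partial>lborel) = (\<integral>\<^sup>+x. F x \<partial>lborel)"
proof -
  have "(\<integral>\<^sup>+x. F x \<partial>lborel) = (\<integral>\<^sup>+x. F x \<partial>(distr lborel borel ((+) c)))" by (simp only: lborel_distr_plus)
  also have "\<dots> = (\<integral>\<^sup>+x. F (c + x) \<partial>lborel)" by (rule nn_integral_distr) auto
  finally show ?thesis by simp
qed

text \<open>A map that moves each line in direction \<open>v\<close> into itself by a translation or reflection does not
  change line integrals. Inserting the factor \<open>1 = \<integral>k(x \<bullet> v + s) ds\<close> and translating by \<open>s *\<^sub>R v\<close> writes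
  the integral over the space as an average of line integrals, without coordinates adapted to \<open>v\<close>.\<close>

lemma nn_integral_shear_average:
  fixes S :: "'a::euclidean_space \<Rightarrow> 'a" and F :: "'a \<Rightarrow> ennreal"
  assumes v: "norm v = 1" and F[measurable]: "F \<in> borel_measurable borel" and S[measurable]: "S \<in> borel_measurable borel"
    and shear: "\<And>x. S x = x + \<sigma> x *\<^sub>R v" "\<And>x t. S (x + t *\<^sub>R v) = S x + (\<epsilon> * t) *\<^sub>R v" and \<epsilon>: "\<bar>\<epsilon>\<bar> = 1"
  shows "(\<integral>\<^sup>+x. F (S x) \<partial>lborel) = (\<integral>\<^sup>+x. indicator {0..1} (x \<bullet> v) * (\<integral>\<^sup>+t. F (x + t *\<^sub>R v) \<partial>lborel) \<partial>lborel)"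
proof -
  have vv: "v \<bullet> v = 1" using v by (simp add: dot_square_norm)
  let ?k = "indicator {0..1::real} :: real \<Rightarrow> ennreal"
  have k: "(\<integral>\<^sup>+s. ?k (c + s) \<partial>lborel) = 1" for c :: real
    by (subst nn_integral_translate) auto
  have "(\<integral>\<^sup>+x. F (S x) \<partial>lborel) = (\<integral>\<^sup>+x. (\<integral>\<^sup>+s. F (S x) * ?k (x \<bullet> v + s) \<partial>lborel) \<partial>lborel)"
    by (intro nn_integral_cong) (simp add: nn_integral_cmult k)
  also have "\<dots> = (\<integral>\<^sup>+s. (\<integral>\<^sup>+x. F (S x) * ?k (x \<bullet> v + s) \<partial>lborel) \<partial>lborel)"
    by (rule lborel_pair.Fubini') measurable
  also have "\<dots> = (\<integral>\<^sup>+s. (\<integral>\<^sup>+x. F (S x + (- (\<epsilon> * s)) *\<^sub>R v) * ?k (x \<bullet> v) \<partial>lborel) \<partial>lborel)"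
  proof (rule nn_integral_cong)
    fix s :: real
    have "(\<integral>\<^sup>+x. F (S x) * ?k (x \<bullet> v + s) \<partial>lborel) = (\<integral>\<^sup>+x. F (S ((- s) *\<^sub>R v + x)) * ?k (((- s) *\<^sub>R v + x) \<bullet> v + s) \<partial>lborel)"
      by (rule nn_integral_translate[symmetric]) measurable
    also have "\<dots> = (\<integral>\<^sup>+x. F (S x + (- (\<epsilon> * s)) *\<^sub>R v) * ?k (x \<bullet> v) \<partial>lborel)"
    proof (rule nn_integral_cong)
      fix x
      have 1: "S ((- s) *\<^sub>R v + x) = S x + (- (\<epsilon> * s)) *\<^sub>R v"
        using shear(2)[of x "- s"] by (simp add: add.commute)
      have 2: "((- s) *\<^sub>R v + x) \<bullet> v + s = x \<bullet> v"
        by (simp add: inner_diff_left vv inner_add_left)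
      show "F (S ((- s) *\<^sub>R v + x)) * ?k (((- s) *\<^sub>R v + x) \<bullet> v + s) = F (S x + (- (\<epsilon> * s)) *\<^sub>R v) * ?k (x \<bullet> v)"
        unfolding 1 2 ..
    qed
    finally show "(\<integral>\<^sup>+x. F (S x) * ?k (x \<bullet> v + s) \<partial>lborel) = (\<integral>\<^sup>+x. F (S x + (- (\<epsilon> * s)) *\<^sub>R v) * ?k (x \<bullet> v) \<partial>lborel)" .
  qed
  also have "\<dots> = (\<integral>\<^sup>+x. (\<integral>\<^sup>+s. F (S x + (- (\<epsilon> * s)) *\<^sub>R v) * ?k (x \<bullet> v) \<partial>lborel) \<partial>lborel)"
    by (rule lborel_pair.Fubini'[symmetric]) measurable
  also have "\<dots> = (\<integral>\<^sup>+x. ?k (x \<bullet> v) * (\<integral>\<^sup>+t. F (x + t *\<^sub>R v) \<partial>lborel) \<partial>lborel)"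
  proof (rule nn_integral_cong)
    fix x
    have "(\<integral>\<^sup>+t. F (x + t *\<^sub>R v) \<partial>lborel) = ennreal \<bar>- \<epsilon>\<bar> * (\<integral>\<^sup>+s. F (x + (\<sigma> x + (- \<epsilon>) * s) *\<^sub>R v) \<partial>lborel)"
      by (rule nn_integral_real_affine) (use \<epsilon> in auto)
    also have "\<dots> = (\<integral>\<^sup>+s. F (S x + (- (\<epsilon> * s)) *\<^sub>R v) \<partial>lborel)"
      using \<epsilon> by (simp add: shear(1) algebra_simps)
    finally have "(\<integral>\<^sup>+t. F (x + t *\<^sub>R v) \<partial>lborel) = (\<integral>\<^sup>+s. F (S x + (- (\<epsilon> * s)) *\<^sub>R v) \<partial>lborel)" .
    moreover have "(\<integral>\<^sup>+s. F (S x + (- (\<epsilon> * s)) *\<^sub>R v) * ?k (x \<bullet> v) \<partial>lborel) = (\<integral>\<^sup>+s. F (S x + (- (\<epsilon> * s)) *\<^sub>R v) \<partial>lborel) * ?k (x \<bullet> v)"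
      by (rule nn_integral_multc) measurable
    ultimately show "(\<integral>\<^sup>+s. F (S x + (- (\<epsilon> * s)) *\<^sub>R v) * ?k (x \<bullet> v) \<partial>lborel) = ?k (x \<bullet> v) * (\<integral>\<^sup>+t. F (x + t *\<^sub>R v) \<partial>lborel)"
      by (simp only: mult.commute)
  qed
  finally show ?thesis .
qed

lemma nn_integral_line_average:
  fixes F :: "'a::euclidean_space \<Rightarrow> ennreal"
  assumes v: "norm v = 1" and F[measurable]: "F \<in> borel_measurable borel"
  shows "(\<integral>\<^sup>+x. F x \<partial>lborel) = (\<integral>\<^sup>+x. indicator {0..1} (x \<bullet> v) * (\<integral>\<^sup>+t. F (x + t *\<^sub>R v) \<partial>lborel) \<partial>lborel)"
  by (rule nn_integral_shear_average[OF v F, of "\<lambda>x. x" "\<lambda>x. 0" 1]) auto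

lemma distr_shear:
  fixes S :: "'a::euclidean_space \<Rightarrow> 'a"
  assumes v: "norm v = 1" and S[measurable]: "S \<in> borel_measurable borel"
    and shear: "\<And>x. S x = x + \<sigma> x *\<^sub>R v" "\<And>x t. S (x + t *\<^sub>R v) = S x + (\<epsilon> * t) *\<^sub>R v" and \<epsilon>: "\<bar>\<epsilon>\<bar> = 1"
  shows "distr lborel borel S = lborel"
proof (rule measure_eqI)
  fix A assume "A \<in> sets (distr lborel borel S)"
  then have [measurable]: "A \<in> sets borel" by simp
  have "emeasure (distr lborel borel S) A = (\<integral>\<^sup>+x. indicator A x \<partial>(distr lborel borel S))" by simp
  also have "\<dots> = (\<integral>\<^sup>+x. indicator A (S x) \<partial>lborel)" by (rule nn_integral_distr) auto
  also have "\<dots> = (\<integral>\<^sup>+x. indicator A x \<partial>lborel)"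
    using nn_integral_shear_average[OF v _ S shear \<epsilon>, of "indicator A"] nn_integral_line_average[OF v, of "indicator A"] by simp
  finally show "emeasure (distr lborel borel S) A = emeasure lborel A" by simp
qed simp

lemma distr_lebesgue:
  fixes T :: "'a::euclidean_space \<Rightarrow> 'a"
  assumes T[measurable]: "T \<in> borel_measurable borel" and d: "distr lborel borel T = lborel"
  shows "T \<in> lebesgue \<rightarrow>\<^sub>M lebesgue" "distr lebesgue lebesgue T = lebesgue"
proof -
  have "distr lebesgue lborel T = distr lborel lborel T" by (rule distr_completion) simp
  also have "\<dots> = distr lborel borel T" by (rule distr_cong) auto
  finally have dl: "distr lebesgue lborel T = lborel" using d by simp
  then have eq: "null_sets lborel = null_sets (distr lebesgue lborel T)" by simp
  show "T \<in> lebesgue \<rightarrow>\<^sub>M lebesgue"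
    by (rule completion.measurable_completion2) (auto simp: eq measurable_completion)
  show "distr lebesgue lebesgue T = lebesgue"
    using completion.completion_distr_eq[of T lborel lborel] dl by (simp add: measurable_completion)
qed

text \<open>The region below a Lipschitz graph over the hyperplane orthogonal to \<open>v\<close> is \<open>h > 0\<close>, where \<open>h x\<close>
  is the height of the graph above \<open>x\<close>, measured along \<open>v\<close>. In this form mollification of the graph is
  mollification of \<open>h\<close> on the whole space, without coordinates on the hyperplane.\<close>

locale graph_height =
  fixes h :: "'a::euclidean_space \<Rightarrow> real" and v :: 'a and K :: real
  assumes unit: "norm v = 1" and lip: "K-lipschitz_on UNIV h" and slope: "\<And>x t. h (x + t *\<^sub>R v) = h x - t"
begin

definition reflect :: "'a \<Rightarrow> 'a" where "reflect x = x + (2 * h x) *\<^sub>R v"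

lemma cont_h: "continuous_on UNIV h" using lip by (rule lipschitz_on_continuous_on)

lemma K_nonneg: "K \<ge> 0" using lip lipschitz_on_nonneg by blast

lemma cont_reflect: "continuous_on UNIV reflect"
  unfolding reflect_def by (intro continuous_intros cont_h)

lemma h_reflect: "h (reflect x) = - h x" by (simp add: reflect_def slope)

lemma reflect_involution: "reflect (reflect x) = x"
  using h_reflect[of x] by (simp add: reflect_def[of "reflect x"]) (simp add: reflect_def)

lemma reflect_borel: "reflect \<in> borel_measurable borel"
  by (rule borel_measurable_continuous_onI[OF cont_reflect])

lemma distr_reflect: "distr lborel borel reflect = lborel"
  by (rule distr_shear[OF unit reflect_borel, of "\<lambda>x. 2 * h x" "-1"])
     (auto simp: reflect_def slope algebra_simps simp flip: scaleR_add_left)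

lemma reflect_measurable: "reflect \<in> lebesgue \<rightarrow>\<^sub>M lebesgue"
  and distr_reflect_lebesgue: "distr lebesgue lebesgue reflect = lebesgue"
  using distr_lebesgue[OF reflect_borel distr_reflect] by auto

lemma integral_reflection:
  fixes f :: "'a \<Rightarrow> 'b::{banach, second_countable_topology}"
  assumes "f \<in> borel_measurable lebesgue"
  shows "(LINT x|lebesgue. f (reflect x)) = (LINT x|lebesgue. f x)"
  using integral_distr[OF reflect_measurable, of f] assms by (simp add: distr_reflect_lebesgue)

lemma l2_reflect:
  assumes "l2 f" shows "l2 (\<lambda>x. f (reflect x))"
proof -
  have "integrable (distr lebesgue lebesgue reflect) (\<lambda>x. (cmod (f x))\<^sup>2)"
    using l2_square_integrable[OF assms] by (simp add: distr_reflect_lebesgue)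
  then have "integrable lebesgue (\<lambda>x. (cmod (f (reflect x)))\<^sup>2)"
    by (rule integrable_distr[OF reflect_measurable])
  then show ?thesis
    using measurable_compose[OF reflect_measurable l2_measurable[OF assms]] by (simp add: l2_def)
qed

lemma l2norm_reflect: "l2 f \<Longrightarrow> l2norm (\<lambda>x. f (reflect x)) = l2norm f"
  unfolding l2norm_def
  using integral_reflection[of "\<lambda>x. (cmod (f x))\<^sup>2"] l2_square_integrable[of f] borel_measurable_integrable by auto

lemma pairing_reflect:
  assumes "l2 g" "l2 f" shows "pairing (\<lambda>x. g (reflect x)) f = pairing g (\<lambda>x. f (reflect x))"
proof -
  have m: "(\<lambda>x. g x * f (reflect x)) \<in> borel_measurable lebesgue"
    using l2_measurable[OF assms(1)] l2_measurable[OF l2_reflect[OF assms(2)]] by simp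
  show ?thesis
    using integral_reflection[OF m] by (simp add: pairing_def reflect_involution)
qed

text \<open>Every line in direction \<open>v\<close> meets the graph in a single point.\<close>

lemma level_null: "{x. h x = 0} \<in> null_sets lebesgue"
proof -
  have "closed {x. h x = 0}" by (intro closed_Collect_eq cont_h continuous_intros)
  then have [measurable]: "{x. h x = 0} \<in> sets borel" by simp
  have "emeasure lborel {x. h x = 0} = (\<integral>\<^sup>+x. indicator {x. h x = 0} x \<partial>lborel)" by simp
  also have "\<dots> = (\<integral>\<^sup>+x. indicator {0..1} (x \<bullet> v) * (\<integral>\<^sup>+t. indicator {x. h x = 0} (x + t *\<^sub>R v) \<partial>lborel) \<partial>lborel)"
    by (rule nn_integral_line_average[OF unit]) measurable
  also have "\<dots> = (\<integral>\<^sup>+x. 0 \<partial>(lborel :: 'a measure))"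
  proof (rule nn_integral_cong)
    fix x
    have "(\<lambda>t. indicator {x. h x = 0} (x + t *\<^sub>R v)) = (indicator {h x} :: real \<Rightarrow> ennreal)"
      by (auto simp: slope indicator_def)
    then show "indicator {0..1} (x \<bullet> v) * (\<integral>\<^sup>+t. indicator {x. h x = 0} (x + t *\<^sub>R v) \<partial>lborel) = (0::ennreal)"
      by simp
  qed
  finally have "{x. h x = 0} \<in> null_sets lborel" by (auto simp: null_sets_def)
  then show ?thesis by (rule null_sets_completionI)
qed

end

text \<open>The slope along \<open>v\<close> survives because the kernel has integral one.\<close>

lemma graph_height_mollify:
  assumes "graph_height h v K" "mollifier e \<rho>"
  shows "graph_height (mollify \<rho> h) v K" "smooth (mollify \<rho> h)" "\<And>x. \<bar>mollify \<rho> h x - h x\<bar> \<le> K * e"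
proof -
  interpret graph_height h v K by fact
  note m = mollify_alt[OF assms(2) cont_h]
  show "graph_height (mollify \<rho> h) v K"
  proof
    show "norm v = 1" by (rule unit)
    show "K-lipschitz_on UNIV (mollify \<rho> h)" by (rule mollify_lipschitz[OF assms(2) cont_h lip])
    fix x t
    have "mollify \<rho> h (x + t *\<^sub>R v) = (LINT y|lborel. h (x - y) * \<rho> y - t * \<rho> y)"
      unfolding m
    proof (rule Bochner_Integration.integral_cong[OF refl])
      fix y
      have "x + t *\<^sub>R v - y = (x - y) + t *\<^sub>R v" by simp
      then have "h (x + t *\<^sub>R v - y) = h (x - y) - t" by (simp only: slope)
      then show "h (x + t *\<^sub>R v - y) * \<rho> y = h (x - y) * \<rho> y - t * \<rho> y" by (simp add: left_diff_distrib)
    qed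
    also have "\<dots> = mollify \<rho> h x - t"
      unfolding m using mollify_integrable[OF assms(2) cont_h] integrable_mollifier[OF assms(2) cont_h] mollifier_integral[OF assms(2) cont_h]
      by (subst Bochner_Integration.integral_diff) auto
    finally show "mollify \<rho> h (x + t *\<^sub>R v) = mollify \<rho> h x - t" .
  qed
  show "smooth (mollify \<rho> h)" by (rule mollify_smooth[OF assms(2) cont_h])
  fix x
  have "h x - K * e \<le> h (x - y) \<and> h (x - y) \<le> h x + K * e" if "norm y \<le> e" for y
  proof -
    have "\<bar>h (x - y) - h x\<bar> \<le> K * norm y" using lipschitz_onD[OF lip, of "x - y" x] by (simp add: dist_norm)
    also have "\<dots> \<le> K * e" using that K_nonneg by (rule mult_left_mono)
    finally show ?thesis by (simp add: abs_le_iff)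
  qed
  from mollify_between[OF assms(2) cont_h this]
  show "\<bar>mollify \<rho> h x - h x\<bar> \<le> K * e" by (auto simp: abs_le_iff)
qed

lemma dird_eqI_quotient:
  fixes f :: "'a::euclidean_space \<Rightarrow> 'b::real_normed_vector"
  assumes "smooth f" "\<And>t. f (x + t *\<^sub>R w) - f x = t *\<^sub>R c"
  shows "dird w f x = c"
proof -
  have "((\<lambda>t. (f (x + t *\<^sub>R w) - f x) /\<^sub>R t) \<longlongrightarrow> dird w f x) (at 0)"
    by (rule directional_quotient_tendsto[OF smooth_has_derivative[OF assms(1)]])
  moreover have "((\<lambda>t. (f (x + t *\<^sub>R w) - f x) /\<^sub>R t) \<longlongrightarrow> c) (at 0)"
    by (rule tendsto_eventually) (simp add: assms(2) eventually_at_filter)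
  ultimately show ?thesis using tendsto_unique[OF at_neq_bot] by blast
qed

lemma dird_of_real:
  "smooth f \<Longrightarrow> dird w (\<lambda>x. complex_of_real (f x)) x = of_real (dird w f x)"
  by (rule fun_cong[OF frechet_derivative_eqI[OF has_derivative_of_real[OF smooth_has_derivative]]])

definition smooth_step :: "(real \<Rightarrow> real) \<Rightarrow> bool" where
  "smooth_step \<eta> \<longleftrightarrow> smooth \<eta> \<and> (\<forall>t. 0 \<le> \<eta> t \<and> \<eta> t \<le> 1) \<and> (\<forall>t\<le>1. \<eta> t = 0) \<and> (\<forall>t\<ge>2. \<eta> t = 1) \<and> 2-lipschitz_on UNIV \<eta>"

lemma smooth_step_derivative:
  assumes "smooth_step \<eta>"
  shows "\<bar>dird 1 \<eta> t\<bar> \<le> 2" "t < 1 \<or> t > 2 \<Longrightarrow> dird 1 \<eta> t = 0"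
proof -
  have \<eta>: "smooth \<eta>" "\<And>t. t \<le> 1 \<Longrightarrow> \<eta> t = 0" "\<And>t. t \<ge> 2 \<Longrightarrow> \<eta> t = 1" "2-lipschitz_on UNIV \<eta>"
    using assms by (auto simp: smooth_step_def)
  show "\<bar>dird 1 \<eta> t\<bar> \<le> 2"
    using norm_derivative_le_lipschitz[OF smooth_has_derivative[OF \<eta>(1)] \<eta>(4), of t 1] by simp
  assume "t < 1 \<or> t > 2"
  then show "dird 1 \<eta> t = 0"
  proof
    assume "t < 1"
    have "(\<eta> has_derivative (\<lambda>v. 0)) (at t)"
      by (rule has_derivative_transform_within_open[OF has_derivative_const[of 0], where s="{..<1}"]) (use \<open>t < 1\<close> \<eta> in auto)
    then show ?thesis by (simp add: frechet_derivative_eqI)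
  next
    assume "t > 2"
    have "(\<eta> has_derivative (\<lambda>v. 0)) (at t)"
      by (rule has_derivative_transform_within_open[OF has_derivative_const[of 1], where s="{2<..}"]) (use \<open>t > 2\<close> \<eta> in auto)
    then show ?thesis by (simp add: frechet_derivative_eqI)
  qed
qed

locale smooth_graph_height = graph_height +
  assumes smooth_h: "smooth h"
begin

lemma smooth_reflect: "smooth reflect"
  unfolding reflect_def
  by (intro smooth_add smooth_scaleR smooth_mult smooth_const smooth_h smooth_bounded_linear bounded_linear_ident)

lemma dird_h_v: "dird v h x = - 1"
  by (rule dird_eqI_quotient[OF smooth_h]) (simp add: slope)

lemma dird_h_bound: "\<bar>dird b h x\<bar> \<le> K * norm b"
  using norm_derivative_le_lipschitz[OF smooth_has_derivative[OF smooth_h] lip] by simp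

lemma dird_dird_h_v: "dird v (dird b h) x = 0"
proof (rule dird_eqI_quotient[OF smooth_dird[OF smooth_h]])
  fix t
  have "((\<lambda>y. h (y + t *\<^sub>R v)) has_derivative (\<lambda>w. frechet_derivative h (at (x + t *\<^sub>R v)) w)) (at x)"
    by (rule has_derivative_compose[where g=h, OF _ smooth_has_derivative[OF smooth_h]]) (auto intro!: derivative_eq_intros)
  moreover have "((\<lambda>y. h (y + t *\<^sub>R v)) has_derivative frechet_derivative h (at x)) (at x)"
    unfolding slope using has_derivative_diff[OF smooth_has_derivative[OF smooth_h] has_derivative_const[of t]] by simp
  ultimately have "frechet_derivative h (at (x + t *\<^sub>R v)) = frechet_derivative h (at x)"
    using has_derivative_unique by metis
  then show "dird b h (x + t *\<^sub>R v) - dird b h x = t *\<^sub>R 0" by simp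
qed

lemma dird_reflect:
  fixes \<phi> :: "'a \<Rightarrow> complex"
  assumes "smooth \<phi>"
  shows "dird w (\<lambda>x. \<phi> (reflect x)) x = dird w \<phi> (reflect x) + 2 * of_real (dird w h x) * dird v \<phi> (reflect x)"
proof -
  let ?D = "frechet_derivative \<phi> (at (reflect x))"
  have "(reflect has_derivative (\<lambda>w. w + (2 * dird w h x) *\<^sub>R v)) (at x)"
    unfolding reflect_def using smooth_has_derivative[OF smooth_h, of x]
    by (auto intro!: derivative_eq_intros)
  from has_derivative_compose[OF this smooth_has_derivative[OF assms]]
  have "((\<lambda>x. \<phi> (reflect x)) has_derivative (\<lambda>w. ?D (w + (2 * dird w h x) *\<^sub>R v))) (at x)" .
  then have "dird w (\<lambda>x. \<phi> (reflect x)) x = ?D (w + (2 * dird w h x) *\<^sub>R v)"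
    by (simp add: frechet_derivative_eqI)
  also have "\<dots> = ?D w + (2 * dird w h x) *\<^sub>R ?D v"
    using has_derivative_linear[OF smooth_has_derivative[OF assms, of "reflect x"]]
    by (simp add: linear_add linear_scale)
  finally show ?thesis by (simp add: scaleR_conv_of_real)
qed

context
  fixes \<eta> :: "real \<Rightarrow> real" and \<delta> :: real and \<phi> :: "'a \<Rightarrow> complex" and b :: 'a
  assumes \<eta>: "smooth_step \<eta>" and \<delta>: "\<delta> > 0" and \<phi>: "\<phi> \<in> test_functions UNIV"
begin

text \<open>This keeps a test function away from the graph; its derivatives live in the layer where \<open>h\<close> is
  between \<open>\<delta>\<close> and \<open>2 * \<delta>\<close>.\<close>

definition cut :: "'a \<Rightarrow> complex" where "cut x = of_real (\<eta> (h x / \<delta>))"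

text \<open>With \<open>a = slant\<close>, the operator \<open>\<partial>\<^sub>b + a \<partial>\<^sub>v\<close> annihilates \<open>h\<close>, hence is tangential to the graph.\<close>

definition slant :: "'a \<Rightarrow> complex" where "slant x = of_real (dird b h x)"

definition \<phi>_reflected :: "'a \<Rightarrow> complex" where "\<phi>_reflected x = \<phi> (reflect x)"

text \<open>The term in which a derivative falls on \<open>cut\<close>.\<close>

definition remainder :: "'a \<Rightarrow> complex" where
  "remainder x = of_real (dird 1 \<eta> (h x / \<delta>) / \<delta>) * slant x * (\<phi> x - \<phi>_reflected x)"

lemma step_facts: "smooth \<eta>" "0 \<le> \<eta> t" "\<eta> t \<le> 1" "t \<le> 1 \<Longrightarrow> \<eta> t = 0" "t \<ge> 2 \<Longrightarrow> \<eta> t = 1"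
  using \<eta> by (auto simp: smooth_step_def)

lemma smooth_cut_real: "smooth (\<lambda>x. \<eta> (h x / \<delta>))"
  using smooth_compose[OF step_facts(1), of "\<lambda>x. inverse \<delta> * h x"] smooth_mult[OF smooth_const smooth_h, of "inverse \<delta>"]
  by (simp add: divide_inverse mult.commute)

lemma smooth_cut: "smooth cut"
  unfolding cut_def by (rule smooth_complex_of_real[OF smooth_cut_real])

lemma smooth_slant: "smooth slant"
  unfolding slant_def by (rule smooth_complex_of_real[OF smooth_dird[OF smooth_h]])

lemma smooth_\<phi>: "smooth \<phi>" using \<phi> by (rule test_smooth)

lemma smooth_\<phi>_reflected: "smooth \<phi>_reflected"
  unfolding \<phi>_reflected_def by (rule smooth_compose[OF smooth_\<phi> smooth_reflect])

lemma dird_cut: "dird w cut x = of_real (dird 1 \<eta> (h x / \<delta>) * (dird w h x / \<delta>))"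
proof -
  have "((\<lambda>x. \<eta> (h x / \<delta>)) has_derivative (\<lambda>w. frechet_derivative \<eta> (at (h x / \<delta>)) (dird w h x / \<delta>))) (at x)"
    by (rule has_derivative_compose[OF _ smooth_has_derivative[OF step_facts(1)]])
       (use smooth_has_derivative[OF smooth_h, of x] \<delta> in \<open>auto intro!: derivative_eq_intros simp: divide_inverse\<close>)
  then have "dird w (\<lambda>x. \<eta> (h x / \<delta>)) x = frechet_derivative \<eta> (at (h x / \<delta>)) (dird w h x / \<delta>)"
    by (simp add: frechet_derivative_eqI)
  also have "\<dots> = (dird w h x / \<delta>) * dird 1 \<eta> (h x / \<delta>)"
    using linear_scale[OF has_derivative_linear[OF smooth_has_derivative[OF step_facts(1), of "h x / \<delta>"]], of "dird w h x / \<delta>" 1] by simp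
  finally show ?thesis
    unfolding cut_def dird_of_real[OF smooth_cut_real] by (simp only: mult.commute)
qed

lemma dird_slant_v: "dird v slant x = 0"
  unfolding slant_def dird_of_real[OF smooth_dird[OF smooth_h]] by (simp add: dird_dird_h_v)

text \<open>Up to the remainder, \<open>cut\<close> times \<open>\<partial>\<^sub>b \<phi> + (\<partial>\<^sub>b \<phi>) \<circ> reflect\<close> is a sum of derivatives of functions supported
  in \<open>h > 0\<close>. Twice \<open>\<phi>_reflected\<close> is the even part \<open>\<phi> + \<phi>_reflected\<close> minus the odd part \<open>\<phi> - \<phi>_reflected\<close>. The
  even part meets only the tangential operator, for which \<open>cut\<close> is constant, so the derivative of
  \<open>cut\<close> multiplies only the odd part, which vanishes on the graph.\<close>

lemma tangential_identity:
  "dird b (\<lambda>x. cut x * (\<phi> x + \<phi>_reflected x)) x + dird v (\<lambda>x. 2 * (slant x * (cut x * \<phi>_reflected x))) x =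
     cut x * (dird b \<phi> x + dird b \<phi> (reflect x)) + remainder x"
proof -
  have r: "dird w \<phi>_reflected x = dird w \<phi> (reflect x) + 2 * of_real (dird w h x) * dird v \<phi> (reflect x)" for w
    unfolding \<phi>_reflected_def by (rule dird_reflect[OF smooth_\<phi>])
  have 1: "dird b (\<lambda>x. cut x * (\<phi> x + \<phi>_reflected x)) x = cut x * (dird b \<phi> x + dird b \<phi>_reflected x) + dird b cut x * (\<phi> x + \<phi>_reflected x)"
    by (simp add: dird_mult dird_add smooth_add smooth_cut smooth_\<phi> smooth_\<phi>_reflected)
  have 2: "dird v (\<lambda>x. 2 * (slant x * (cut x * \<phi>_reflected x))) x = 2 * (slant x * (cut x * dird v \<phi>_reflected x + dird v cut x * \<phi>_reflected x))"
    by (simp add: dird_cmult dird_mult smooth_mult smooth_cut smooth_slant smooth_\<phi>_reflected dird_slant_v)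
  show ?thesis
    unfolding 1 2 r dird_cut remainder_def dird_h_v
    using \<delta> by (simp add: slant_def field_simps)
qed

lemma test_cut_mult:
  assumes "smooth k" "compact S" "\<And>x. x \<notin> S \<Longrightarrow> k x = 0" "\<And>x. h x \<ge> \<delta> \<Longrightarrow> x \<in> U"
  shows "(\<lambda>x. cut x * k x) \<in> test_functions U"
proof (rule test_functionsI[of _ "S \<inter> {x. h x \<ge> \<delta>}"])
  show "smooth (\<lambda>x. cut x * k x)" by (rule smooth_mult[OF smooth_cut assms(1)])
  show "compact (S \<inter> {x. h x \<ge> \<delta>})"
    by (intro compact_Int_closed assms closed_Collect_le cont_h continuous_intros)
  show "S \<inter> {x. \<delta> \<le> h x} \<subseteq> U" using assms(4) by auto
  show "cut x * k x = 0" if "x \<notin> S \<inter> {x. \<delta> \<le> h x}" for x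
  proof (cases "x \<in> S")
    case True
    then have "h x / \<delta> \<le> 1" using that \<delta> by (simp add: field_simps)
    then show ?thesis by (simp add: cut_def step_facts(4))
  qed (simp add: assms(3))
qed

lemma \<phi>_reflected_compact:
  obtains S where "compact S" "\<And>x. x \<notin> S \<Longrightarrow> \<phi> x = 0" "\<And>x. x \<notin> S \<Longrightarrow> \<phi>_reflected x = 0"
    "\<And>x c. x \<notin> S \<Longrightarrow> dird c \<phi> x = 0" "\<And>x c. x \<notin> S \<Longrightarrow> dird c \<phi> (reflect x) = 0"
proof -
  obtain S where S: "compact S" "\<And>x. x \<notin> S \<Longrightarrow> \<phi> x = 0" using \<phi> by (auto elim: test_functionsE)
  have d: "dird c \<phi> x = 0" if "x \<notin> S" for x c
    by (rule dird_zero_outside_closed[OF compact_imp_closed[OF S(1)] S(2) that])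
  have r: "reflect x \<notin> S" if "x \<notin> reflect ` S" for x using that reflect_involution[of x] by (metis image_eqI)
  have "compact (S \<union> reflect ` S)"
    by (intro compact_Un S compact_continuous_image continuous_on_subset[OF cont_reflect]) auto
  then show thesis
    by (rule that) (use S d r in \<open>auto simp: \<phi>_reflected_def\<close>)
qed

lemma cut_bound: "cmod (cut x) \<le> 1"
  using step_facts(2,3) by (simp add: cut_def)

text \<open>The derivative of \<open>cut\<close> is of order \<open>1 / \<delta>\<close>, and in the layer where it lives \<open>\<phi>\<close> and its
  reflection differ by a multiple of \<open>\<delta>\<close>.\<close>

lemma remainder_bound:
  assumes M: "M-lipschitz_on UNIV \<phi>" and b: "norm b \<le> 1"
  shows "cmod (remainder x) \<le> 8 * K * M"
proof -
  have M0: "M \<ge> 0" using M lipschitz_on_nonneg by blast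
  have Kb: "cmod (slant x) \<le> K"
    using dird_h_bound[where b=b and x=x] mult_left_mono[OF b K_nonneg] by (simp add: slant_def)
  show ?thesis
  proof (cases "h x / \<delta> < 1 \<or> h x / \<delta> > 2")
    case True
    then have "remainder x = 0" using smooth_step_derivative(2)[OF \<eta>] by (simp add: remainder_def)
    then show ?thesis using M0 K_nonneg by simp
  next
    case False
    then have hx: "0 \<le> h x" "h x \<le> 2 * \<delta>" using \<delta> by (auto simp: field_simps)
    have "cmod (\<phi> x - \<phi>_reflected x) \<le> M * dist x (reflect x)"
      using lipschitz_onD[OF M, of x "reflect x"] by (simp add: dist_norm \<phi>_reflected_def)
    also have "dist x (reflect x) = 2 * h x" using hx unit by (simp add: reflect_def dist_norm)
    also have "M * (2 * h x) \<le> M * (4 * \<delta>)" using M0 hx by (intro mult_left_mono) auto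
    finally have d: "cmod (\<phi> x - \<phi>_reflected x) \<le> M * (4 * \<delta>)" .
    have "cmod (remainder x) = (\<bar>dird 1 \<eta> (h x / \<delta>)\<bar> / \<delta>) * cmod (slant x) * cmod (\<phi> x - \<phi>_reflected x)"
      using \<delta> by (simp add: remainder_def norm_mult norm_divide)
    also have "\<dots> \<le> (2 / \<delta>) * K * (M * (4 * \<delta>))"
      using \<delta> smooth_step_derivative(1)[OF \<eta>] K_nonneg
      by (intro mult_mono d Kb divide_right_mono) auto
    also have "\<dots> = 8 * K * M" using \<delta> by simp
    finally show ?thesis .
  qed
qed

lemma remainder_zero: "h x > 2 * \<delta> \<Longrightarrow> remainder x = 0"
  using smooth_step_derivative(2)[OF \<eta>, of "h x / \<delta>"] \<delta> by (simp add: remainder_def field_simps)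

lemma cut_one: "h x \<ge> 2 * \<delta> \<Longrightarrow> cut x = 1"
  using step_facts(5)[of "h x / \<delta>"] \<delta> by (simp add: cut_def field_simps)

lemma tangential_bound:
  assumes g: "l2 g" "l2 gb" "l2 gv" and wd: "weak_dird U b g gb" "weak_dird U v g gv"
    and U: "\<And>x. h x \<ge> \<delta> \<Longrightarrow> x \<in> U" and b: "norm b \<le> 1"
  shows "cmod (pairing g (\<lambda>x. cut x * (dird b \<phi> x + dird b \<phi> (reflect x))))
     \<le> (2 * l2norm gb + 2 * K * l2norm gv) * l2norm \<phi> + cmod (pairing g remainder)"
proof -
  obtain S where S: "compact S" "\<And>x. x \<notin> S \<Longrightarrow> \<phi> x = 0" "\<And>x. x \<notin> S \<Longrightarrow> \<phi>_reflected x = 0"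
    "\<And>x c. x \<notin> S \<Longrightarrow> dird c \<phi> x = 0" "\<And>x c. x \<notin> S \<Longrightarrow> dird c \<phi> (reflect x) = 0"
    using \<phi>_reflected_compact by metis
  have sd: "smooth (\<lambda>x. dird b \<phi> (reflect x))"
    by (rule smooth_compose[OF smooth_dird[OF smooth_\<phi>] smooth_reflect])
  have t1: "(\<lambda>x. cut x * (\<phi> x + \<phi>_reflected x)) \<in> test_functions U"
    by (rule test_cut_mult[OF _ S(1) _ U]) (auto intro!: smooth_add smooth_\<phi> smooth_\<phi>_reflected simp: S)
  have t1a: "(\<lambda>x. cut x * \<phi> x) \<in> test_functions U"
    by (rule test_cut_mult[OF _ S(1) _ U]) (auto intro!: smooth_\<phi> simp: S)
  have t2a: "(\<lambda>x. cut x * \<phi>_reflected x) \<in> test_functions U"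
    by (rule test_cut_mult[OF _ S(1) _ U]) (auto intro!: smooth_\<phi>_reflected simp: S)
  have t2: "(\<lambda>x. 2 * (slant x * (cut x * \<phi>_reflected x))) \<in> test_functions U"
    by (intro test_cmult test_mult[OF t2a smooth_slant])
  have t3: "(\<lambda>x. cut x * (dird b \<phi> x + dird b \<phi> (reflect x))) \<in> test_functions U"
    by (rule test_cut_mult[OF _ S(1) _ U]) (auto intro!: smooth_add smooth_dird[OF smooth_\<phi>] sd simp: S)
  let ?d1 = "dird b (\<lambda>x. cut x * (\<phi> x + \<phi>_reflected x))" and ?d2 = "dird v (\<lambda>x. 2 * (slant x * (cut x * \<phi>_reflected x)))"
  have l12: "l2 ?d1" "l2 ?d2" using test_l2[OF test_dird[OF t1]] test_l2[OF test_dird[OF t2]] by auto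
  have rem: "remainder = (\<lambda>x. (?d1 x + ?d2 x) - cut x * (dird b \<phi> x + dird b \<phi> (reflect x)))"
    by (rule ext) (simp only: tangential_identity add_diff_cancel_left')
  have "pairing g remainder = pairing g ?d1 + pairing g ?d2 - pairing g (\<lambda>x. cut x * (dird b \<phi> x + dird b \<phi> (reflect x)))"
    unfolding rem by (simp add: pairing_diff_right pairing_add_right g l12 l2_add test_l2[OF t3])
  then have eq: "pairing g (\<lambda>x. cut x * (dird b \<phi> x + dird b \<phi> (reflect x))) =
    - pairing gb (\<lambda>x. cut x * (\<phi> x + \<phi>_reflected x)) - pairing gv (\<lambda>x. 2 * (slant x * (cut x * \<phi>_reflected x))) - pairing g remainder"
    using wd t1 t2 by (simp add: weak_dird_def)
  have l2\<phi>: "l2 \<phi>" by (rule test_l2[OF \<phi>])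
  have l2r: "l2 \<phi>_reflected" unfolding \<phi>_reflected_def by (rule l2_reflect[OF l2\<phi>])
  have nr: "l2norm \<phi>_reflected = l2norm \<phi>" unfolding \<phi>_reflected_def by (rule l2norm_reflect[OF l2\<phi>])
  have n1: "l2norm (\<lambda>x. cut x * \<phi> x) \<le> 1 * l2norm \<phi>"
    by (rule l2norm_mono[OF test_l2[OF t1a] l2\<phi>]) (auto simp: norm_mult intro!: mult_right_mono[OF cut_bound, THEN order_trans])
  have n2: "l2norm (\<lambda>x. cut x * \<phi>_reflected x) \<le> 1 * l2norm \<phi>_reflected"
    by (rule l2norm_mono[OF test_l2[OF t2a] l2r]) (auto simp: norm_mult intro!: mult_right_mono[OF cut_bound, THEN order_trans])
  have n3: "l2norm (\<lambda>x. 2 * (slant x * (cut x * \<phi>_reflected x))) \<le> (2 * K) * l2norm \<phi>_reflected"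
  proof (rule l2norm_mono[OF test_l2[OF t2] l2r])
    have "cmod (2 * (slant x * (cut x * \<phi>_reflected x))) \<le> 2 * K * cmod (\<phi>_reflected x)" for x
    proof -
      have Kb: "cmod (slant x) \<le> K"
        using dird_h_bound[where b=b and x=x] mult_left_mono[OF b K_nonneg] by (simp add: slant_def)
      have "cmod (slant x) * (cmod (cut x) * cmod (\<phi>_reflected x)) \<le> K * (1 * cmod (\<phi>_reflected x))"
        by (intro mult_mono Kb cut_bound K_nonneg) auto
      then show ?thesis by (simp add: norm_mult)
    qed
    then show "AE x in lebesgue. cmod (2 * (slant x * (cut x * \<phi>_reflected x))) \<le> 2 * K * cmod (\<phi>_reflected x)" by simp
  qed (use K_nonneg in simp)
  have "pairing gb (\<lambda>x. cut x * (\<phi> x + \<phi>_reflected x)) = pairing gb (\<lambda>x. cut x * \<phi> x) + pairing gb (\<lambda>x. cut x * \<phi>_reflected x)"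
    by (simp add: distrib_left pairing_add_right g test_l2[OF t1a] test_l2[OF t2a])
  then have "cmod (pairing gb (\<lambda>x. cut x * (\<phi> x + \<phi>_reflected x))) \<le> cmod (pairing gb (\<lambda>x. cut x * \<phi> x)) + cmod (pairing gb (\<lambda>x. cut x * \<phi>_reflected x))"
    by (simp only: norm_triangle_ineq)
  also have "\<dots> \<le> l2norm gb * l2norm (\<lambda>x. cut x * \<phi> x) + l2norm gb * l2norm (\<lambda>x. cut x * \<phi>_reflected x)"
    by (intro add_mono Cauchy_Schwarz_pairing g test_l2[OF t1a] test_l2[OF t2a])
  also have "\<dots> \<le> l2norm gb * l2norm \<phi> + l2norm gb * l2norm \<phi>"
    using n1 n2 nr by (intro add_mono mult_left_mono l2norm_nonneg) auto
  finally have b1: "cmod (pairing gb (\<lambda>x. cut x * (\<phi> x + \<phi>_reflected x))) \<le> 2 * l2norm gb * l2norm \<phi>" by (simp add: mult_ac)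
  have "cmod (pairing gv (\<lambda>x. 2 * (slant x * (cut x * \<phi>_reflected x)))) \<le> l2norm gv * l2norm (\<lambda>x. 2 * (slant x * (cut x * \<phi>_reflected x)))"
    by (rule Cauchy_Schwarz_pairing[OF g(3) test_l2[OF t2]])
  also have "\<dots> \<le> l2norm gv * ((2 * K) * l2norm \<phi>)"
    using n3 nr by (intro mult_left_mono l2norm_nonneg) auto
  finally have b2: "cmod (pairing gv (\<lambda>x. 2 * (slant x * (cut x * \<phi>_reflected x)))) \<le> 2 * K * l2norm gv * l2norm \<phi>"
    by (simp add: mult_ac)
  have "cmod (pairing g (\<lambda>x. cut x * (dird b \<phi> x + dird b \<phi> (reflect x)))) \<le>
    cmod (pairing gb (\<lambda>x. cut x * (\<phi> x + \<phi>_reflected x))) + cmod (pairing gv (\<lambda>x. 2 * (slant x * (cut x * \<phi>_reflected x)))) + cmod (pairing g remainder)"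
    unfolding eq by (smt (verit) norm_minus_cancel norm_triangle_ineq4)
  then show ?thesis using b1 b2 by (simp add: distrib_right)
qed

lemma remainder_measurable: "remainder \<in> borel_measurable lebesgue"
proof (rule continuous_imp_lebesgue_measurable)
  have "continuous_on UNIV (\<lambda>x. dird 1 \<eta> (h x / \<delta>))"
    by (rule continuous_on_compose2[OF smooth_continuous[OF smooth_dird[OF step_facts(1)], of UNIV]])
       (use \<delta> in \<open>auto intro!: continuous_intros cont_h\<close>)
  then show "continuous_on UNIV remainder"
    unfolding remainder_def using \<delta>
    by (intro continuous_intros smooth_continuous[OF smooth_slant] smooth_continuous[OF smooth_\<phi>] smooth_continuous[OF smooth_\<phi>_reflected]) auto
qed

end

text \<open>All that the passage to the limit needs from the cutoff and the remainder; the constants do not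
  depend on \<open>\<delta>\<close>, nor on \<open>h\<close> except through \<open>K\<close>.\<close>

lemma smooth_approximation:
  assumes \<eta>: "smooth_step \<eta>" and \<delta>: "\<delta> > 0" and \<phi>: "\<phi> \<in> test_functions UNIV" "M-lipschitz_on UNIV \<phi>" and b: "norm b \<le> 1"
  shows "\<exists>c r. c \<in> borel_measurable lebesgue \<and> (\<forall>x. cmod (c x) \<le> 1) \<and> (\<forall>x. h x > 2 * \<delta> \<longrightarrow> c x = 1) \<and>
    r \<in> borel_measurable lebesgue \<and> (\<forall>x. cmod (r x) \<le> 8 * K * M) \<and> (\<forall>x. h x > 2 * \<delta> \<longrightarrow> r x = 0) \<and>
    (\<forall>g gb gv U. l2 g \<longrightarrow> l2 gb \<longrightarrow> l2 gv \<longrightarrow> weak_dird U b g gb \<longrightarrow> weak_dird U v g gv \<longrightarrow>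
      (\<forall>x. h x \<ge> \<delta> \<longrightarrow> x \<in> U) \<longrightarrow>
      cmod (pairing g (\<lambda>x. c x * (dird b \<phi> x + dird b \<phi> (reflect x))))
        \<le> (2 * l2norm gb + 2 * K * l2norm gv) * l2norm \<phi> + cmod (pairing g r))"
proof (intro exI conjI)
  show "cut \<eta> \<delta> \<in> borel_measurable lebesgue"
    by (rule continuous_imp_lebesgue_measurable[OF smooth_continuous[OF smooth_cut[OF \<eta> \<delta> \<phi>(1)]]])
  show "\<forall>x. cmod (cut \<eta> \<delta> x) \<le> 1" using cut_bound[OF \<eta> \<delta> \<phi>(1)] by blast
  show "\<forall>x. h x > 2 * \<delta> \<longrightarrow> cut \<eta> \<delta> x = 1" using cut_one[OF \<eta> \<delta> \<phi>(1)] by simp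
  show "remainder \<eta> \<delta> \<phi> b \<in> borel_measurable lebesgue" by (rule remainder_measurable[OF \<eta> \<delta> \<phi>(1)])
  show "\<forall>x. cmod (remainder \<eta> \<delta> \<phi> b x) \<le> 8 * K * M" using remainder_bound[OF \<eta> \<delta> \<phi>(1) \<phi>(2) b] by blast
  show "\<forall>x. h x > 2 * \<delta> \<longrightarrow> remainder \<eta> \<delta> \<phi> b x = 0" using remainder_zero[OF \<eta> \<delta> \<phi>(1)] by blast
qed (use tangential_bound[OF \<eta> \<delta> \<phi>(1) _ _ _ _ _ _ b] in blast)

end

context graph_height
begin

text \<open>The height is approximated by mollified heights. Cutting off at height \<open>\<delta> n\<close>, slightly more than
  the approximation error \<open>K * \<epsilon> n\<close>, keeps the test functions inside the original region. In the limit
  the cutoff disappears, and the remainders tend to zero pointwise with a common bound.\<close>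

lemma reflection_bound:
  assumes g: "l2 g" "l2 gb" "l2 gv"
    and wd: "weak_dird {x. h x > 0} b g gb" "weak_dird {x. h x > 0} v g gv" and b: "norm b \<le> 1"
    and B: "compact B" "\<And>x. x \<notin> B \<Longrightarrow> g x = 0" and pos: "\<And>x. h x \<le> 0 \<Longrightarrow> g x = 0"
    and \<phi>: "\<phi> \<in> test_functions UNIV"
  shows "cmod (pairing g (\<lambda>x. dird b \<phi> x + dird b \<phi> (reflect x))) \<le> (2 * l2norm gb + 2 * K * l2norm gv) * l2norm \<phi>"
proof -
  obtain \<eta> where \<eta>: "smooth_step \<eta>"
    unfolding smooth_step_def by (rule exists_smooth_step) blast
  obtain M where M: "M-lipschitz_on UNIV \<phi>" using test_lipschitz[OF \<phi>] .
  obtain Mb where Mb: "Mb \<ge> 0" "\<And>x. cmod (dird b \<phi> x) \<le> Mb" using test_bounded[OF test_dird[OF \<phi>]] by metis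
  define \<epsilon> where "\<epsilon> n = inverse (real (Suc n))" for n
  define \<delta> where "\<delta> n = (K + 1) * \<epsilon> n" for n
  have \<epsilon>: "\<epsilon> n > 0" for n by (simp add: \<epsilon>_def)
  have \<epsilon>0: "\<epsilon> \<longlonglongrightarrow> 0" unfolding \<epsilon>_def by (rule LIMSEQ_inverse_real_of_nat)
  have \<delta>: "\<delta> n > 0" "\<delta> n > K * \<epsilon> n" for n using \<epsilon>[of n] K_nonneg by (auto simp: \<delta>_def distrib_right add_nonneg_pos)
  have "\<exists>\<rho>::'a \<Rightarrow> real. mollifier (\<epsilon> n) \<rho>" for n using exists_mollifier[OF \<epsilon>[of n]] by metis
  then obtain \<rho> :: "nat \<Rightarrow> 'a \<Rightarrow> real" where \<rho>: "\<And>n. mollifier (\<epsilon> n) (\<rho> n)" by metis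
  define H where "H n = mollify (\<rho> n) h" for n
  have gh: "graph_height h v K" by (rule graph_height_axioms)
  have H: "smooth_graph_height (H n) v K" "\<bar>H n x - h x\<bar> \<le> K * \<epsilon> n" for n x
    unfolding H_def using graph_height_mollify[OF gh \<rho>[of n]]
    by (auto simp: smooth_graph_height_def smooth_graph_height_axioms_def)
  define R where "R n = graph_height.reflect (H n) v" for n
  have R: "R n x = x + (2 * H n x) *\<^sub>R v" for n x
    unfolding R_def by (rule graph_height.reflect_def[OF smooth_graph_height.axioms(1)[OF H(1)]])
  define Q where "Q n c r \<longleftrightarrow> c \<in> borel_measurable lebesgue \<and> (\<forall>x. cmod (c x) \<le> 1) \<and> (\<forall>x. H n x > 2 * \<delta> n \<longrightarrow> c x = 1) \<and>
    r \<in> borel_measurable lebesgue \<and> (\<forall>x. cmod (r x) \<le> 8 * K * M) \<and> (\<forall>x. H n x > 2 * \<delta> n \<longrightarrow> r x = 0) \<and>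
    (\<forall>g gb gv U. l2 g \<longrightarrow> l2 gb \<longrightarrow> l2 gv \<longrightarrow> weak_dird U b g gb \<longrightarrow> weak_dird U v g gv \<longrightarrow>
      (\<forall>x. H n x \<ge> \<delta> n \<longrightarrow> x \<in> U) \<longrightarrow>
      cmod (pairing g (\<lambda>x. c x * (dird b \<phi> x + dird b \<phi> (R n x))))
        \<le> (2 * l2norm gb + 2 * K * l2norm gv) * l2norm \<phi> + cmod (pairing g r))" for n c r
  have "\<forall>n. \<exists>c r. Q n c r"
    unfolding R_def Q_def by (rule allI, rule smooth_graph_height.smooth_approximation[OF H(1) \<eta> \<delta>(1) \<phi> M b])
  then obtain c r where Q: "\<And>n. Q n (c n) (r n)" by metis
  have cr: "\<And>n. c n \<in> borel_measurable lebesgue" "\<And>n x. cmod (c n x) \<le> 1" "\<And>n x. H n x > 2 * \<delta> n \<Longrightarrow> c n x = 1"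
    "\<And>n. r n \<in> borel_measurable lebesgue" "\<And>n x. cmod (r n x) \<le> 8 * K * M" "\<And>n x. H n x > 2 * \<delta> n \<Longrightarrow> r n x = 0"
    and bnd: "\<And>n g gb gv U. l2 g \<Longrightarrow> l2 gb \<Longrightarrow> l2 gv \<Longrightarrow> weak_dird U b g gb \<Longrightarrow> weak_dird U v g gv \<Longrightarrow>
      (\<forall>x. H n x \<ge> \<delta> n \<longrightarrow> x \<in> U) \<Longrightarrow>
      cmod (pairing g (\<lambda>x. c n x * (dird b \<phi> x + dird b \<phi> (R n x))))
        \<le> (2 * l2norm gb + 2 * K * l2norm gv) * l2norm \<phi> + cmod (pairing g (r n))"
    using Q by (auto simp: Q_def)
  have sub: "\<forall>x. H n x \<ge> \<delta> n \<longrightarrow> x \<in> {x. h x > 0}" for n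
  proof (intro allI impI)
    fix x assume "H n x \<ge> \<delta> n"
    then have "h x > 0" using H(2)[of n x] \<delta>(2)[of n] by linarith
    then show "x \<in> {x. h x > 0}" by simp
  qed
  have [measurable]: "g \<in> borel_measurable lebesgue" "\<And>n. c n \<in> borel_measurable lebesgue" "\<And>n. r n \<in> borel_measurable lebesgue"
    using g(1) l2_measurable cr by auto
  have contd: "continuous_on UNIV (dird b \<phi>)" by (rule smooth_continuous[OF smooth_dird[OF test_smooth[OF \<phi>]]])
  have contS: "(\<lambda>x. dird b \<phi> x + dird b \<phi> (R n x)) \<in> borel_measurable lebesgue" for n
  proof (rule continuous_imp_lebesgue_measurable)
    have "continuous_on UNIV (R n)"
      unfolding R_def by (rule graph_height.cont_reflect[OF smooth_graph_height.axioms(1)[OF H(1)]])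
    then show "continuous_on UNIV (\<lambda>x. dird b \<phi> x + dird b \<phi> (R n x))"
      by (intro continuous_intros contd continuous_on_compose2[OF contd]) auto
  qed
  have contS': "(\<lambda>x. dird b \<phi> x + dird b \<phi> (reflect x)) \<in> borel_measurable lebesgue"
    by (intro continuous_imp_lebesgue_measurable continuous_intros contd continuous_on_compose2[OF contd] cont_reflect) auto
  have gB: "g x * indicator B x = g x" for x using B(2) by (auto simp: indicator_def)
  have gint: "integrable lebesgue (\<lambda>x. cmod (g x))"
    using l2_mult_integrable[OF g(1) l2_indicator_compact[OF B(1)]] by (simp add: gB integrable_norm)
  have eventually_high: "\<forall>\<^sub>F n in sequentially. H n x > 2 * \<delta> n" if "g x \<noteq> 0" for x
  proof -
    have hx: "h x > 0" using pos that not_le by blast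
    have "(\<lambda>n. (3 * K + 2) * \<epsilon> n) \<longlonglongrightarrow> (3 * K + 2) * 0" by (intro tendsto_intros \<epsilon>0)
    then have "\<forall>\<^sub>F n in sequentially. (3 * K + 2) * \<epsilon> n < h x" using hx by (simp add: order_tendsto_iff)
    then show ?thesis
    proof eventually_elim
      case (elim n)
      have "h x - K * \<epsilon> n \<le> H n x" using H(2)[of n x] by linarith
      then show ?case using elim by (simp add: \<delta>_def algebra_simps)
    qed
  qed
  have lim1: "(\<lambda>n. pairing g (\<lambda>x. c n x * (dird b \<phi> x + dird b \<phi> (R n x)))) \<longlonglongrightarrow> pairing g (\<lambda>x. dird b \<phi> x + dird b \<phi> (reflect x))"
    unfolding pairing_def
  proof (rule integral_dominated_convergence)
    show "(\<lambda>x. g x * (dird b \<phi> x + dird b \<phi> (reflect x))) \<in> borel_measurable lebesgue"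
      using contS' by measurable
    show "(\<lambda>x. g x * (c n x * (dird b \<phi> x + dird b \<phi> (R n x)))) \<in> borel_measurable lebesgue" for n
      using contS[of n] by measurable
    show "integrable lebesgue (\<lambda>x. (2 * Mb) * cmod (g x))" using gint by simp
    show "AE x in lebesgue. (\<lambda>n. g x * (c n x * (dird b \<phi> x + dird b \<phi> (R n x)))) \<longlonglongrightarrow> g x * (dird b \<phi> x + dird b \<phi> (reflect x))"
    proof (rule AE_I2)
      fix x
      show "(\<lambda>n. g x * (c n x * (dird b \<phi> x + dird b \<phi> (R n x)))) \<longlonglongrightarrow> g x * (dird b \<phi> x + dird b \<phi> (reflect x))"
      proof (cases "g x = 0")
        case False
        have "(\<lambda>n. K * \<epsilon> n) \<longlonglongrightarrow> K * 0" by (intro tendsto_intros \<epsilon>0)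
        then have "(\<lambda>n. H n x - h x) \<longlonglongrightarrow> 0"
          by (intro Lim_null_comparison[of "\<lambda>n. H n x - h x" "\<lambda>n. K * \<epsilon> n"]) (use H(2) in auto)
        then have "(\<lambda>n. H n x) \<longlonglongrightarrow> h x" by (rule LIM_zero_cancel)
        then have "(\<lambda>n. R n x) \<longlonglongrightarrow> reflect x" unfolding R reflect_def by (intro tendsto_intros)
        then have "(\<lambda>n. dird b \<phi> (R n x)) \<longlonglongrightarrow> dird b \<phi> (reflect x)"
          using continuous_on_tendsto_compose[OF contd] by simp
        moreover have "(\<lambda>n. c n x) \<longlonglongrightarrow> 1"
          by (rule tendsto_eventually) (use eventually_high[OF False] cr(3) in \<open>auto elim: eventually_mono\<close>)
        ultimately have "(\<lambda>n. g x * (c n x * (dird b \<phi> x + dird b \<phi> (R n x)))) \<longlonglongrightarrow> g x * (1 * (dird b \<phi> x + dird b \<phi> (reflect x)))"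
          by (intro tendsto_intros)
        then show ?thesis by simp
      qed simp
    qed
    show "AE x in lebesgue. norm (g x * (c n x * (dird b \<phi> x + dird b \<phi> (R n x)))) \<le> (2 * Mb) * cmod (g x)" for n
    proof (rule AE_I2)
      fix x
      have "cmod (dird b \<phi> x + dird b \<phi> (R n x)) \<le> 2 * Mb"
        using norm_triangle_ineq[of "dird b \<phi> x" "dird b \<phi> (R n x)"] Mb(2)[of x] Mb(2)[of "R n x"] by linarith
      then have "cmod (c n x) * cmod (dird b \<phi> x + dird b \<phi> (R n x)) \<le> 1 * (2 * Mb)"
        by (intro mult_mono cr(2)) auto
      then have "cmod (g x) * (cmod (c n x) * cmod (dird b \<phi> x + dird b \<phi> (R n x))) \<le> cmod (g x) * (2 * Mb)"
        by (intro mult_left_mono) auto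
      then show "norm (g x * (c n x * (dird b \<phi> x + dird b \<phi> (R n x)))) \<le> (2 * Mb) * cmod (g x)"
        by (simp add: norm_mult mult.commute)
    qed
  qed
  have lim2: "(\<lambda>n. pairing g (r n)) \<longlonglongrightarrow> (LINT x|(lebesgue :: 'a measure). (0::complex))"
    unfolding pairing_def
  proof (rule integral_dominated_convergence)
    show "integrable lebesgue (\<lambda>x. (8 * K * M) * cmod (g x))" using gint by simp
    show "AE x in lebesgue. (\<lambda>n. g x * r n x) \<longlonglongrightarrow> 0"
    proof (rule AE_I2)
      fix x
      show "(\<lambda>n. g x * r n x) \<longlonglongrightarrow> 0"
      proof (cases "g x = 0")
        case False
        show ?thesis
        proof (rule tendsto_eventually)
          show "\<forall>\<^sub>F n in sequentially. g x * r n x = 0"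
            using eventually_high[OF False] by (rule eventually_mono) (simp add: cr(6))
        qed
      qed simp
    qed
    show "AE x in lebesgue. norm (g x * r n x) \<le> (8 * K * M) * cmod (g x)" for n
    proof (rule AE_I2)
      fix x
      show "norm (g x * r n x) \<le> (8 * K * M) * cmod (g x)"
        unfolding norm_mult mult.commute[of "cmod (g x)"] by (rule mult_right_mono[OF cr(5) norm_ge_zero])
    qed
  qed measurable
  have "(\<lambda>n. cmod (pairing g (\<lambda>x. c n x * (dird b \<phi> x + dird b \<phi> (R n x))))) \<longlonglongrightarrow> cmod (pairing g (\<lambda>x. dird b \<phi> x + dird b \<phi> (reflect x)))"
    by (intro tendsto_norm lim1)
  moreover have "(\<lambda>n. (2 * l2norm gb + 2 * K * l2norm gv) * l2norm \<phi> + cmod (pairing g (r n))) \<longlonglongrightarrow>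
      (2 * l2norm gb + 2 * K * l2norm gv) * l2norm \<phi> + cmod (LINT x|(lebesgue :: 'a measure). (0::complex))"
    by (intro tendsto_intros lim2)
  ultimately show ?thesis
    using LIMSEQ_le[of _ _ _ "(2 * l2norm gb + 2 * K * l2norm gv) * l2norm \<phi> + cmod (LINT x|(lebesgue :: 'a measure). (0::complex))"]
      bnd[OF g wd sub] by fastforce
qed

text \<open>Since the reflection preserves measure, pairing the reflected function with a derivative of \<open>\<phi>\<close> amounts
  to pairing \<open>g\<close> with the reflected derivative.\<close>

lemma W1_reflection:
  assumes g: "l2 g" and wd: "\<And>b. b \<in> Basis \<Longrightarrow> \<exists>gb. l2 gb \<and> weak_dird {x. h x > 0} b g gb"
    and B: "compact B" "\<And>x. x \<notin> B \<Longrightarrow> g x = 0" and pos: "\<And>x. h x \<le> 0 \<Longrightarrow> g x = 0"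
  shows "(\<lambda>x. g x + g (reflect x)) \<in> W1 UNIV"
  unfolding W1_UNIV_iff
proof (intro conjI ballI)
  show l2F: "l2 (\<lambda>x. g x + g (reflect x))" by (intro l2_add g l2_reflect)
  obtain G where G: "\<And>b. b \<in> Basis \<Longrightarrow> l2 (G b)" "\<And>b. b \<in> Basis \<Longrightarrow> weak_dird {x. h x > 0} b g (G b)"
    using wd by metis
  define gv where "gv x = (\<Sum>b\<in>Basis. of_real (v \<bullet> b) * G b x)" for x
  have gv: "l2 gv" "weak_dird {x. h x > 0} v g gv"
    unfolding gv_def using G by (auto intro!: l2_sum l2_cmult weak_dird_any_direction g)
  fix b :: 'a assume b: "b \<in> Basis"
  have B': "compact (B \<union> reflect ` B)"
    by (intro compact_Un B compact_continuous_image continuous_on_subset[OF cont_reflect]) auto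
  obtain F where "l2 F" "weak_dird UNIV b (\<lambda>x. g x + g (reflect x)) F"
  proof (rule weak_dird_if_bounded[OF l2F B'])
    fix x assume x: "x \<notin> B \<union> reflect ` B"
    then have "reflect x \<notin> B" using reflect_involution[of x] by (metis UnI2 image_eqI)
    then show "g x + g (reflect x) = 0" using x B(2) by auto
  next
    show "2 * l2norm (G b) + 2 * K * l2norm gv \<ge> 0" using l2norm_nonneg[of "G b"] l2norm_nonneg[of gv] K_nonneg by simp
    fix \<phi> :: "'a \<Rightarrow> complex" assume \<phi>: "\<phi> \<in> test_functions UNIV"
    have d: "l2 (dird b \<phi>)" by (rule test_l2[OF test_dird[OF \<phi>]])
    have "pairing (\<lambda>x. g x + g (reflect x)) (dird b \<phi>) = pairing g (\<lambda>x. dird b \<phi> x + dird b \<phi> (reflect x))"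
      by (simp add: pairing_add_left pairing_add_right g l2_reflect[OF g] l2_reflect[OF d] d pairing_reflect)
    then show "cmod (pairing (\<lambda>x. g x + g (reflect x)) (dird b \<phi>)) \<le> (2 * l2norm (G b) + 2 * K * l2norm gv) * l2norm \<phi>"
      using reflection_bound[OF g G(1)[OF b] gv(1) G(2)[OF b] gv(2) _ B pos \<phi>] b by simp
  qed blast
  then show "\<exists>F. l2 F \<and> weak_dird UNIV b (\<lambda>x. g x + g (reflect x)) F" by blast
qed

end

lemma lipschitz_graph_height:
  fixes v :: "'a::euclidean_space"
  assumes v: "norm v = 1" and \<psi>: "C-lipschitz_on {y. y \<bullet> v = 0} \<psi>"
  shows "graph_height (\<lambda>x. \<psi> (x - (x \<bullet> v) *\<^sub>R v) - x \<bullet> v) v (C + 1)"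
proof
  have vv: "v \<bullet> v = 1" using v by (simp add: dot_square_norm)
  show "norm v = 1" by (rule v)
  show "(C + 1)-lipschitz_on UNIV (\<lambda>x. \<psi> (x - (x \<bullet> v) *\<^sub>R v) - x \<bullet> v)"
  proof (rule lipschitz_onI)
    have C: "C \<ge> 0" using \<psi> lipschitz_on_nonneg by blast
    then show "0 \<le> C + 1" by simp
    fix x y :: 'a
    let ?P = "\<lambda>x. x - (x \<bullet> v) *\<^sub>R v"
    have "?P x - ?P y = ?P (x - y)" by (simp add: inner_diff_left algebra_simps)
    moreover have "norm (?P z) \<le> norm z" for z
    proof -
      have "(norm (?P z))\<^sup>2 = (norm z)\<^sup>2 - (z \<bullet> v)\<^sup>2"
        unfolding power2_norm_eq_inner by (simp add: inner_diff_left inner_diff_right vv inner_commute power2_eq_square)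
      then have "(norm (?P z))\<^sup>2 \<le> (norm z)\<^sup>2" by simp
      then show ?thesis by (rule power2_le_imp_le) (rule norm_ge_zero)
    qed
    ultimately have "dist (?P x) (?P y) \<le> dist x y" by (metis dist_norm)
    moreover have "dist (\<psi> (?P x)) (\<psi> (?P y)) \<le> C * dist (?P x) (?P y)"
      by (rule lipschitz_onD[OF \<psi>]) (simp_all add: inner_diff_left vv)
    ultimately have "dist (\<psi> (?P x)) (\<psi> (?P y)) \<le> C * dist x y"
      using C by (meson mult_left_mono order_trans)
    moreover have "\<bar>x \<bullet> v - y \<bullet> v\<bar> \<le> dist x y"
      using Cauchy_Schwarz_ineq2[of "x - y" v] v by (simp add: inner_diff_left dist_norm)
    ultimately show "dist (\<psi> (?P x) - x \<bullet> v) (\<psi> (?P y) - y \<bullet> v) \<le> (C + 1) * dist x y"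
      by (simp add: dist_real_def distrib_right)
  qed
  fix x t
  have "x + t *\<^sub>R v - ((x + t *\<^sub>R v) \<bullet> v) *\<^sub>R v = x - (x \<bullet> v) *\<^sub>R v"
    by (simp add: inner_add_left vv algebra_simps)
  then show "\<psi> (x + t *\<^sub>R v - ((x + t *\<^sub>R v) \<bullet> v) *\<^sub>R v) - (x + t *\<^sub>R v) \<bullet> v = \<psi> (x - (x \<bullet> v) *\<^sub>R v) - x \<bullet> v - t"
    by (simp only:) (simp add: inner_add_left vv)
qed

lemma lipschitz_boundary_height:
  fixes V :: "'a::euclidean_space set"
  assumes "lipschitz_boundary V" "p \<in> frontier V"
  obtains r h v K where "r > 0" "graph_height h v K" "V \<inter> ball p r = {x \<in> ball p r. h x > 0}"
proof -
  obtain r v \<psi> C where "r > 0" "norm v = 1" "C-lipschitz_on {y. y \<bullet> v = 0} \<psi>"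
    and V: "V \<inter> ball p r = {x \<in> ball p r. x \<bullet> v < \<psi> (x - (x \<bullet> v) *\<^sub>R v)}"
    using assms(1)[unfolded lipschitz_boundary_def, rule_format, OF assms(2)] by blast
  then have "graph_height (\<lambda>x. \<psi> (x - (x \<bullet> v) *\<^sub>R v) - x \<bullet> v) v (C + 1)"
    by (intro lipschitz_graph_height)
  moreover have "V \<inter> ball p r = {x \<in> ball p r. \<psi> (x - (x \<bullet> v) *\<^sub>R v) - x \<bullet> v > 0}"
    unfolding V by auto
  ultimately show thesis using that[OF \<open>r > 0\<close>] by blast
qed

lemma negligible_lipschitz_frontier:
  fixes V :: "'a::euclidean_space set"
  assumes V: "open V" "bounded V" "lipschitz_boundary V"
  shows "frontier V \<in> null_sets lebesgue"
proof -
  have "\<exists>r>0. frontier V \<inter> ball p r \<in> null_sets lebesgue" if p: "p \<in> frontier V" for p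
  proof -
    obtain r h v K where r: "r > 0" and gh: "graph_height h v K" and eq: "V \<inter> ball p r = {x \<in> ball p r. h x > 0}"
      using lipschitz_boundary_height[OF V(3) p] by metis
    interpret graph_height h v K by fact
    have "frontier V \<inter> ball p r \<subseteq> {x. h x = 0}"
    proof
      fix x assume x: "x \<in> frontier V \<inter> ball p r"
      have "\<not> h x > 0"
      proof
        assume "h x > 0"
        then have "x \<in> V" using eq x by blast
        then show False using x V(1) by (simp add: frontier_def interior_open)
      qed
      moreover have "\<not> h x < 0"
      proof
        assume neg: "h x < 0"
        have "open (ball p r \<inter> {y. h y < 0})" by (intro open_Int open_ball open_Collect_less cont_h continuous_intros)
        moreover have "x \<in> ball p r \<inter> {y. h y < 0}" using x neg by simp
        moreover have "x \<in> closure V" using x by (simp add: frontier_def)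
        ultimately obtain y where "y \<in> V" "y \<in> ball p r" "h y < 0"
          using open_Int_closure_eq_empty[of "ball p r \<inter> {y. h y < 0}" V] by blast
        then show False using eq by force
      qed
      ultimately show "x \<in> {x. h x = 0}" by simp
    qed
    moreover have "frontier V \<inter> ball p r \<in> sets lebesgue" by simp
    ultimately show ?thesis using r null_sets_subset[OF level_null] by blast
  qed
  then obtain r where r: "\<And>p. p \<in> frontier V \<Longrightarrow> r p > 0 \<and> frontier V \<inter> ball p (r p) \<in> null_sets lebesgue" by metis
  have "compact (frontier V)" using V(2) by (simp add: compact_frontier_bounded)
  then obtain P where P: "P \<subseteq> frontier V" "finite P" "frontier V \<subseteq> (\<Union>p\<in>P. ball p (r p))"
    by (rule compactE_image[of _ "frontier V" "\<lambda>p. ball p (r p)"]) (use r in force)+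
  have "(\<Union>p\<in>P. frontier V \<inter> ball p (r p)) \<in> null_sets lebesgue"
    using P r by (intro null_sets.finite_UN) auto
  moreover have "frontier V = (\<Union>p\<in>P. frontier V \<inter> ball p (r p))" using P(3) by blast
  ultimately show ?thesis by simp
qed

section \<open>Extension of Sobolev functions from Lipschitz domains\<close>

lemma W1_UNIV_test_mult:
  assumes "F \<in> W1 UNIV" "\<theta> \<in> test_functions UNIV" shows "(\<lambda>x. \<theta> x * F x) \<in> W1 UNIV"
  unfolding W1_UNIV_iff
proof (intro conjI ballI)
  have F: "l2 F" using assms(1) by (simp add: W1_UNIV_iff)
  show "l2 (\<lambda>x. \<theta> x * F x)"
    using test_bounded[OF assms(2)] l2_bounded_mult[OF F test_measurable[OF assms(2)]] by metis
  fix v :: 'a assume "v \<in> Basis"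
  then obtain G where G: "l2 G" "weak_dird UNIV v F G" using assms(1) by (auto simp: W1_UNIV_iff)
  show "\<exists>g. l2 g \<and> weak_dird UNIV v (\<lambda>x. \<theta> x * F x) g"
    using weak_dird_cutoff(2,3)[OF G(2) F G(1) assms(2)] by blast
qed

text \<open>Near a point of the frontier the cut off function is reflected across the local graph. Its mirror
  image may meet \<open>V\<close> away from the ball, where the graph no longer describes \<open>V\<close>; a second cutoff
  removes that part.\<close>

lemma local_extension:
  fixes V :: "'a::euclidean_space set"
  assumes V: "open V" "lipschitz_boundary V" and u: "u \<in> W1 V" and p: "p \<in> closure V"
  shows "\<exists>r>0. \<forall>\<theta>\<in>test_functions (ball p r). \<exists>F\<in>W1 UNIV. \<forall>x\<in>V. F x = \<theta> x * u x"
proof -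
  let ?u = "zero_ext V u"
  have l2u: "l2 ?u" and wdu: "\<And>b. b \<in> Basis \<Longrightarrow> \<exists>g. l2 g \<and> weak_dird V b ?u g"
    using u by (auto simp: W1_iff[OF V(1)])
  show ?thesis
  proof (cases "p \<in> V")
    case True
    then obtain r where r: "r > 0" "ball p r \<subseteq> V" using V(1) openE by blast
    have "\<exists>F\<in>W1 UNIV. \<forall>x\<in>V. F x = \<theta> x * u x" if "\<theta> \<in> test_functions (ball p r)" for \<theta>
    proof (intro bexI[of _ "\<lambda>x. \<theta> x * ?u x"])
      have \<theta>: "\<theta> \<in> test_functions V" by (rule test_mono[OF that r(2)])
      show "(\<lambda>x. \<theta> x * ?u x) \<in> W1 UNIV"
        unfolding W1_UNIV_iff
      proof (intro conjI ballI)
        show "l2 (\<lambda>x. \<theta> x * ?u x)"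
          using test_bounded[OF \<theta>] l2_bounded_mult[OF l2u test_measurable[OF \<theta>]] by metis
        fix b :: 'a assume "b \<in> Basis"
        then obtain g where g: "l2 g" "weak_dird V b ?u g" using wdu by blast
        show "\<exists>g. l2 g \<and> weak_dird UNIV b (\<lambda>x. \<theta> x * ?u x) g"
          using weak_dird_cutoff(2,3)[OF g(2) l2u g(1) \<theta>] by blast
      qed
    qed (simp add: zero_ext_def)
    then show ?thesis using r(1) by blast
  next
    case False
    then have "p \<in> frontier V" using p V(1) by (simp add: frontier_def interior_open)
    then obtain r h v K where r: "r > 0" and gh: "graph_height h v K" and eq: "V \<inter> ball p r = {x \<in> ball p r. h x > 0}"
      using lipschitz_boundary_height[OF V(2)] by metis
    interpret graph_height h v K by fact
    have "\<exists>F\<in>W1 UNIV. \<forall>x\<in>V. F x = \<theta> x * u x" if \<theta>: "\<theta> \<in> test_functions (ball p r)" for \<theta>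
    proof -
      obtain B where B: "compact B" "B \<subseteq> ball p r" "\<And>x. x \<notin> B \<Longrightarrow> \<theta> x = 0"
        using \<theta> by (auto elim: test_functionsE)
      define g where "g x = \<theta> x * ?u x" for x
      have W: "(\<lambda>x. g x + g (reflect x)) \<in> W1 UNIV"
      proof (rule W1_reflection)
        show "l2 g"
          unfolding g_def using test_bounded[OF \<theta>] l2_bounded_mult[OF l2u test_measurable[OF \<theta>]] by metis
        show "\<exists>gb. l2 gb \<and> weak_dird {x. 0 < h x} b g gb" if b: "b \<in> Basis" for b
        proof -
          obtain f where f: "l2 f" "weak_dird V b ?u f" using wdu[OF b] by blast
          have sub: "{x. h x > 0} \<inter> ball p r \<subseteq> V" using eq by blast
          show ?thesis
            unfolding g_def using weak_dird_localize(2,3)[OF f(2) l2u f(1) \<theta> sub] by blast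
        qed
        show "compact B" by (rule B(1))
        show "g x = 0" if "x \<notin> B" for x using B(3)[OF that] by (simp add: g_def)
        show "g x = 0" if "h x \<le> 0" for x
        proof (cases "x \<in> B \<and> x \<in> V")
          case True
          then have "x \<in> V \<inter> ball p r" using B(2) by blast
          then have "h x > 0" unfolding eq by simp
          then show ?thesis using that by simp
        next
          case False
          then show ?thesis using B(3) by (auto simp: g_def zero_ext_def)
        qed
      qed
      obtain \<theta>' W where \<theta>': "\<theta>' \<in> test_functions (ball p r)" "B \<subseteq> W" "\<And>x. x \<in> W \<Longrightarrow> \<theta>' x = 1"
        using exists_test_cutoff[OF B(1) open_ball B(2)] by metis
      have "(\<lambda>x. \<theta>' x * (g x + g (reflect x))) \<in> W1 UNIV"
        by (rule W1_UNIV_test_mult[OF W test_mono[OF \<theta>'(1)]]) simp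
      moreover have "\<theta>' x * (g x + g (reflect x)) = \<theta> x * u x" if "x \<in> V" for x
      proof (cases "x \<in> ball p r")
        case True
        then have "x \<in> V \<inter> ball p r" using that by blast
        then have "h x > 0" unfolding eq by simp
        then have "h (reflect x) \<le> 0" by (simp add: h_reflect)
        have "g (reflect x) = 0"
        proof (cases "reflect x \<in> B \<and> reflect x \<in> V")
          case True
          then have "reflect x \<in> V \<inter> ball p r" using B(2) by blast
          then have "h (reflect x) > 0" unfolding eq by simp
          then show ?thesis using \<open>h (reflect x) \<le> 0\<close> by simp
        next
          case False
          then show ?thesis using B(3) by (auto simp: g_def zero_ext_def)
        qed
        moreover have "\<theta>' x * \<theta> x = \<theta> x" using \<theta>'(2,3) B(3) by (cases "x \<in> B") auto
        ultimately have "\<theta>' x * (g x + g (reflect x)) = \<theta> x * ?u x"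
          unfolding g_def by (simp only: add_0_right mult.assoc[symmetric])
        then show ?thesis using that by (simp add: zero_ext_def)
      next
        case False
        then have "\<theta>' x = 0" "\<theta> x = 0"
          using test_zero_outside[OF \<theta>'(1), of x] test_zero_outside[OF \<theta>, of x] by blast+
        then show ?thesis by simp
      qed
      ultimately show ?thesis by (intro bexI[of _ "\<lambda>x. \<theta>' x * (g x + g (reflect x))"]) blast+
    qed
    then show ?thesis using r by blast
  qed
qed

text \<open>Finitely many local extensions are glued by cutoffs \<open>b p\<close> that equal one on smaller balls. The
  products \<open>b q * (\<Prod>p\<in>Q. 1 - b p)\<close> telescope to \<open>1 - (\<Prod>p\<in>P. 1 - b p)\<close>, which is one on the
  closure of \<open>V\<close>.\<close>

lemma W1_extension:
  fixes V :: "'a::euclidean_space set"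
  assumes V: "open V" "bounded V" "lipschitz_boundary V" and u: "u \<in> W1 V"
  obtains F where "F \<in> W1 UNIV" "\<And>x. x \<in> V \<Longrightarrow> F x = u x"
proof -
  obtain r where r: "\<And>p. p \<in> closure V \<Longrightarrow> r p > 0"
    "\<And>p \<theta>. p \<in> closure V \<Longrightarrow> \<theta> \<in> test_functions (ball p (r p)) \<Longrightarrow> \<exists>F\<in>W1 UNIV. \<forall>x\<in>V. F x = \<theta> x * u x"
    using local_extension[OF V(1,3) u] by metis
  have "\<forall>p\<in>closure V. \<exists>\<theta>. \<theta> \<in> test_functions (ball p (r p)) \<and> (\<forall>x\<in>cball p (r p / 2). \<theta> x = 1)"
  proof
    fix p assume p: "p \<in> closure V"
    have "cball p (r p / 2) \<subseteq> ball p (r p)" using r(1)[OF p] by (auto simp: dist_norm)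
    then show "\<exists>\<theta>. \<theta> \<in> test_functions (ball p (r p)) \<and> (\<forall>x\<in>cball p (r p / 2). \<theta> x = 1)"
      using exists_test_cutoff[OF compact_cball open_ball] by (metis subsetD)
  qed
  then obtain b where b: "\<And>p. p \<in> closure V \<Longrightarrow> b p \<in> test_functions (ball p (r p))"
    "\<And>p x. p \<in> closure V \<Longrightarrow> x \<in> cball p (r p / 2) \<Longrightarrow> b p x = 1" by metis
  have "compact (closure V)" using V(2) by simp
  then obtain P where P: "P \<subseteq> closure V" "finite P" "closure V \<subseteq> (\<Union>p\<in>P. ball p (r p / 2))"
    by (rule compactE_image[of _ "closure V" "\<lambda>p. ball p (r p / 2)"]) (use r(1) in force)+
  have "smooth (\<lambda>x. \<Prod>p\<in>Q. 1 - b p x) \<and> (\<exists>F\<in>W1 UNIV. \<forall>x\<in>V. F x = (1 - (\<Prod>p\<in>Q. 1 - b p x)) * u x)"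
    if "finite Q" "Q \<subseteq> closure V" for Q
    using that
  proof (induction Q rule: finite_induct)
    case empty
    show ?case by (auto intro!: smooth_const bexI[of _ "\<lambda>x. 0"] W1_UNIV_zero)
  next
    case (insert q Q)
    then have q: "q \<in> closure V" and IH: "smooth (\<lambda>x. \<Prod>p\<in>Q. 1 - b p x)"
      and "\<exists>F\<in>W1 UNIV. \<forall>x\<in>V. F x = (1 - (\<Prod>p\<in>Q. 1 - b p x)) * u x" by auto
    then obtain F where F: "F \<in> W1 UNIV" "\<And>x. x \<in> V \<Longrightarrow> F x = (1 - (\<Prod>p\<in>Q. 1 - b p x)) * u x" by blast
    have "(\<lambda>x. (\<Prod>p\<in>Q. 1 - b p x) * b q x) \<in> test_functions (ball q (r q))"
      by (rule test_mult[OF b(1)[OF q] IH])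
    then obtain G where G: "G \<in> W1 UNIV" "\<And>x. x \<in> V \<Longrightarrow> G x = (\<Prod>p\<in>Q. 1 - b p x) * b q x * u x"
      using r(2)[OF q] by blast
    have "smooth (\<lambda>x. (1 - b q x) * (\<Prod>p\<in>Q. 1 - b p x))"
      by (intro smooth_mult smooth_minus smooth_const test_smooth[OF b(1)[OF q]] IH)
    moreover have "F x + G x = (1 - (1 - b q x) * (\<Prod>p\<in>Q. 1 - b p x)) * u x" if "x \<in> V" for x
      using F(2)[OF that] G(2)[OF that] by (simp add: algebra_simps)
    ultimately show ?case
      using insert.hyps W1_UNIV_add[OF F(1) G(1)] by (auto intro!: bexI[of _ "\<lambda>x. F x + G x"])
  qed
  from this[OF P(2,1)] obtain F where F: "F \<in> W1 UNIV" "\<And>x. x \<in> V \<Longrightarrow> F x = (1 - (\<Prod>p\<in>P. 1 - b p x)) * u x" by blast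
  have "(\<Prod>p\<in>P. 1 - b p x) = 0" if x: "x \<in> V" for x
  proof -
    obtain p where "p \<in> P" "x \<in> ball p (r p / 2)" using P(3) x closure_subset by blast
    then have "1 - b p x = 0" using b(2)[of p x] P(1) by auto
    then show ?thesis using P(2) \<open>p \<in> P\<close> by (metis prod_zero)
  qed
  then show thesis using that[OF F(1)] F(2) by simp
qed

section \<open>The Mayer-Vietoris argument\<close>

lemma W1_l2: "f \<in> W1 UNIV \<Longrightarrow> l2 f"
  by (simp add: W1_UNIV_iff)

lemma W1_restrict:
  assumes "f \<in> W1 UNIV" "open V" shows "f \<in> W1 V"
  unfolding W1_iff[OF assms(2)]
proof (intro conjI ballI)
  show "l2 (zero_ext V f)" using W1_l2[OF assms(1)] assms(2) by (intro l2_zero_ext) auto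
  fix v :: 'a assume "v \<in> Basis"
  then obtain g where g: "l2 g" "weak_dird UNIV v f g" using assms(1) by (auto simp: W1_UNIV_iff)
  have "weak_dird V v (zero_ext V f) g"
    unfolding weak_dird_def
  proof
    fix \<phi> :: "'a \<Rightarrow> complex" assume \<phi>: "\<phi> \<in> test_functions V"
    show "pairing (zero_ext V f) (dird v \<phi>) = - pairing g \<phi>"
      using g(2) test_mono[OF \<phi>, of UNIV] by (simp add: pairing_zero_ext_test[OF test_dird[OF \<phi>]] weak_dird_def)
  qed
  then show "\<exists>g. l2 g \<and> weak_dird V v (zero_ext V f) g" using g(1) by blast
qed

lemma W1_forms_L2: "f \<in> W1_forms p q UNIV \<Longrightarrow> f \<in> L2_forms p q UNIV"
  by (auto simp: W1_forms_def L2_forms_def L2_UNIV_iff W1_l2)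

lemma weak_dbar_lincomb:
  fixes f :: "'n::{finite,linorder} form"
  assumes "weak_dbar p q UNIV f h" "weak_dbar p q UNIV f' h'"
    and f: "f \<in> L2_forms p q UNIV" "f' \<in> L2_forms p q UNIV"
    and h: "h \<in> L2_forms p (Suc q) UNIV" "h' \<in> L2_forms p (Suc q) UNIV"
  shows "weak_dbar p q UNIV (\<lambda>I J x. f I J x + c * f' I J x) (\<lambda>I J x. h I J x + c * h' I J x)"
proof -
  have U: "UNIV \<in> sets lebesgue" by simp
  show ?thesis
    unfolding weak_dbar_iff[OF U]
  proof (intro allI impI ballI)
    fix I L :: "'n set" and \<phi> :: "complex^('n::{finite,linorder}) \<Rightarrow> complex"
    assume IL: "card I = p \<and> card L = Suc q" and \<phi>: "\<phi> \<in> test_functions UNIV"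
    note d = assms(1,2)[unfolded weak_dbar_iff[OF U], rule_format, OF IL \<phi>]
    have l2f: "l2 (f I (L - {k}))" "l2 (f' I (L - {k}))" if "k \<in> L" for k
      using f IL that by (auto simp: L2_forms_def L2_UNIV_iff)
    have l2h: "l2 (h I L)" "l2 (h' I L)" using h IL by (auto simp: L2_forms_def L2_UNIV_iff)
    let ?s = "\<lambda>k. (-1) ^ (p + card {l\<in>L. l < k}) :: complex"
    have "(\<Sum>k\<in>L. ?s k * pairing (\<lambda>x. f I (L - {k}) x + c * f' I (L - {k}) x) (zbar_derivative k \<phi>)) =
       (\<Sum>k\<in>L. ?s k * pairing (f I (L - {k})) (zbar_derivative k \<phi>) + c * (?s k * pairing (f' I (L - {k})) (zbar_derivative k \<phi>)))"
      by (intro sum.cong refl, subst pairing_add_left)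
         (auto intro: l2f l2_cmult test_l2[OF test_zbar[OF \<phi>]] simp: pairing_cmult_left distrib_left)
    also have "\<dots> = - pairing (h I L) \<phi> + c * (- pairing (h' I L) \<phi>)"
      unfolding sum.distrib sum_distrib_left[symmetric] d ..
    also have "\<dots> = - pairing (\<lambda>x. h I L x + c * h' I L x) \<phi>"
      by (simp add: pairing_add_left l2h l2_cmult test_l2[OF \<phi>] pairing_cmult_left)
    finally show "(\<Sum>k\<in>L. ?s k * pairing (\<lambda>x. f I (L - {k}) x + c * f' I (L - {k}) x) (zbar_derivative k \<phi>)) =
      - pairing (\<lambda>x. h I L x + c * h' I L x) \<phi>" .
  qed
qed

lemma form_eq_onD:
  "form_eq_on p q S f g \<Longrightarrow> card I = p \<Longrightarrow> card J = q \<Longrightarrow> AE x in lebesgue. x \<in> S \<longrightarrow> f I J x = g I J x"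
  by (simp add: form_eq_on_def)

lemma W1_forms_lincomb:
  "f \<in> W1_forms p q UNIV \<Longrightarrow> g \<in> W1_forms p q UNIV \<Longrightarrow> (\<lambda>I J x. f I J x + c * g I J x) \<in> W1_forms p q UNIV"
  by (auto simp: W1_forms_def intro!: W1_UNIV_add W1_UNIV_cmult)

lemma L2_forms_lincomb:
  "f \<in> L2_forms p q UNIV \<Longrightarrow> g \<in> L2_forms p q UNIV \<Longrightarrow> (\<lambda>I J x. f I J x + c * g I J x) \<in> L2_forms p q UNIV"
  by (auto simp: L2_forms_def L2_UNIV_iff intro!: l2_add l2_cmult)

lemma solve_top_degree_dbar:
  fixes H :: "complex^('n::{finite,linorder}) \<Rightarrow> complex"
  assumes H: "l2 H"
  obtains \<omega> h where "\<omega> \<in> W1_forms 0 (CARD('n) - 1) UNIV" "h \<in> L2_forms 0 (Suc (CARD('n) - 1)) UNIV"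
    "weak_dbar 0 (CARD('n) - 1) UNIV \<omega> h" "AE x in lebesgue. x \<in> ball 0 R \<longrightarrow> h {} UNIV x = H x"
proof -
  define q where "q = CARD('n) - 1"
  have q: "Suc q = CARD('n)" unfolding q_def by simp
  define s :: "'n \<Rightarrow> complex" where "s k = (-1) ^ card {l. l < k}" for k
  have ss: "s k * s k = 1" for k by (simp add: s_def power_mult_distrib[symmetric])
  obtain w where w: "\<And>k. w k \<in> W1 UNIV"
    "\<And>\<phi>. \<phi> \<in> test_functions (ball 0 R) \<Longrightarrow> (\<Sum>k\<in>UNIV. s k * pairing (w k) (zbar_derivative k \<phi>)) = - pairing H \<phi>"
    using top_degree_dbar[where s=s and R=R, OF H ss] by blast
  \<comment> \<open>a set \<open>J\<close> of \<open>n - 1\<close> indices is named by the one index that it misses\<close>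
  define \<omega> :: "'n form" where "\<omega> I J = w (the_elem (UNIV - J))" for I J
  have W: "\<omega> \<in> W1_forms 0 q UNIV" using w(1) by (simp add: W1_forms_def \<omega>_def)
  obtain h where h: "h \<in> L2_forms 0 (Suc q) UNIV" "weak_dbar 0 q UNIV \<omega> h"
    using W1_forms_dbar[OF W] by blast
  have b: "ball (0::complex^('n::{finite,linorder})) R \<in> sets lebesgue" by simp
  have "AE x in lebesgue. x \<in> ball 0 R \<longrightarrow> h {} UNIV x = H x"
  proof (rule pairing_eq_imp_AE_eq[OF open_ball _ H])
    show "l2 (h {} UNIV)" using h(1) q by (auto simp: L2_forms_def L2_UNIV_iff)
    fix \<phi> assume \<phi>: "\<phi> \<in> test_functions (ball (0::complex^('n::{finite,linorder})) R)"
    have "weak_dbar 0 q (ball 0 R) \<omega> h" by (rule weak_dbar_mono[OF h(2)]) auto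
    moreover have "card {} = 0 \<and> card (UNIV :: 'n set) = Suc q" using q by simp
    ultimately have "(\<Sum>k\<in>UNIV. (-1) ^ (0 + card {l\<in>UNIV. l < k}) * pairing (\<omega> {} (UNIV - {k})) (zbar_derivative k \<phi>)) = - pairing (h {} UNIV) \<phi>"
      using \<phi> unfolding weak_dbar_iff[OF b] by blast
    moreover have "\<omega> {} (UNIV - {k}) = w k" for k
    proof -
      have "UNIV - (UNIV - {k}) = {k}" by auto
      then show ?thesis by (simp add: \<omega>_def)
    qed
    ultimately have "(\<Sum>k\<in>UNIV. s k * pairing (w k) (zbar_derivative k \<phi>)) = - pairing (h {} UNIV) \<phi>"
      by (simp add: s_def)
    then show "pairing (h {} UNIV) \<phi> = pairing H \<phi>" using w(2)[OF \<phi>] by simp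
  qed
  then show thesis using that W h unfolding q_def by blast
qed

lemma dbar_eq_on_top_zeroI:
  fixes h :: "'n::{finite,linorder} form"
  assumes "h \<in> L2_forms 0 (Suc (CARD('n) - 1)) UNIV" "weak_dbar 0 (CARD('n) - 1) UNIV f h"
    "AE x in lebesgue. x \<in> S \<longrightarrow> h {} UNIV x = 0"
  shows "dbar_eq_on 0 (CARD('n) - 1) S f form_zero"
proof -
  have "L = UNIV" if "card L = Suc (CARD('n) - 1)" for L :: "'n set"
    using that by (simp add: card_eq_UNIV_imp_eq_UNIV)
  then have "form_eq_on 0 (Suc (CARD('n) - 1)) S h form_zero"
    using assms(3) by (auto simp: form_eq_on_def form_zero_def)
  then show ?thesis using assms(1,2) unfolding dbar_eq_on_def by blast
qed

text \<open>The dbar of a form of degree \<open>(0,n-1)\<close> has top degree, so it may be cut off along \<open>K2\<close> and still be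
  a dbar.\<close>

lemma Mayer_Vietoris_vanishing:
  fixes K1 K2 :: "(complex^('n::{finite,linorder})) set"
  assumes n: "CARD('n) \<ge> 2" and bdd: "bounded K1" "bounded K2" and meas: "K2 \<in> sets lebesgue"
    and v1: "compact_W1_cohomology_vanishes 0 (CARD('n) - 1) K1"
    and v2: "compact_W1_cohomology_vanishes 0 (CARD('n) - 1) K2"
  shows "compact_W1_cohomology_vanishes 0 (CARD('n) - 1) (K1 \<inter> K2)"
proof -
  define q where "q = CARD('n) - 1"
  have q: "q \<noteq> 0" "Suc q = CARD('n)" "Suc (q - 1) = q" using n by (auto simp: q_def)
  have solve: "\<exists>u\<in>W1_forms 0 (q - 1) UNIV. dbar_eq_on 0 (q - 1) K' u f"
    if "compact_W1_cohomology_vanishes 0 q K'" "f \<in> W1_forms 0 q UNIV" "dbar_eq_on 0 q K' f form_zero" for K' and f :: "'n form"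
    using that q(1) by (simp add: compact_W1_cohomology_vanishes_def)
  obtain R where R: "K1 \<union> K2 \<subseteq> ball 0 R" using bdd by (metis bounded_Un bounded_subset_ballD)
  have "\<exists>u\<in>W1_forms 0 (q - 1) UNIV. dbar_eq_on 0 (q - 1) (K1 \<inter> K2) u f"
    if f: "f \<in> W1_forms 0 q UNIV" and "dbar_eq_on 0 q (K1 \<inter> K2) f form_zero" for f :: "'n form"
  proof -
    obtain h where h: "h \<in> L2_forms 0 (Suc q) UNIV" "weak_dbar 0 q UNIV f h" "form_eq_on 0 (Suc q) (K1 \<inter> K2) h form_zero"
      using \<open>dbar_eq_on 0 q (K1 \<inter> K2) f form_zero\<close> unfolding dbar_eq_on_def by blast
    have h0: "AE x in lebesgue. x \<in> K1 \<inter> K2 \<longrightarrow> h {} UNIV x = 0"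
      using form_eq_onD[OF h(3), of "{}" UNIV] q by (simp add: form_zero_def)
    have l2h: "l2 (h {} UNIV)" using h(1) q by (auto simp: L2_forms_def L2_UNIV_iff)
    define H where "H = zero_ext (- K2) (h {} UNIV)"
    have "- K2 \<in> sets lebesgue" using meas by (rule Compl_in_sets_lebesgue[THEN iffD2])
    then have "l2 H" unfolding H_def by (rule l2_zero_ext[OF l2h])
    then obtain \<omega> h\<omega> where \<omega>: "\<omega> \<in> W1_forms 0 q UNIV" "h\<omega> \<in> L2_forms 0 (Suc q) UNIV" "weak_dbar 0 q UNIV \<omega> h\<omega>"
      and h\<omega>: "AE x in lebesgue. x \<in> ball 0 R \<longrightarrow> h\<omega> {} UNIV x = H x"
      unfolding q_def by (rule solve_top_degree_dbar[where R=R])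
    have "AE x in lebesgue. x \<in> K2 \<longrightarrow> h\<omega> {} UNIV x = 0"
      using h\<omega> by eventually_elim (use R in \<open>auto simp: H_def zero_ext_def\<close>)
    then have "dbar_eq_on 0 q K2 \<omega> form_zero"
      using dbar_eq_on_top_zeroI \<omega>(2,3) unfolding q_def by blast
    then obtain u2 where u2: "u2 \<in> W1_forms 0 (q - 1) UNIV" "dbar_eq_on 0 (q - 1) K2 u2 \<omega>"
      using solve[OF _ \<omega>(1), of K2] v2 unfolding q_def by blast
    define f1 :: "'n form" where "f1 = (\<lambda>I J x. f I J x + (-1) * \<omega> I J x)"
    have f1: "f1 \<in> W1_forms 0 q UNIV" unfolding f1_def by (rule W1_forms_lincomb[OF f \<omega>(1)])
    have d1: "weak_dbar 0 q UNIV f1 (\<lambda>I J x. h I J x + (-1) * h\<omega> I J x)"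
      unfolding f1_def by (rule weak_dbar_lincomb[OF h(2) \<omega>(3) W1_forms_L2[OF f] W1_forms_L2[OF \<omega>(1)] h(1) \<omega>(2)])
    have "AE x in lebesgue. x \<in> K1 \<longrightarrow> h {} UNIV x + (-1) * h\<omega> {} UNIV x = 0"
      using h0 h\<omega> by eventually_elim (use R in \<open>auto simp: H_def zero_ext_def split: if_splits\<close>)
    then have "dbar_eq_on 0 q K1 f1 form_zero"
      using dbar_eq_on_top_zeroI[of "\<lambda>I J x. h I J x + (-1) * h\<omega> I J x"] d1 L2_forms_lincomb[OF h(1) \<omega>(2)]
      unfolding q_def by blast
    then obtain u1 where u1: "u1 \<in> W1_forms 0 (q - 1) UNIV" "dbar_eq_on 0 (q - 1) K1 u1 f1"
      using solve[OF _ f1, of K1] v1 unfolding q_def by blast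
    obtain h1 where h1: "h1 \<in> L2_forms 0 (Suc (q - 1)) UNIV" "weak_dbar 0 (q - 1) UNIV u1 h1" "form_eq_on 0 (Suc (q - 1)) K1 h1 f1"
      using u1(2) unfolding dbar_eq_on_def by blast
    obtain h2 where h2: "h2 \<in> L2_forms 0 (Suc (q - 1)) UNIV" "weak_dbar 0 (q - 1) UNIV u2 h2" "form_eq_on 0 (Suc (q - 1)) K2 h2 \<omega>"
      using u2(2) unfolding dbar_eq_on_def by blast
    have "form_eq_on 0 (Suc (q - 1)) (K1 \<inter> K2) (\<lambda>I J x. h1 I J x + 1 * h2 I J x) f"
      unfolding form_eq_on_def
    proof (intro allI impI)
      fix I J :: "'n set" assume IJ: "card I = 0 \<and> card J = Suc (q - 1)"
      have "AE x in lebesgue. x \<in> K1 \<longrightarrow> h1 I J x = f1 I J x" "AE x in lebesgue. x \<in> K2 \<longrightarrow> h2 I J x = \<omega> I J x"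
        using form_eq_onD[OF h1(3)] form_eq_onD[OF h2(3)] IJ by blast+
      then show "AE x in lebesgue. x \<in> K1 \<inter> K2 \<longrightarrow> h1 I J x + 1 * h2 I J x = f I J x"
        by eventually_elim (auto simp: f1_def)
    qed
    moreover have "weak_dbar 0 (q - 1) UNIV (\<lambda>I J x. u1 I J x + 1 * u2 I J x) (\<lambda>I J x. h1 I J x + 1 * h2 I J x)"
      by (rule weak_dbar_lincomb[OF h1(2) h2(2) W1_forms_L2[OF u1(1)] W1_forms_L2[OF u2(1)] h1(1) h2(1)])
    ultimately have "dbar_eq_on 0 (q - 1) (K1 \<inter> K2) (\<lambda>I J x. u1 I J x + 1 * u2 I J x) f"
      unfolding dbar_eq_on_def using L2_forms_lincomb[OF h1(1) h2(1), of 1] by blast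
    then show ?thesis using W1_forms_lincomb[OF u1(1) u2(1), of 1] by blast
  qed
  then show ?thesis
    using q(1) unfolding compact_W1_cohomology_vanishes_def q_def[symmetric] by simp
qed

lemma form_zero_W1: "form_zero \<in> W1_forms p q U"
proof -
  have "(\<lambda>x. 0) \<in> W1 U"
  proof -
    have z: "(\<lambda>x. 0) \<in> L2 U" by (simp add: L2_def)
    show ?thesis unfolding W1_def weak_derivative_def using z by (auto intro!: bexI[OF _ z])
  qed
  then show ?thesis by (simp add: W1_forms_def form_zero_def)
qed

lemma weak_dbar_zero: "weak_dbar p q U form_zero form_zero"
  by (simp add: weak_dbar_def form_zero_def)

text \<open>The class of \<open>f\<close> and the class of zero are the same element of the quotient.\<close>

lemma cocycle_is_coboundary:
  assumes "W1_cohomology_vanishes p q U" "q \<noteq> 0" "f \<in> W1_cocycles p q U"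
  shows "\<exists>g\<in>W1_forms p (q - 1) U. weak_dbar p (q - 1) U g f"
proof -
  define E where "E = {(f, f'). f \<in> W1_cocycles p q U \<and> f' \<in> W1_cocycles p q U \<and> form_diff f f' \<in> W1_coboundaries p q U}"
  have z: "form_zero \<in> W1_cocycles p q U"
    by (simp add: W1_cocycles_def form_zero_W1 weak_dbar_zero)
  have fz: "form_diff form_zero form_zero = form_zero" by (simp add: form_diff_def form_zero_def)
  have "\<exists>g\<in>W1_forms p (q - 1) U. weak_dbar p (q - 1) U g form_zero"
    using weak_dbar_zero form_zero_W1 by blast
  then have "form_diff form_zero form_zero \<in> W1_coboundaries p q U"
    unfolding fz W1_coboundaries_def
    using assms(2) form_zero_W1[of p q U] by simp
  then have "(form_zero, form_zero) \<in> E" using z by (simp add: E_def)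
  moreover obtain X where "W1_cohomology p q U = {X}"
    using assms(1) unfolding W1_cohomology_vanishes_def is_singleton_def by blast
  then have "W1_cocycles p q U // E = {X}" unfolding W1_cohomology_def E_def .
  then have "E `` {f} = X" "E `` {form_zero} = X"
    using quotientI[OF assms(3), of E] quotientI[OF z, of E] by auto
  ultimately have "(f, form_zero) \<in> E" by blast
  then have "form_diff f form_zero \<in> W1_coboundaries p q U" by (simp add: E_def)
  moreover have "form_diff f form_zero = f" by (simp add: form_diff_def form_zero_def)
  ultimately show ?thesis using assms(2) by (simp add: W1_coboundaries_def)
qed

text \<open>The primitive on \<open>V\<close> is extended coefficient by coefficient. The dbar of the extension is a
  square integrable form on the whole space, and it equals \<open>f\<close> on \<open>V\<close> by uniqueness of weak derivatives.\<close>

lemma lipschitz_domain_vanishing: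
  fixes V :: "(complex^('n::{finite,linorder})) set"
  assumes V: "lipschitz_domain V" "bounded V" and q: "q \<noteq> 0" and van: "W1_cohomology_vanishes p q V"
  shows "compact_W1_cohomology_vanishes p q (closure V)"
proof -
  have op: "open V" and lb: "lipschitz_boundary V" using V(1) by (auto simp: lipschitz_domain_def)
  have Vl: "V \<in> sets lebesgue" using op by simp
  have "\<exists>u\<in>W1_forms p (q - 1) UNIV. dbar_eq_on p (q - 1) (closure V) u f"
    if f: "f \<in> W1_forms p q UNIV" and "dbar_eq_on p q (closure V) f form_zero" for f :: "'n form"
  proof -
    obtain h where h: "h \<in> L2_forms p (Suc q) UNIV" "weak_dbar p q UNIV f h" "form_eq_on p (Suc q) (closure V) h form_zero"
      using \<open>dbar_eq_on p q (closure V) f form_zero\<close> unfolding dbar_eq_on_def by blast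
    have "weak_dbar p q V f form_zero"
      unfolding weak_dbar_iff[OF Vl]
    proof (intro allI impI ballI)
      fix I L :: "'n set" and \<phi> :: "complex^('n::{finite,linorder}) \<Rightarrow> complex"
      assume IL: "card I = p \<and> card L = Suc q" and \<phi>: "\<phi> \<in> test_functions V"
      have "(\<Sum>k\<in>L. (-1) ^ (p + card {l\<in>L. l < k}) * pairing (f I (L - {k})) (zbar_derivative k \<phi>)) = - pairing (h I L) \<phi>"
        using weak_dbar_mono[OF h(2) subset_UNIV open_UNIV op, unfolded weak_dbar_iff[OF Vl], rule_format, OF IL \<phi>] .
      also have "pairing (h I L) \<phi> = pairing (form_zero I L) \<phi>"
      proof (rule pairing_cong_AE)
        show "h I L \<in> borel_measurable lebesgue"
          using h(1) IL by (auto simp: L2_forms_def L2_UNIV_iff l2_measurable)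
        show "form_zero I L \<in> borel_measurable lebesgue" by (simp add: form_zero_def)
        show "\<phi> \<in> borel_measurable lebesgue" by (rule test_measurable[OF \<phi>])
        then show "\<phi> \<in> borel_measurable lebesgue" .
        have "AE x in lebesgue. x \<in> closure V \<longrightarrow> h I L x = form_zero I L x"
          using form_eq_onD[OF h(3)] IL by blast
        then show "AE x in lebesgue. h I L x * \<phi> x = form_zero I L x * \<phi> x"
        proof eventually_elim
          case (elim x)
          show ?case
          proof (cases "x \<in> V")
            case True
            then show ?thesis using elim closure_subset by (metis subsetD)
          qed (simp add: test_zero_outside[OF \<phi>])
        qed
      qed
      finally show "(\<Sum>k\<in>L. (-1) ^ (p + card {l\<in>L. l < k}) * pairing (f I (L - {k})) (zbar_derivative k \<phi>)) = - pairing (form_zero I L) \<phi>" .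
    qed
    then have "f \<in> W1_cocycles p q V"
      using f W1_restrict[OF _ op] by (auto simp: W1_cocycles_def W1_forms_def)
    then obtain g where g: "g \<in> W1_forms p (q - 1) V" "weak_dbar p (q - 1) V g f"
      using cocycle_is_coboundary[OF van q] by blast
    have "\<forall>I J. \<exists>F. card I = p \<and> card J = q - 1 \<longrightarrow> F \<in> W1 UNIV \<and> (\<forall>x\<in>V. F x = g I J x)"
    proof (intro allI)
      fix I J :: "'n set"
      show "\<exists>F. card I = p \<and> card J = q - 1 \<longrightarrow> F \<in> W1 UNIV \<and> (\<forall>x\<in>V. F x = g I J x)"
      proof (cases "card I = p \<and> card J = q - 1")
        case True
        then have "g I J \<in> W1 V" using g(1) by (simp add: W1_forms_def)
        then show ?thesis using W1_extension[OF op V(2) lb] by metis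
      qed auto
    qed
    then obtain u where u: "\<And>I J. card I = p \<Longrightarrow> card J = q - 1 \<Longrightarrow> u I J \<in> W1 UNIV"
      "\<And>I J x. card I = p \<Longrightarrow> card J = q - 1 \<Longrightarrow> x \<in> V \<Longrightarrow> u I J x = g I J x" by metis
    have uW: "u \<in> W1_forms p (q - 1) UNIV" using u(1) by (simp add: W1_forms_def)
    obtain hu where hu: "hu \<in> L2_forms p (Suc (q - 1)) UNIV" "weak_dbar p (q - 1) UNIV u hu"
      using W1_forms_dbar[OF uW] by blast
    have "weak_dbar p (q - 1) V u f"
      unfolding weak_dbar_iff[OF Vl]
    proof (intro allI impI ballI)
      fix I L :: "'n set" and \<phi> :: "complex^('n::{finite,linorder}) \<Rightarrow> complex"
      assume IL: "card I = p \<and> card L = Suc (q - 1)" and \<phi>: "\<phi> \<in> test_functions V"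
      have "pairing (u I (L - {k})) (zbar_derivative k \<phi>) = pairing (g I (L - {k})) (zbar_derivative k \<phi>)" if k: "k \<in> L" for k
      proof (rule pairing_cong)
        fix x show "u I (L - {k}) x * zbar_derivative k \<phi> x = g I (L - {k}) x * zbar_derivative k \<phi> x"
          using u(2)[of I "L - {k}" x] test_zero_outside[OF test_zbar[OF \<phi>], of x k] IL k by (cases "x \<in> V") auto
      qed
      then show "(\<Sum>k\<in>L. (-1) ^ (p + card {l\<in>L. l < k}) * pairing (u I (L - {k})) (zbar_derivative k \<phi>)) = - pairing (f I L) \<phi>"
        using g(2)[unfolded weak_dbar_iff[OF Vl], rule_format, OF IL \<phi>] by simp
    qed
    moreover have "weak_dbar p (q - 1) V u hu" by (rule weak_dbar_mono[OF hu(2) subset_UNIV open_UNIV op])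
    moreover have "f \<in> L2_forms p (Suc (q - 1)) UNIV" using W1_forms_L2[OF f] q by simp
    ultimately have eq: "form_eq_on p (Suc (q - 1)) V hu f" using weak_dbar_unique[OF op _ _ hu(1)] by blast
    have fr: "AE x in lebesgue. x \<notin> frontier V"
      by (rule AE_not_in[OF negligible_lipschitz_frontier[OF op V(2) lb]])
    have "form_eq_on p (Suc (q - 1)) (closure V) hu f"
      unfolding form_eq_on_def
    proof (intro allI impI)
      fix I J :: "'n set" assume "card I = p \<and> card J = Suc (q - 1)"
      then have "AE x in lebesgue. x \<in> V \<longrightarrow> hu I J x = f I J x" using form_eq_onD[OF eq] by blast
      then show "AE x in lebesgue. x \<in> closure V \<longrightarrow> hu I J x = f I J x"
        using fr by eventually_elim (use op in \<open>auto simp: frontier_def interior_open\<close>)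
    qed
    then have "dbar_eq_on p (q - 1) (closure V) u f" unfolding dbar_eq_on_def using hu by blast
    then show ?thesis using uW by blast
  qed
  then show ?thesis using q by (simp add: compact_W1_cohomology_vanishes_def)
qed

theorem corollary4p1:
  fixes K :: "(complex^'n::{finite,linorder}) set"
    and V :: "nat \<Rightarrow> (complex^'n::{finite,linorder}) set"
    and N :: nat
  assumes "CARD('n) \<ge> 2"
    and "regular_compact K"
    and "connected (- K)"
    and "K = (\<Inter>j\<in>{1..N}. closure (V j))"
    and "\<And>j. j \<in> {1..N} \<Longrightarrow> bounded (V j)"
    and "\<And>j. j \<in> {1..N} \<Longrightarrow> lipschitz_domain (V j)"
    and "\<And>j. j \<in> {1..N} \<Longrightarrow> W1_cohomology_vanishes 0 (CARD('n) - 1) (V j)"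
    and "\<And>j. j \<in> {1..N} \<Longrightarrow> connected (- V j)"
    and "\<And>i j. i \<in> {1..N} \<Longrightarrow> j \<in> {1..N} \<Longrightarrow> connected (- (V i \<union> V j))"
  shows "compact_W1_cohomology_vanishes 0 (CARD('n) - 1) K"
proof -
  have q: "CARD('n) - 1 \<noteq> 0" using assms(1) by simp
  have "compact K" using assms(2) by (simp add: regular_compact_def)
  then have "{1..N} \<noteq> {}"
    using assms(4) not_bounded_UNIV compact_imp_bounded by fastforce
  have single: "compact_W1_cohomology_vanishes 0 (CARD('n) - 1) (closure (V j))" if "j \<in> {1..N}" for j
    by (rule lipschitz_domain_vanishing[OF assms(6)[OF that] assms(5)[OF that] q assms(7)[OF that]])
  have "compact_W1_cohomology_vanishes 0 (CARD('n) - 1) (\<Inter>j\<in>S. closure (V j))"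
    if "finite S" "S \<noteq> {}" "S \<subseteq> {1..N}" for S
    using that
  proof (induction S rule: finite_ne_induct)
    case (singleton j)
    then show ?case using single[of j] by simp
  next
    case (insert j S)
    then have j: "j \<in> {1..N}" and S: "S \<subseteq> {1..N}" by auto
    obtain i where i: "i \<in> S" using insert.hyps by blast
    have "i \<in> {1..N}" using i S by blast
    then have "bounded (closure (V i))" by (rule bounded_closure[OF assms(5)])
    then have b: "bounded (\<Inter>j\<in>S. closure (V j))" by (rule bounded_subset) (use i in blast)
    have "compact_W1_cohomology_vanishes 0 (CARD('n) - 1) ((\<Inter>j\<in>S. closure (V j)) \<inter> closure (V j))"
      by (rule Mayer_Vietoris_vanishing[OF assms(1) b _ _ insert.IH[OF S] single[OF j]])
         (use assms(5)[OF j] in auto)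
    then show ?case by (simp add: Int_commute)
  qed
  then show ?thesis using \<open>{1..N} \<noteq> {}\<close> assms(4) by simp
qed

end
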